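(* Let $0<\alpha<1$ and $\varphi(z)=(1+(1-z)^{\alpha})^{-1}$ for $z$ in the unit disc $\mathbb{D}$ (principal branch of the power). Then \[ \exp\Big(-\pi(1-\alpha)\sqrt{2n/\alpha}\Big)\ll a_n(C_\varphi)\ll \exp\Big(-\pi(1-\alpha)\sqrt{n/(2\alpha)}\Big). \]
   Context: $C_\varphi f=f\circ\varphi$ acting on the Hardy space $H^2$ of the unit disc; $a_n(T)$ is the $n$th approximation number (operator-norm distance from $T$ to operators of rank $<n$). $f(n)\ll g(n)$ means $f(n)\le Cg(n)$ for all $n$ with a constant $C$ independent of $n$. *)

theory Defs
  imports "HOL-Analysis.Analysis"
begin

text \<open>Hardy space H^2 of the unit disc. Elements are represented by functions
  holomorphic on the open unit disc, normalised to be 0 outside the disc, whose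
  Taylor coefficients at 0 are square summable.\<close>

definition h2_coeff :: "(complex \<Rightarrow> complex) \<Rightarrow> nat \<Rightarrow> complex" where
  "h2_coeff f n = (deriv ^^ n) f 0 / fact n"

definition H2 :: "(complex \<Rightarrow> complex) set" where
  "H2 = {f. f holomorphic_on ball 0 1 \<and> (\<forall>z. z \<notin> ball 0 1 \<longrightarrow> f z = 0)
            \<and> summable (\<lambda>n. (norm (h2_coeff f n))\<^sup>2)}"

definition h2_norm :: "(complex \<Rightarrow> complex) \<Rightarrow> real" where
  "h2_norm f = sqrt (\<Sum>n. (norm (h2_coeff f n))\<^sup>2)"

definition comp_op :: "(complex \<Rightarrow> complex) \<Rightarrow> (complex \<Rightarrow> complex) \<Rightarrow> (complex \<Rightarrow> complex)" where
  "comp_op \<phi> f = (\<lambda>z. if z \<in> ball 0 1 then f (\<phi> z) else 0)"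

definition h2_op_norm :: "((complex \<Rightarrow> complex) \<Rightarrow> (complex \<Rightarrow> complex)) \<Rightarrow> real" where
  "h2_op_norm T = Sup {h2_norm (T f) | f. f \<in> H2 \<and> h2_norm f \<le> 1}"

definition h2_bounded_linear :: "((complex \<Rightarrow> complex) \<Rightarrow> (complex \<Rightarrow> complex)) \<Rightarrow> bool" where
  "h2_bounded_linear R \<longleftrightarrow>
     (\<forall>f\<in>H2. R f \<in> H2) \<and>
     (\<forall>f\<in>H2. \<forall>g\<in>H2. R (\<lambda>z. f z + g z) = (\<lambda>z. R f z + R g z)) \<and>
     (\<forall>c. \<forall>f\<in>H2. R (\<lambda>z. c * f z) = (\<lambda>z. c * R f z)) \<and>
     (\<exists>C. \<forall>f\<in>H2. h2_norm (R f) \<le> C * h2_norm f)"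

definition h2_rank_less :: "((complex \<Rightarrow> complex) \<Rightarrow> (complex \<Rightarrow> complex)) \<Rightarrow> nat \<Rightarrow> bool" where
  "h2_rank_less R n \<longleftrightarrow>
     (\<exists>gs. length gs < n \<and> set gs \<subseteq> H2 \<and>
        (\<forall>f\<in>H2. \<exists>c::nat \<Rightarrow> complex. R f = (\<lambda>z. \<Sum>i<length gs. c i * (gs ! i) z)))"

definition approx_number :: "((complex \<Rightarrow> complex) \<Rightarrow> (complex \<Rightarrow> complex)) \<Rightarrow> nat \<Rightarrow> real" where
  "approx_number T n =
     Inf {h2_op_norm (\<lambda>f z. T f z - R f z) | R. h2_bounded_linear R \<and> h2_rank_less R n}"

end

theory Submission
  imports Defs "HOL-Complex_Analysis.Complex_Analysis"
begin

text \<open>Upper bound: for a finite Blaschke product \<open>B\<close> with \<open>N\<close> zeros every \<open>f \<in> H\<^sup>2\<close> is an element of an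
  \<open>N\<close>-dimensional space plus \<open>B g\<close> with \<open>\<parallel>g\<parallel> \<le> \<parallel>f\<parallel>\<close>, so \<open>a_(N+1)\<close> is at most the norm of
  \<open>g \<mapsto> (B \<circ> \<phi>) (g \<circ> \<phi>)\<close>. The image of \<open>\<phi>\<close> touches the circle only at 1 with opening \<open>\<alpha> \<pi>\<close>; in logarithmic
  coordinates at 1 it is a half-strip inside a strip of width \<open>\<pi>\<close>. Placing real zeros there with linearly
  decreasing density balances \<open>|B|\<close> against the weight \<open>|1 - z| powr ((\<alpha> - 1) / 2)\<close> that the composition
  operator tolerates. Replacing the density by points costs a bounded factor, and the effect of the end of the
  half-strip is repaired by \<open>O(\<surd>n)\<close> additional zeros at the origin, which again costs a bounded factor.

  Lower bound: for \<open>n \<le> 2 K + 1\<close> an operator of rank \<open>< n\<close> kills a nonzero combination \<open>f\<close> of the functions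
  \<open>(1 - \<zeta>) powr (\<eta> - 1/2 + i \<kappa> k)\<close>, \<open>|k| \<le> K\<close>. On two rays at 1 inside the image of \<open>\<phi>\<close> these are
  exponentials in the logarithmic coordinate, so the coefficients of \<open>f\<close>, and with them \<open>\<parallel>f\<parallel>\<close>, are recovered
  by a discrete Fourier transform from point values of \<open>f \<circ> \<phi>\<close>. Polynomial losses are harmless because this
  yields an exponent strictly smaller than the claimed one, which is twice that of the upper bound.\<close>

section \<open>The Hardy space\<close>

text \<open>The square root in the exponent comes from a balance that also fixes the density of
  zeros. With \<open>v\<close> the half-plane coordinate of the image point, |v| is comparable to |1
  - z| powr \<alpha>, so the tolerated weight is |v| powr (-\<beta>) with \<beta> = (1 - \<alpha>) /
  (2 \<alpha>), and -ln |B| has to follow \<beta> (A - x), where x = -ln |v|. One zero contributes a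
  bump \<open>G\<close> of total mass pi^2 (1 - \<alpha>) / 2, which forces the slope 1 / (\<alpha>
  pi^2) of the density. Filling [0, A] takes N = A^2 / (2 \<alpha> pi^2) zeros, and exp (-\<beta> A)
  is the claimed rate. In the lower bound, sampling a logarithmic window of length L costs exp
  (\<beta> L) by point evaluation. The window resolves frequencies with spacing 2 pi / L. The norms
  of the test functions grow like exp (pi/2 |Im s|), but the rays give back only exp (\<alpha>^2
  pi/2 |Im s|), which for |k| <= K costs exp (pi^2 K (1 - \<alpha>^2) / L). With K about n/2 the two
  costs balance at L of order sqrt n.\<close>

lemma H2_holomorphic: "f \<in> H2 \<Longrightarrow> f holomorphic_on ball 0 1"
  by (simp add: H2_def)

lemma H2_outside: "f \<in> H2 \<Longrightarrow> z \<notin> ball 0 1 \<Longrightarrow> f z = 0"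
  by (auto simp: H2_def)

lemma h2_norm_nonneg: "f \<in> H2 \<Longrightarrow> 0 \<le> h2_norm f"
  by (simp add: H2_def h2_norm_def suminf_nonneg)

lemma H2_partial_sum_le:
  assumes "f \<in> H2"
  shows "(\<Sum>n<m. (norm (h2_coeff f n))\<^sup>2) \<le> (h2_norm f)\<^sup>2"
proof -
  have s: "summable (\<lambda>n. (norm (h2_coeff f n))\<^sup>2)" using assms by (simp add: H2_def)
  have "(h2_norm f)\<^sup>2 = (\<Sum>n. (norm (h2_coeff f n))\<^sup>2)"
    unfolding h2_norm_def by (simp add: suminf_nonneg[OF s])
  then show ?thesis using sum_le_suminf[OF s, of "{..<m}"] by simp
qed

text \<open>Membership and norm bound come together from partial sums, so later norm estimates are
  bounds on finite sums of coefficients.\<close>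

lemma H2_I:
  assumes "f holomorphic_on ball 0 1" and "\<And>z. z \<notin> ball 0 1 \<Longrightarrow> f z = 0" and "0 \<le> B"
    and "\<And>m. (\<Sum>n<m. (norm (h2_coeff f n))\<^sup>2) \<le> B\<^sup>2"
  shows "f \<in> H2 \<and> h2_norm f \<le> B"
proof -
  have s: "summable (\<lambda>n. (norm (h2_coeff f n))\<^sup>2)"
    by (rule summableI_nonneg_bounded[OF _ assms(4)]) simp
  have "(\<Sum>n. (norm (h2_coeff f n))\<^sup>2) \<le> B\<^sup>2"
    by (rule suminf_le_const[OF s assms(4)])
  then have "h2_norm f \<le> B"
    unfolding h2_norm_def by (simp add: assms(3) real_le_lsqrt)
  then show ?thesis using s assms by (auto simp: H2_def)
qed

section \<open>Taylor coefficients: linearity and uniqueness\<close>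

lemma h2_coeff_add:
  assumes "f holomorphic_on ball 0 1" "g holomorphic_on ball 0 1"
  shows "h2_coeff (\<lambda>z. f z + g z) n = h2_coeff f n + h2_coeff g n"
  unfolding h2_coeff_def by (subst higher_deriv_add[OF assms]) (auto simp: add_divide_distrib)

lemma h2_coeff_cmult:
  assumes "f holomorphic_on ball 0 1"
  shows "h2_coeff (\<lambda>z. c * f z) n = c * h2_coeff f n"
  unfolding h2_coeff_def by (subst higher_deriv_cmult[OF assms]) auto

lemma h2_coeff_sums:
  assumes "f holomorphic_on ball 0 1" "norm z < 1"
  shows "(\<lambda>n. h2_coeff f n * z ^ n) sums f z"
  using holomorphic_power_series[OF assms(1), of z] assms(2) by (simp add: h2_coeff_def)

text \<open>Identifies \<open>h2_coeff\<close> for a function known only through its series, which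
  is how the Blaschke quotient is defined later; uniqueness of formal power series does the
  work.\<close>

lemma power_series_h2_coeff:
  assumes "\<And>z. norm z < 1 \<Longrightarrow> (\<lambda>n. a n * z ^ n) sums f z"
  shows "f holomorphic_on ball 0 1" and "h2_coeff f n = a n"
proof -
  show hol: "f holomorphic_on ball 0 1"
    using power_series_holomorphic[of 0 1 a f] assms by auto
  have "f has_fps_expansion fps_expansion f 0"
    by (rule has_fps_expansion_fps_expansion[OF open_ball _ hol]) simp
  moreover have "f has_fps_expansion Abs_fps a"
    unfolding has_fps_expansion_def
  proof
    have "conv_radius a \<ge> 1"
    proof (rule conv_radius_geI_ex')
      fix r :: real assume "0 < r" "ereal r < 1"
      then show "summable (\<lambda>n. a n * of_real r ^ n)"
        using assms[of "of_real r"] by (auto simp: sums_iff)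
    qed
    then show "0 < fps_conv_radius (Abs_fps a)"
      by (auto simp: fps_conv_radius_def intro: less_le_trans[of 0 "1::ereal"])
    have "eventually (\<lambda>z. z \<in> ball 0 1) (nhds (0::complex))"
      by (rule eventually_nhds_in_open) auto
    then show "\<forall>\<^sub>F z in nhds 0. eval_fps (Abs_fps a) z = f z"
      by eventually_elim (use assms in \<open>auto simp: eval_fps_def sums_iff\<close>)
  qed
  ultimately have "fps_expansion f 0 = Abs_fps a"
    using fps_expansion_unique_complex by blast
  then show "h2_coeff f n = a n"
    by (metis fps_nth_Abs_fps fps_expansion_def h2_coeff_def)
qed

section \<open>Arithmetic of the norm\<close>

lemma h2_norm_cmult:
  assumes "f \<in> H2"
  shows "(\<lambda>z. c * f z) \<in> H2" and "h2_norm (\<lambda>z. c * f z) = norm c * h2_norm f"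
proof -
  have s: "summable (\<lambda>n. (norm (h2_coeff f n))\<^sup>2)" and hol: "f holomorphic_on ball 0 1"
    using assms by (auto simp: H2_def)
  have eq: "(norm (h2_coeff (\<lambda>z. c * f z) n))\<^sup>2 = (norm c)\<^sup>2 * (norm (h2_coeff f n))\<^sup>2" for n
    by (simp add: h2_coeff_cmult[OF hol] norm_mult power_mult_distrib)
  show "(\<lambda>z. c * f z) \<in> H2"
    using assms by (auto simp: H2_def eq intro!: holomorphic_intros summable_mult)
  show "h2_norm (\<lambda>z. c * f z) = norm c * h2_norm f"
    by (simp add: h2_norm_def eq suminf_mult[OF s] real_sqrt_mult)
qed

lemma h2_norm_add:
  assumes "f \<in> H2" "g \<in> H2"
  shows "(\<lambda>z. f z + g z) \<in> H2 \<and> h2_norm (\<lambda>z. f z + g z) \<le> h2_norm f + h2_norm g"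
proof (rule H2_I)
  show "(\<lambda>z. f z + g z) holomorphic_on ball 0 1"
    by (intro holomorphic_intros H2_holomorphic assms)
  show "0 \<le> h2_norm f + h2_norm g" by (simp add: h2_norm_nonneg assms)
  fix m
  have L: "L2_set (\<lambda>n. norm (h2_coeff f n)) {..<m} \<le> h2_norm f" if "f \<in> H2" for f
    unfolding L2_set_def using H2_partial_sum_le[OF that] h2_norm_nonneg[OF that] by (simp add: real_le_lsqrt)
  have "L2_set (\<lambda>n. norm (h2_coeff (\<lambda>z. f z + g z) n)) {..<m}
      \<le> L2_set (\<lambda>n. norm (h2_coeff f n) + norm (h2_coeff g n)) {..<m}"
    by (rule L2_set_mono) (auto simp: h2_coeff_add assms H2_holomorphic norm_triangle_ineq)
  also have "\<dots> \<le> L2_set (\<lambda>n. norm (h2_coeff f n)) {..<m} + L2_set (\<lambda>n. norm (h2_coeff g n)) {..<m}"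
    by (rule L2_set_triangle_ineq)
  also have "\<dots> \<le> h2_norm f + h2_norm g" using L assms by (intro add_mono) auto
  finally have "(L2_set (\<lambda>n. norm (h2_coeff (\<lambda>z. f z + g z) n)) {..<m})\<^sup>2 \<le> (h2_norm f + h2_norm g)\<^sup>2"
    by (rule power_mono) simp
  then show "(\<Sum>n<m. (norm (h2_coeff (\<lambda>z. f z + g z) n))\<^sup>2) \<le> (h2_norm f + h2_norm g)\<^sup>2"
    by (simp add: L2_set_def sum_nonneg)
qed (simp add: H2_outside[OF assms(1)] H2_outside[OF assms(2)])

lemma h2_norm_diff:
  assumes "f \<in> H2" "g \<in> H2"
  shows "(\<lambda>z. f z - g z) \<in> H2 \<and> h2_norm (\<lambda>z. f z - g z) \<le> h2_norm f + h2_norm g"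
  using h2_norm_add[OF assms(1) h2_norm_cmult(1)[OF assms(2), of "-1"]]
    h2_norm_cmult(2)[OF assms(2), of "-1"] by simp

lemma zero_H2: "(\<lambda>z. 0) \<in> H2" and h2_norm_zero: "h2_norm (\<lambda>z. 0) = 0"
  by (auto simp: H2_def h2_norm_def h2_coeff_def)

lemma H2_sum:
  assumes "finite I" "\<And>i. i \<in> I \<Longrightarrow> f i \<in> H2"
  shows "(\<lambda>z. \<Sum>i\<in>I. c i * f i z) \<in> H2 \<and>
     h2_norm (\<lambda>z. \<Sum>i\<in>I. c i * f i z) \<le> (\<Sum>i\<in>I. norm (c i) * h2_norm (f i))"
  using assms
proof (induction I rule: finite_induct)
  case empty
  then show ?case by (simp add: zero_H2 h2_norm_zero)
next
  case (insert x F)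
  have "(\<lambda>z. c x * f x z) \<in> H2" "h2_norm (\<lambda>z. c x * f x z) = norm (c x) * h2_norm (f x)"
    using h2_norm_cmult insert by auto
  with insert h2_norm_add[of "\<lambda>z. c x * f x z" "\<lambda>z. \<Sum>i\<in>F. c i * f i z"] show ?case
    by (auto intro: order_trans)
qed

text \<open>Cauchy-Schwarz against the Szego kernel at z, whose squared norm is 1 / (1 - |z|^2). In
  the lower bound it controls sampled values by the norm.\<close>

lemma H2_point_evaluation:
  assumes "f \<in> H2" "norm z < 1"
  shows "(norm (f z))\<^sup>2 * (1 - (norm z)\<^sup>2) \<le> (h2_norm f)\<^sup>2"
proof -
  have "(\<lambda>n. h2_coeff f n * z ^ n) sums f z"
    by (rule h2_coeff_sums[OF H2_holomorphic[OF assms(1)] assms(2)])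
  then have lim: "(\<lambda>m. (norm (\<Sum>n<m. h2_coeff f n * z ^ n))\<^sup>2 * (1 - (norm z)\<^sup>2))
      \<longlonglongrightarrow> (norm (f z))\<^sup>2 * (1 - (norm z)\<^sup>2)"
    unfolding sums_def by (intro tendsto_intros)
  have z2: "(norm z)\<^sup>2 < 1" using assms(2) by (simp add: power_less_one_iff)
  have "(norm (\<Sum>n<m. h2_coeff f n * z ^ n))\<^sup>2 * (1 - (norm z)\<^sup>2) \<le> (h2_norm f)\<^sup>2" for m
  proof -
    have "norm (\<Sum>n<m. h2_coeff f n * z ^ n) \<le> (\<Sum>n<m. norm (h2_coeff f n) * norm z ^ n)"
      by (rule order_trans[OF norm_sum]) (simp add: norm_mult norm_power)
    then have "(norm (\<Sum>n<m. h2_coeff f n * z ^ n))\<^sup>2 \<le> (\<Sum>n<m. norm (h2_coeff f n) * norm z ^ n)\<^sup>2"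
      by (rule power_mono) simp
    also have "\<dots> \<le> (\<Sum>n<m. (norm (h2_coeff f n))\<^sup>2) * (\<Sum>n<m. (norm z ^ n)\<^sup>2)"
      by (rule Cauchy_Schwarz_ineq_sum)
    also have "\<dots> \<le> (h2_norm f)\<^sup>2 * (\<Sum>n<m. (norm z ^ n)\<^sup>2)"
      by (intro mult_right_mono H2_partial_sum_le assms sum_nonneg) auto
    finally have "(norm (\<Sum>n<m. h2_coeff f n * z ^ n))\<^sup>2 * (1 - (norm z)\<^sup>2)
        \<le> (h2_norm f)\<^sup>2 * (\<Sum>n<m. (norm z ^ n)\<^sup>2) * (1 - (norm z)\<^sup>2)"
      using z2 by (intro mult_right_mono) auto
    also have "(\<Sum>n<m. (norm z ^ n)\<^sup>2) = (\<Sum>n<m. ((norm z)\<^sup>2) ^ n)"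
      by (simp add: power_mult[symmetric] mult.commute)
    also have "(h2_norm f)\<^sup>2 * \<dots> * (1 - (norm z)\<^sup>2) = (h2_norm f)\<^sup>2 * (1 - ((norm z)\<^sup>2) ^ m)"
      using one_diff_power_eq[of "(norm z)\<^sup>2" m] by (simp add: mult.commute mult.left_commute)
    also have "\<dots> \<le> (h2_norm f)\<^sup>2 * 1"
      by (intro mult_left_mono) auto
    finally show ?thesis by simp
  qed
  then show ?thesis by (intro LIMSEQ_le_const2[OF lim]) auto
qed

section \<open>Coefficients and means over circles\<close>

lemma h2_coeff_circle_integral:
  assumes hol: "F holomorphic_on ball 0 1" and r: "0 < r" "r < 1"
  shows "((\<lambda>t. F (of_real r * cis (2 * pi * t)) * cis (- (2 * pi * t)) ^ n)
           has_integral (h2_coeff F n * of_real r ^ n)) {0..1}"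
proof -
  have sub: "cball 0 r \<subseteq> ball (0::complex) 1" using r by auto
  have "((\<lambda>u. F u / (u - 0) ^ Suc n) has_contour_integral
      ((2 * pi * \<i>) / (fact n) * (deriv ^^ n) F 0)) (circlepath 0 r)"
    using r sub ball_subset_cball[of "0::complex" r] hol
    by (intro Cauchy_has_contour_integral_higher_derivative_circlepath)
      (auto intro: holomorphic_on_subset holomorphic_on_imp_continuous_on)
  then have "((\<lambda>t. F (circlepath 0 r t) / circlepath 0 r t ^ Suc n *
        vector_derivative (circlepath 0 r) (at t)) has_integral
      ((2 * pi * \<i>) / (fact n) * (deriv ^^ n) F 0)) {0..1}"
    by (simp add: has_contour_integral)
  from has_integral_mult_left[OF this, of "of_real r ^ n / (2 * pi * \<i>)"]
  have I: "((\<lambda>t. F (circlepath 0 r t) / circlepath 0 r t ^ Suc n *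
        vector_derivative (circlepath 0 r) (at t) * (of_real r ^ n / (2 * pi * \<i>)))
     has_integral (h2_coeff F n * of_real r ^ n)) {0..1}"
    by (simp add: h2_coeff_def)
  show ?thesis
  proof (rule has_integral_eq[OF _ I])
    fix t :: real
    have e: "exp (2 * complex_of_real pi * \<i> * t) = cis (2 * pi * t)"
      by (simp add: cis_conv_exp mult_ac)
    have c: "circlepath 0 r t = of_real r * cis (2 * pi * t)"
      by (simp add: circlepath e)
    have v: "vector_derivative (circlepath 0 r) (at t) = 2 * pi * \<i> * r * cis (2 * pi * t)"
      by (simp add: vector_derivative_circlepath e)
    have n0: "cis (2 * pi * t) \<noteq> 0" by simp
    have inv: "cis (- (2 * pi * t)) = inverse (cis (2 * pi * t))"
      by simp
    show "F (circlepath 0 r t) / circlepath 0 r t ^ Suc n *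
        vector_derivative (circlepath 0 r) (at t) * (of_real r ^ n / (2 * pi * \<i>))
      = F (of_real r * cis (2 * pi * t)) * cis (- (2 * pi * t)) ^ n"
      unfolding c v inv power_inverse using r n0
      by (simp add: power_mult_distrib divide_simps del: cis_inverse)
  qed
qed

text \<open>Expand the mean of |F - P|^2 >= 0 for the Taylor polynomial P of degree below m: the
  cross term and |P|^2 both have mean \<open>q\<close>.\<close>

lemma bessel_circle:
  assumes hol: "F holomorphic_on ball 0 1" and r: "0 < r" "r < 1"
  shows "(\<Sum>n<m. (norm (h2_coeff F n))\<^sup>2 * r ^ (2 * n))
       \<le> integral {0..1} (\<lambda>t. (norm (F (of_real r * cis (2 * pi * t))))\<^sup>2)"
proof -
  define a where "a = h2_coeff F"
  define P where "P = (\<lambda>z. \<Sum>n<m. a n * z ^ n)"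
  define G where "G = (\<lambda>G t. G (of_real r * cis (2 * pi * t)) :: complex)"
  define q where "q = (\<Sum>n<m. (norm (a n))\<^sup>2 * r ^ (2 * n))"
  have holP: "P holomorphic_on ball 0 1"
    unfolding P_def by (intro holomorphic_intros)
  have coeffP: "h2_coeff P n = a n" if "n < m" for n
  proof -
    have "h2_coeff P n = (if n < m then a n else 0)"
    proof (rule power_series_h2_coeff(2))
      fix z :: complex
      have "(\<lambda>n. if n \<in> {..<m} then a n * z ^ n else 0) sums (\<Sum>n<m. a n * z ^ n)"
        by (rule sums_If_finite_set) simp
      then show "(\<lambda>n. (if n < m then a n else 0) * z ^ n) sums P z"
        by (simp add: P_def if_distrib[of "\<lambda>x. x * _"] cong: if_cong)
    qed
    then show ?thesis using that by simp
  qed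
  \<comment> \<open>Applied with H = F and with H = P: pairing with P sees only the first m
    coefficients, where the two agree.\<close>
  have inner: "((\<lambda>t. G H t * cnj (G P t)) has_integral (of_real q)) {0..1}"
    if "H holomorphic_on ball 0 1" "\<And>n. n < m \<Longrightarrow> h2_coeff H n = a n" for H
  proof -
    have "((\<lambda>t. \<Sum>n<m. cnj (a n) * of_real r ^ n * (G H t * cis (- (2 * pi * t)) ^ n))
        has_integral (\<Sum>n<m. cnj (a n) * of_real r ^ n * (h2_coeff H n * of_real r ^ n))) {0..1}"
      unfolding G_def
      by (intro has_integral_sum has_integral_mult_right h2_coeff_circle_integral that r) auto
    moreover have "(\<Sum>n<m. cnj (a n) * of_real r ^ n * (h2_coeff H n * of_real r ^ n)) = of_real q"
      unfolding q_def of_real_sum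
    proof (intro sum.cong refl)
      fix n assume "n \<in> {..<m}"
      moreover have "cnj (a n) * a n = of_real ((norm (a n))\<^sup>2)"
        using complex_norm_square[of "a n"] by (simp add: mult.commute)
      moreover have "complex_of_real r ^ n * of_real r ^ n = of_real (r ^ (2 * n))"
        by (simp add: power_add[symmetric] mult_2)
      ultimately show "cnj (a n) * of_real r ^ n * (h2_coeff H n * of_real r ^ n)
          = of_real ((norm (a n))\<^sup>2 * r ^ (2 * n))"
        using that(2) by (simp add: mult_ac)
    qed
    moreover have "(\<lambda>t. \<Sum>n<m. cnj (a n) * of_real r ^ n * (G H t * cis (- (2 * pi * t)) ^ n))
        = (\<lambda>t. G H t * cnj (G P t))"
      by (auto simp: G_def P_def sum_distrib_left cis_cnj power_mult_distrib mult_ac intro!: sum.cong)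
    ultimately show ?thesis by simp
  qed
  have contG: "continuous_on {0..1} (G H)" if "H holomorphic_on ball 0 1" for H
    unfolding G_def
    by (rule continuous_on_compose2[OF holomorphic_on_imp_continuous_on[OF that]])
      (use r in \<open>auto intro!: continuous_intros simp: norm_mult\<close>)
  have FF: "((\<lambda>t. (norm (G F t))\<^sup>2) has_integral integral {0..1} (\<lambda>t. (norm (G F t))\<^sup>2)) {0..1}"
    by (intro integrable_integral integrable_continuous_real continuous_intros contG hol)
  have FP: "((\<lambda>t. Re (G F t * cnj (G P t))) has_integral q) {0..1}"
    using has_integral_Re[OF inner[OF hol]] by (simp add: a_def)
  have PP: "((\<lambda>t. Re (G P t * cnj (G P t))) has_integral q) {0..1}"
    using has_integral_Re[OF inner[OF holP coeffP]] by simp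
  have "((\<lambda>t. (norm (G F t))\<^sup>2 - 2 * Re (G F t * cnj (G P t)) + Re (G P t * cnj (G P t)))
      has_integral (integral {0..1} (\<lambda>t. (norm (G F t))\<^sup>2) - 2 * q + q)) {0..1}"
    by (intro has_integral_add has_integral_diff has_integral_mult_right FF FP PP)
  moreover have "0 \<le> (norm (G F t))\<^sup>2 - 2 * Re (G F t * cnj (G P t)) + Re (G P t * cnj (G P t))" for t
  proof -
    have "0 \<le> (norm (G F t - G P t))\<^sup>2" by simp
    then show ?thesis
      unfolding cmod_power2 by (simp add: power2_eq_square algebra_simps)
  qed
  ultimately have "0 \<le> integral {0..1} (\<lambda>t. (norm (G F t))\<^sup>2) - 2 * q + q"
    by (rule has_integral_nonneg)
  then show ?thesis by (simp add: q_def a_def G_def)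
qed

text \<open>The majorant is split as \<open>h t + h (1 - t)\<close> because the point 1 sits at both
  ends of the parameter interval. Values in \<open>ennreal\<close> admit majorants given by infinite
  series, and uniformity in r allows the passage r -> 1.\<close>

lemma circle_mean_bound:
  fixes h :: "real \<Rightarrow> ennreal"
  assumes hol: "F holomorphic_on ball 0 1" and h[measurable]: "h \<in> borel_measurable borel"
    and bound: "\<And>r t. 0 < r \<Longrightarrow> r < 1 \<Longrightarrow> 0 < t \<Longrightarrow> t < 1 \<Longrightarrow>
        ennreal ((norm (F (of_real r * cis (2 * pi * t))))\<^sup>2) \<le> h t + h (1 - t)"
    and int: "(\<integral>\<^sup>+t\<in>{0..1}. h t \<partial>lborel) \<le> ennreal B" and B: "0 \<le> B"
  shows "(\<Sum>n<m. (norm (h2_coeff F n))\<^sup>2) \<le> 2 * B"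
proof -
  have step: "(\<Sum>n<m. (norm (h2_coeff F n))\<^sup>2 * r ^ (2 * n)) \<le> 2 * B" if r: "0 < r" "r < 1" for r
  proof -
    let ?f = "\<lambda>t. (norm (F (of_real r * cis (2 * pi * t))))\<^sup>2"
    have cont: "continuous_on {0..1} ?f"
      by (intro continuous_intros continuous_on_compose2[OF holomorphic_on_imp_continuous_on[OF hol]])
        (use r in \<open>auto simp: norm_mult\<close>)
    have refl: "(\<integral>\<^sup>+t\<in>{0..1}. h (1 - t) \<partial>lborel) = (\<integral>\<^sup>+t\<in>{0..1}. h t \<partial>lborel)"
    proof -
      have "(\<integral>\<^sup>+t\<in>{0..1}. h t \<partial>lborel) = (\<integral>\<^sup>+t. h (1 - t) * indicator {0..1} (1 - t) \<partial>lborel)"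
        using nn_integral_real_affine[of "\<lambda>t. h t * indicator {0..1} t" "-1" 1] by simp
      also have "\<dots> = (\<integral>\<^sup>+t\<in>{0..1}. h (1 - t) \<partial>lborel)"
        by (intro nn_integral_cong) (auto simp: indicator_def)
      finally show ?thesis ..
    qed
    have ae: "AE t in lborel. ennreal (indicator {0..1} t * ?f t)
        \<le> h t * indicator {0..1} t + h (1 - t) * indicator {0..1} t"
    proof -
      have "AE t in lborel. t \<noteq> (0::real)" "AE t in lborel. t \<noteq> (1::real)"
        by (rule AE_lborel_singleton)+
      then show ?thesis
        by eventually_elim (use bound[OF r] in \<open>auto simp: indicator_def\<close>)
    qed
    have "ennreal (integral {0..1} ?f) = (\<integral>\<^sup>+t. ennreal (indicator {0..1} t * ?f t) \<partial>lborel)"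
      by (rule nn_integral_has_integral_lebesgue[symmetric])
        (auto intro!: integrable_integral integrable_continuous_real cont)
    also have "\<dots> \<le> (\<integral>\<^sup>+t. h t * indicator {0..1} t + h (1 - t) * indicator {0..1} t \<partial>lborel)"
      by (rule nn_integral_mono_AE[OF ae])
    also have "\<dots> = (\<integral>\<^sup>+t\<in>{0..1}. h t \<partial>lborel) + (\<integral>\<^sup>+t\<in>{0..1}. h (1 - t) \<partial>lborel)"
      by (rule nn_integral_add) measurable
    also have "\<dots> \<le> ennreal B + ennreal B"
      unfolding refl by (intro add_mono int)
    also have "\<dots> = ennreal (2 * B)" using B by (simp flip: ennreal_plus)
    finally have "integral {0..1} ?f \<le> 2 * B" using B by (subst (asm) ennreal_le_iff) auto
    then show ?thesis using bessel_circle[OF hol r, of m] by linarith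
  qed
  have "((\<lambda>r. \<Sum>n<m. (norm (h2_coeff F n))\<^sup>2 * r ^ (2 * n)) \<longlongrightarrow>
      (\<Sum>n<m. (norm (h2_coeff F n))\<^sup>2 * 1 ^ (2 * n))) (at_left 1)"
    by (intro tendsto_intros)
  moreover have "eventually (\<lambda>r. (\<Sum>n<m. (norm (h2_coeff F n))\<^sup>2 * r ^ (2 * n)) \<le> 2 * B) (at_left 1)"
    using eventually_at_left_real[of 0 "1::real"] step by (auto elim!: eventually_mono)
  ultimately show ?thesis
    using tendsto_upperbound[of _ "\<Sum>n<m. (norm (h2_coeff F n))\<^sup>2 * 1 ^ (2 * n)"] by force
qed

section \<open>Composition with the symbol\<close>

text \<open>Terms with n + 1 <= 1 / (1 - q) are dominated by differences of square roots, which
  telescope to 1 / sqrt (1 - q); beyond, 1 / sqrt (n + 1) <= sqrt (1 - q) leaves a geometric series.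
  The constant is 2 + 1.\<close>

lemma sum_power_div_sqrt_le:
  fixes q :: real
  assumes "0 \<le> q" "q < 1"
  shows "(\<Sum>n<m. q ^ n / sqrt (real n + 1)) \<le> 3 / sqrt (1 - q)"
proof -
  define d where "d = 1 - q"
  have d: "0 < d" using assms by (simp add: d_def)
  define s where "s = (\<lambda>n. if real n + 1 \<le> 1 / d then sqrt (real n + 1) - sqrt (real n) else 0)"
  have s: "(\<Sum>n<m. s n) \<le> sqrt (1 / d)" for m
  proof -
    have "(\<Sum>n<m. s n) \<le> min (sqrt (real m)) (sqrt (1 / d))"
    proof (induction m)
      case (Suc m)
      have "sqrt (real m) \<le> sqrt (real m + 1)" by simp
      moreover have "sqrt (real m + 1) \<le> sqrt (1 / d)" if "real m + 1 \<le> 1 / d"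
        using that by (rule real_sqrt_le_mono)
      ultimately have "s m \<le> min (sqrt (real m + 1)) (sqrt (1 / d)) - min (sqrt (real m)) (sqrt (1 / d))"
        by (auto simp: s_def)
      then have "sum s {..<m} + s m \<le> min (sqrt (real m + 1)) (sqrt (1 / d))" using Suc by linarith
      then show ?case by (simp add: add.commute)
    qed (use d in auto)
    then show ?thesis by simp
  qed
  have bound: "q ^ n / sqrt (real n + 1) \<le> 2 * s n + sqrt d * q ^ n" for n
  proof (cases "real n + 1 \<le> 1 / d")
    case True
    have "(sqrt (real n + 1) - sqrt (real n)) * (sqrt (real n + 1) + sqrt (real n)) = 1"
      by (simp add: algebra_simps)
    moreover have "(sqrt (real n + 1) - sqrt (real n)) * (sqrt (real n + 1) + sqrt (real n))
        \<le> (sqrt (real n + 1) - sqrt (real n)) * (2 * sqrt (real n + 1))"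
      by (rule mult_left_mono) auto
    ultimately have "1 / sqrt (real n + 1) \<le> 2 * (sqrt (real n + 1) - sqrt (real n))"
      by (simp add: field_simps)
    moreover have "q ^ n / sqrt (real n + 1) \<le> 1 / sqrt (real n + 1)"
      using assms by (intro divide_right_mono power_le_one) auto
    moreover have "0 \<le> sqrt d * q ^ n" using d assms by simp
    ultimately show ?thesis using True by (simp add: s_def)
  next
    case False
    then have "1 / (real n + 1) < d" using d by (simp add: field_simps)
    then have "1 / sqrt (real n + 1) \<le> sqrt d"
      using real_sqrt_le_mono[of "1 / (real n + 1)" d] by (simp add: real_sqrt_divide)
    then have "q ^ n * (1 / sqrt (real n + 1)) \<le> q ^ n * sqrt d"
      using assms by (intro mult_left_mono) auto
    then show ?thesis using False by (simp add: s_def mult.commute)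
  qed
  have geo: "(\<Sum>n<m. q ^ n) \<le> 1 / d"
  proof -
    have "d * (\<Sum>n<m. q ^ n) = 1 - q ^ m"
      unfolding d_def by (rule one_diff_power_eq[symmetric])
    also have "\<dots> \<le> 1" using assms by simp
    finally show ?thesis using d by (simp add: field_simps)
  qed
  have "(\<Sum>n<m. q ^ n / sqrt (real n + 1)) \<le> (\<Sum>n<m. 2 * s n + sqrt d * q ^ n)"
    by (rule sum_mono) (rule bound)
  also have "\<dots> = 2 * (\<Sum>n<m. s n) + sqrt d * (\<Sum>n<m. q ^ n)"
    by (simp add: sum.distrib sum_distrib_left)
  also have "\<dots> \<le> 2 * sqrt (1 / d) + sqrt d * (1 / d)"
    using d by (intro add_mono mult_left_mono s geo) auto
  also have "sqrt d * (1 / d) = 1 / sqrt d"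
    using d by (simp add: real_div_sqrt field_simps)
  finally show ?thesis by (simp add: real_sqrt_divide d_def)
qed

lemma two_mult_le_sin:
  assumes "0 \<le> t" "t \<le> 1/4"
  shows "2 * t \<le> sin (2 * pi * t)"
\<comment> \<open>Up to 1/6 the derivative is at least 2 pi cos (pi/3) - 2 = pi - 2 > 0; beyond, sin
  (pi/6) = 1/2 suffices since 2 t <= 1/2.\<close>
proof (cases "t \<le> 1/6")
  case True
  have "(\<lambda>t. sin (2 * pi * t) - 2 * t) 0 \<le> (\<lambda>t. sin (2 * pi * t) - 2 * t) t"
  proof (rule DERIV_nonneg_imp_nondecreasing[OF assms(1)])
    fix x assume x: "0 \<le> x" "x \<le> t"
    have "((\<lambda>t. sin (2 * pi * t) - 2 * t) has_real_derivative (cos (2 * pi * x) * (2 * pi) - 2)) (at x)"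
      by (auto intro!: derivative_eq_intros)
    moreover have "cos (2 * pi * x) * (2 * pi) - 2 \<ge> 0"
    proof -
      have "cos (pi / 3) \<le> cos (2 * pi * x)"
        using x True pi_gt_zero by (intro cos_monotone_0_pi_le) auto
      then have "1/2 * (2 * pi) \<le> cos (2 * pi * x) * (2 * pi)"
        by (intro mult_right_mono) (auto simp: cos_60)
      then show ?thesis using pi_gt3 by linarith
    qed
    ultimately show "\<exists>y. ((\<lambda>t. sin (2 * pi * t) - 2 * t) has_real_derivative y) (at x) \<and> 0 \<le> y"
      by blast
  qed
  then show ?thesis by simp
next
  case False
  have "sin (pi / 6) \<le> sin (2 * pi * t)"
    using False assms pi_gt_zero
    by (intro sin_monotone_2pi_le) (auto simp: field_simps)
  then show ?thesis using assms by (simp add: sin_30)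
qed

text \<open>Uniform in r: the line through 0 in direction exp (2 pi i t) has distance |sin (2 pi t)|
  from 1, and in the left half of the disc the real part of 1 - z is at least 1.\<close>

lemma norm_one_minus_circle_ge:
  assumes "0 < r" "r < 1" "0 < t" "t < 1"
  shows "2 * min t (1 - t) \<le> norm (1 - of_real r * cis (2 * pi * t))"
proof -
  let ?z = "1 - of_real r * cis (2 * pi * t)"
  have n: "(norm ?z)\<^sup>2 = (1 - r * cos (2 * pi * t))\<^sup>2 + (r * sin (2 * pi * t))\<^sup>2"
    by (simp add: cmod_power2)
  have eq: "(1 - r * cos x)\<^sup>2 + (r * sin x)\<^sup>2 = (r - cos x)\<^sup>2 + (sin x)\<^sup>2" for x
  proof -
    have "(r * sin x)\<^sup>2 = r\<^sup>2 * (1 - (cos x)\<^sup>2)" "(sin x)\<^sup>2 = 1 - (cos x)\<^sup>2"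
      by (auto simp: sin_squared_eq power_mult_distrib)
    then show ?thesis by (simp add: power2_eq_square algebra_simps)
  qed
  have sin_le: "\<bar>sin (2 * pi * t)\<bar> \<le> norm ?z"
    by (rule power2_le_imp_le) (auto simp: n eq)
  consider "t \<le> 1/4" | "1/4 \<le> t" "t \<le> 3/4" | "3/4 \<le> t" by linarith
  then show ?thesis
  proof cases
    case 1
    then show ?thesis using two_mult_le_sin[of t] sin_le assms by auto
  next
    case 2
    have "cos (2 * pi * t) \<le> 0"
    proof -
      have "0 \<le> cos (2 * pi * t - pi)"
        using 2 pi_gt_zero by (intro cos_ge_zero) (auto simp: field_simps)
      then show ?thesis by (simp add: cos_diff)
    qed
    then have "r * cos (2 * pi * t) \<le> 0" using assms by (simp add: mult_le_0_iff)
    then have "1 \<le> Re ?z" by simp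
    then show ?thesis using complex_Re_le_cmod[of ?z] by (auto simp: min_def split: if_splits)
  next
    case 3
    have "sin (2 * pi * (1 - t)) = - sin (2 * pi * t)"
      by (simp add: right_diff_distrib sin_diff)
    then show ?thesis using two_mult_le_sin[of "1 - t"] sin_le 3 assms by auto
  qed
qed

section \<open>The symbol and its sector\<close>

locale lens_symbol =
  fixes \<alpha> :: real
  assumes \<alpha>_pos: "0 < \<alpha>" and \<alpha>_less: "\<alpha> < 1"
begin

text \<open>Half the opening of the sector that contains w z.\<close>

definition \<theta> where "\<theta> = \<alpha> * pi / 2"

definition c where "c = cos \<theta>"

definition w where "w z = (1 - z) powr (of_real \<alpha> :: complex)"

definition \<phi> where "\<phi> z = 1 / (1 + w z)"

lemma \<theta>_bounds: "0 < \<theta>" "\<theta> < pi / 2"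
  using \<alpha>_pos \<alpha>_less by (auto simp: \<theta>_def)

lemma c_pos: "0 < c" and c_less: "c < 1"
proof -
  show "0 < c" unfolding c_def using \<theta>_bounds by (intro cos_gt_zero) auto
  have "cos \<theta> < cos 0" using \<theta>_bounds by (intro cos_monotone_0_pi) auto
  then show "c < 1" by (simp add: c_def)
qed

lemma Re_one_minus_pos: "norm z < 1 \<Longrightarrow> 0 < Re (1 - z)"
  using complex_Re_le_cmod[of z] by simp

lemma norm_w: "norm (w z) = norm (1 - z) powr \<alpha>"
  unfolding w_def by (subst norm_powr_real_powr') auto

lemma w_nonzero: "norm z < 1 \<Longrightarrow> w z \<noteq> 0"
  using Re_one_minus_pos[of z] by (auto simp: w_def)

lemma norm_w_le:
  assumes "norm z < 1" shows "norm (w z) \<le> 2"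
proof -
  have "norm (1 - z) \<le> 2" using norm_triangle_ineq4[of 1 z] assms by simp
  then have "norm (1 - z) powr \<alpha> \<le> 2 powr \<alpha>" using \<alpha>_pos by (intro powr_mono2) auto
  also have "\<dots> \<le> 2 powr 1" using \<alpha>_less by (intro powr_mono) auto
  finally show ?thesis by (simp add: norm_w)
qed

text \<open>Raising to the power \<alpha> multiplies the argument of 1 - z, which is below pi/2 in
  modulus, by \<alpha>.\<close>

lemma Re_w_ge:
  assumes "norm z < 1"
  shows "c * norm (w z) \<le> Re (w z)"
proof -
  let ?y = "1 - z"
  have nz: "?y \<noteq> 0" and re: "0 < Re ?y" using Re_one_minus_pos[OF assms] by auto
  have arg: "\<bar>Im (Ln ?y)\<bar> < pi / 2" using Re_Ln_pos_lt[OF nz] re by simp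
  have w: "w z = exp (of_real \<alpha> * Ln ?y)" using nz by (simp add: w_def powr_def)
  have "\<alpha> * \<bar>Im (Ln ?y)\<bar> \<le> \<alpha> * (pi / 2)"
    using arg \<alpha>_pos by (intro mult_left_mono) auto
  moreover have "\<alpha> * (pi / 2) \<le> 1 * (pi / 2)"
    using \<alpha>_less by (intro mult_right_mono) auto
  ultimately have "cos (\<alpha> * (pi / 2)) \<le> cos (\<alpha> * \<bar>Im (Ln ?y)\<bar>)"
    using \<alpha>_pos pi_gt_zero by (intro cos_monotone_0_pi_le) auto
  also have "\<dots> = cos (\<alpha> * Im (Ln ?y))"
    using \<alpha>_pos by (simp add: abs_if)
  finally have "c \<le> cos (\<alpha> * Im (Ln ?y))" by (simp add: c_def \<theta>_def)
  then show ?thesis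
    unfolding w by (simp add: Re_exp norm_exp_eq_Re mult_left_mono mult.commute)
qed

lemma norm_one_plus_w_ge:
  assumes "norm z < 1"
  shows "1 + c * norm (w z) \<le> norm (1 + w z)"
  using Re_w_ge[OF assms] complex_Re_le_cmod[of "1 + w z"] by simp

lemma norm_\<phi>_le:
  assumes "norm z < 1"
  shows "norm (\<phi> z) \<le> 1 / (1 + c * norm (w z))"
proof -
  have "0 < 1 + c * norm (w z)" using c_pos by (simp add: add_pos_nonneg)
  then show ?thesis
    using norm_one_plus_w_ge[OF assms] by (auto simp: \<phi>_def norm_divide intro!: frac_le)
qed

lemma norm_\<phi>_less:
  assumes "norm z < 1" shows "norm (\<phi> z) < 1"
proof -
  have "0 < c * norm (w z)" using c_pos w_nonzero[OF assms] by simp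
  then have "1 / (1 + c * norm (w z)) < 1" by (simp add: field_simps)
  then show ?thesis using norm_\<phi>_le[OF assms] by linarith
qed

lemma \<phi>_holomorphic: "\<phi> holomorphic_on ball 0 1"
proof -
  have "1 - z \<notin> \<real>\<^sub>\<le>\<^sub>0" if "z \<in> ball 0 1" for z :: complex
    using Re_one_minus_pos[of z] that complex_nonpos_Reals_iff by (auto simp: dist_norm)
  then have "w holomorphic_on ball 0 1"
    unfolding w_def by (intro holomorphic_intros) auto
  moreover have "1 + w z \<noteq> 0" if "z \<in> ball 0 1" for z :: complex
  proof -
    have "0 < 1 + c * norm (w z)" using c_pos by (simp add: add_pos_nonneg)
    then show ?thesis using norm_one_plus_w_ge[of z] that by auto
  qed
  ultimately show ?thesis unfolding \<phi>_def by (intro holomorphic_intros) auto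
qed

text \<open>The n-th term of the pointwise bound at distance t from 1, up to constants: t powr
  (\<alpha> - 1) is the weight, t powr (-\<alpha>/2) comes from the Schur sum, and the denominator
  replaces |\<phi> z| ^ n.\<close>

definition kern :: "nat \<Rightarrow> real \<Rightarrow> real" where
  "kern n t = t powr (\<alpha> / 2 - 1) / (1 + (real n + 1) * c * t powr \<alpha>)"

lemma kern_nonneg: "0 \<le> kern n t"
  unfolding kern_def using c_pos by (intro divide_nonneg_nonneg add_nonneg_nonneg mult_nonneg_nonneg) auto

lemma kern_antimono:
  assumes "0 < s" "s \<le> t" shows "kern n t \<le> kern n s"
proof -
  have "t powr (\<alpha> / 2 - 1) \<le> s powr (\<alpha> / 2 - 1)"
    using assms \<alpha>_less by (intro powr_mono2') auto
  moreover have "s powr \<alpha> \<le> t powr \<alpha>"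
    using assms \<alpha>_pos by (intro powr_mono2) auto
  ultimately show ?thesis unfolding kern_def using c_pos
    by (intro frac_le add_left_mono mult_left_mono add_pos_nonneg) auto
qed

lemma kern_measurable [measurable]: "kern n \<in> borel_measurable borel"
  unfolding kern_def by measurable

text \<open>In the variable s = t powr (\<alpha>/2) the integrand is a multiple of 1 / (1 + k s^2),
  with an arctangent as primitive. The resulting 1 / sqrt (n + 1) cancels the weight of Schur's
  test.\<close>

lemma kern_integral:
  "(\<integral>\<^sup>+t\<in>{0..1}. ennreal (kern n t) \<partial>lborel) \<le> ennreal (pi / (\<alpha> * sqrt c) / sqrt (real n + 1))"
proof -
  define k where "k = (real n + 1) * c"
  have k: "0 < k" using c_pos by (simp add: k_def)
  let ?F = "\<lambda>t. 2 / (\<alpha> * sqrt k) * arctan (sqrt k * t powr (\<alpha> / 2))"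
  have I: "(kern n has_integral (?F 1 - ?F 0)) {0..1}"
  proof (rule fundamental_theorem_of_calculus_interior)
    show "continuous_on {0..1} ?F"
      by (intro continuous_intros continuous_on_powr') (use \<alpha>_pos in auto)
    fix t :: real assume t: "t \<in> {0<..<1}"
    have "(?F has_real_derivative
       2 / (\<alpha> * sqrt k) * (inverse (1 + (sqrt k * t powr (\<alpha> / 2))\<^sup>2) * (sqrt k * (\<alpha> / 2 * t powr (\<alpha> / 2 - 1))))) (at t)"
      by (rule derivative_eq_intros refl | use t in simp)+
    moreover have "2 / (\<alpha> * sqrt k) * (inverse (1 + (sqrt k * t powr (\<alpha> / 2))\<^sup>2) * (sqrt k * (\<alpha> / 2 * t powr (\<alpha> / 2 - 1)))) = kern n t"
    proof -
      have sq: "(t powr (\<alpha> / 2))\<^sup>2 = t powr \<alpha>"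
        by (simp add: power2_eq_square powr_add[symmetric])
      have e: "(sqrt k * t powr (\<alpha> / 2))\<^sup>2 = k * t powr \<alpha>"
        using k by (simp add: power_mult_distrib sq)
      have "2 / (\<alpha> * sqrt k) * (inverse X * (sqrt k * (\<alpha> / 2 * Y))) = Y / X" for X Y
        using k \<alpha>_pos by (simp add: divide_simps)
      then show ?thesis unfolding e kern_def k_def[symmetric] .
    qed
    ultimately show "(?F has_vector_derivative kern n t) (at t)"
      by (simp add: has_real_derivative_iff_has_vector_derivative)
  qed simp
  have "(\<integral>\<^sup>+t\<in>{0..1}. ennreal (kern n t) \<partial>lborel) = (\<integral>\<^sup>+t. ennreal (indicator {0..1} t * kern n t) \<partial>lborel)"
    by (intro nn_integral_cong) (auto simp: indicator_def)
  also have "\<dots> = ennreal (?F 1 - ?F 0)"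
    by (rule nn_integral_has_integral_lebesgue[OF kern_nonneg I])
  also have "?F 1 - ?F 0 \<le> 2 / (\<alpha> * sqrt k) * (pi / 2)"
    using arctan_ubound[of "sqrt k"] k \<alpha>_pos by (auto intro!: mult_left_mono simp: field_simps)
  also have "2 / (\<alpha> * sqrt k) * (pi / 2) = pi / (\<alpha> * sqrt c) / sqrt (real n + 1)"
    unfolding k_def real_sqrt_mult by (simp add: mult_ac)
  finally show ?thesis by (simp add: ennreal_leI)
qed

text \<open>The 18 is 2 for the two ends of the parameter interval, 3 from the bound on q ^ n and 3
  from \<open>sum_power_div_sqrt_le\<close>.\<close>

definition Cw where "Cw = 18 * sqrt (3 / c) * (pi / (\<alpha> * sqrt c))"

lemma Cw_pos: "0 < Cw"
  unfolding Cw_def using c_pos \<alpha>_pos by simp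

text \<open>The weight \<open>|1 - z| powr (\<alpha> - 1)\<close> turns the measure on the circle into arc length on the image curve,
  on which Schur's test applies to the Taylor series of \<open>g\<close>, with weights \<open>\<surd>(n + 1)\<close>.\<close>
lemma weighted_composition:
  assumes holU: "U holomorphic_on ball 0 1" and M: "0 \<le> M"
    and U: "\<And>z. norm z < 1 \<Longrightarrow> (norm (U z))\<^sup>2 \<le> M * norm (1 - z) powr (\<alpha> - 1)"
    and g: "g \<in> H2"
  shows "(\<lambda>z. if z \<in> ball 0 1 then U z * g (\<phi> z) else 0) \<in> H2
     \<and> h2_norm (\<lambda>z. if z \<in> ball 0 1 then U z * g (\<phi> z) else 0) \<le> sqrt (M * Cw) * h2_norm g"
proof -
  define F where "F = (\<lambda>z. if z \<in> ball 0 1 then U z * g (\<phi> z) else 0)"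
  define b where "b = h2_coeff g"
  define K where "K = M * 9 * sqrt (3 / c)"
  have K: "0 \<le> K" using M c_pos by (simp add: K_def)
  define h where "h = (\<lambda>t. \<Sum>n. ennreal (K * (norm (b n))\<^sup>2 * sqrt (real n + 1) * kern n t))"
  have hol: "F holomorphic_on ball 0 1"
  proof -
    have "(\<lambda>z. U z * g (\<phi> z)) holomorphic_on ball 0 1"
      using norm_\<phi>_less
      by (intro holomorphic_intros holU holomorphic_on_compose_gen[OF \<phi>_holomorphic H2_holomorphic[OF g], unfolded o_def])
        auto
    then show ?thesis unfolding F_def by (rule holomorphic_transform) auto
  qed
  have h_meas: "h \<in> borel_measurable borel" unfolding h_def by measurable
  \<comment> \<open>The distance to 1 may be replaced by any positive lower bound s since
    \<open>kern\<close> decreases; on circles s is min t (1 - t).\<close>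
  have pointwise: "ennreal ((norm (F z))\<^sup>2) \<le> h s" if z: "norm z < 1" and s: "0 < s" "s \<le> norm (1 - z)" for z s
  proof -
    define d where "d = norm (1 - z)"
    define q where "q = 1 / (1 + c * d powr \<alpha>)"
    have d: "0 < d" unfolding d_def using s by (rule less_le_trans)
    have X: "0 < c * d powr \<alpha>" "c * d powr \<alpha> \<le> 2"
    proof -
      show "0 < c * d powr \<alpha>" using c_pos d by simp
      have "c * d powr \<alpha> \<le> 1 * 2"
        using norm_w_le[OF z] c_pos c_less by (intro mult_mono) (auto simp: norm_w d_def)
      then show "c * d powr \<alpha> \<le> 2" by simp
    qed
    have q: "0 \<le> q" "q < 1" using X by (auto simp: q_def field_simps)
    have \<phi>q: "norm (\<phi> z) \<le> q" using norm_\<phi>_le[OF z] by (simp add: q_def d_def norm_w)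
    have q1: "3 / sqrt (1 - q) \<le> 3 * (sqrt (3 / c) * d powr (- \<alpha> / 2))"
    proof -
      have "1 - q = c * d powr \<alpha> / (1 + c * d powr \<alpha>)" using X by (simp add: q_def field_simps)
      also have "\<dots> \<ge> c * d powr \<alpha> / 3" using X by (intro divide_left_mono) auto
      finally have "sqrt (c * d powr \<alpha> / 3) \<le> sqrt (1 - q)" by simp
      then have "1 / sqrt (1 - q) \<le> 1 / sqrt (c * d powr \<alpha> / 3)"
        using X by (intro divide_left_mono) auto
      also have "sqrt (d powr \<alpha>) = d powr (\<alpha> / 2)"
        by (simp add: powr_half_sqrt[symmetric] powr_powr)
      then have "1 / sqrt (c * d powr \<alpha> / 3) = sqrt (3 / c) * d powr (- \<alpha> / 2)"
        by (simp add: real_sqrt_divide real_sqrt_mult powr_minus field_simps)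
      finally show ?thesis by simp
    qed
    \<comment> \<open>Bernoulli gives 1 + n x <= (1 + x) ^ n; the spare factor 1 + x <= 3 turns n
      into n + 1, which matches the weights sqrt (n + 1).\<close>
    have qn: "q ^ n \<le> 3 / (1 + (real n + 1) * c * d powr \<alpha>)" for n
    proof -
      define x where "x = c * d powr \<alpha>"
      have "0 \<le> real n * (x * x)" by simp
      then have "1 + (real n + 1) * x \<le> (1 + x) * (1 + real n * x)"
        by (simp add: algebra_simps)
      also have "\<dots> \<le> 3 * (1 + x) ^ n"
        using X Bernoulli_inequality[of x n] by (intro mult_mono) (auto simp: x_def)
      finally have "1 + (real n + 1) * x \<le> 3 * (1 + x) ^ n" .
      moreover have "0 < 1 + (real n + 1) * x" "0 < 1 + x" using X by (auto simp: x_def add_pos_pos)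
      ultimately show ?thesis
        unfolding q_def x_def[symmetric] mult.assoc by (simp add: power_divide field_simps)
    qed
    have partial: "(norm (U z * (\<Sum>n<m. b n * \<phi> z ^ n)))\<^sup>2
        \<le> (\<Sum>n<m. K * (norm (b n))\<^sup>2 * sqrt (real n + 1) * kern n d)" for m
    proof -
      have "norm (\<Sum>n<m. b n * \<phi> z ^ n) \<le> (\<Sum>n<m. norm (b n) * q ^ n)"
        by (rule order_trans[OF norm_sum])
          (use \<phi>q in \<open>auto intro!: sum_mono mult_left_mono power_mono simp: norm_mult norm_power\<close>)
      \<comment> \<open>Schur weights for Cauchy-Schwarz: the two square roots multiply to q ^
        n.\<close>
      also have "\<dots> = (\<Sum>n<m. (norm (b n) * sqrt (sqrt (real n + 1) * q ^ n)) * sqrt (q ^ n / sqrt (real n + 1)))"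
      proof (rule sum.cong[OF refl])
        fix n
        have "sqrt (sqrt (real n + 1) * q ^ n) * sqrt (q ^ n / sqrt (real n + 1)) = sqrt ((q ^ n)\<^sup>2)"
          unfolding real_sqrt_mult[symmetric] by (simp add: power2_eq_square)
        also have "\<dots> = q ^ n" using q by simp
        finally show "norm (b n) * q ^ n = (norm (b n) * sqrt (sqrt (real n + 1) * q ^ n)) * sqrt (q ^ n / sqrt (real n + 1))"
          by (simp add: mult.assoc)
      qed
      finally have "(norm (\<Sum>n<m. b n * \<phi> z ^ n))\<^sup>2 \<le> \<dots>\<^sup>2"
        by (rule power_mono) simp
      also have "\<dots> \<le> (\<Sum>n<m. (norm (b n) * sqrt (sqrt (real n + 1) * q ^ n))\<^sup>2)
          * (\<Sum>n<m. (sqrt (q ^ n / sqrt (real n + 1)))\<^sup>2)"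
        by (rule Cauchy_Schwarz_ineq_sum)
      also have "\<dots> = (\<Sum>n<m. (norm (b n))\<^sup>2 * sqrt (real n + 1) * q ^ n)
          * (\<Sum>n<m. q ^ n / sqrt (real n + 1))"
        using q by (simp add: power_mult_distrib mult.assoc)
      also have "\<dots> \<le> (\<Sum>n<m. (norm (b n))\<^sup>2 * sqrt (real n + 1) * (3 / (1 + (real n + 1) * c * d powr \<alpha>)))
          * (3 * (sqrt (3 / c) * d powr (- \<alpha> / 2)))"
        using q by (intro mult_mono sum_mono mult_left_mono qn order_trans[OF sum_power_div_sqrt_le[OF q] q1] sum_nonneg)
          (auto intro!: mult_nonneg_nonneg divide_nonneg_nonneg add_nonneg_nonneg simp: c_pos less_imp_le)
      finally have s1: "(norm (\<Sum>n<m. b n * \<phi> z ^ n))\<^sup>2 \<le> \<dots>" .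
      have "(norm (U z * (\<Sum>n<m. b n * \<phi> z ^ n)))\<^sup>2 = (norm (U z))\<^sup>2 * (norm (\<Sum>n<m. b n * \<phi> z ^ n))\<^sup>2"
        by (simp add: norm_mult power_mult_distrib)
      also have "\<dots> \<le> (M * d powr (\<alpha> - 1)) * ((\<Sum>n<m. (norm (b n))\<^sup>2 * sqrt (real n + 1) * (3 / (1 + (real n + 1) * c * d powr \<alpha>)))
          * (3 * (sqrt (3 / c) * d powr (- \<alpha> / 2))))"
        using U[OF z] M by (intro mult_mono s1) (auto simp: d_def)
      also have "\<dots> = (\<Sum>n<m. K * (norm (b n))\<^sup>2 * sqrt (real n + 1) * kern n d)"
      proof -
        have p: "d powr (\<alpha> - 1) * d powr (- \<alpha> / 2) = d powr (\<alpha> / 2 - 1)"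
          by (simp add: powr_add[symmetric] field_simps)
        show ?thesis
          unfolding kern_def p[symmetric] K_def sum_distrib_left sum_distrib_right
          by (rule sum.cong[OF refl]) (simp add: mult_ac)
      qed
      finally show ?thesis .
    qed
    have "(\<lambda>m. \<Sum>n<m. b n * \<phi> z ^ n) \<longlonglongrightarrow> g (\<phi> z)"
      using h2_coeff_sums[OF H2_holomorphic[OF g] norm_\<phi>_less[OF z]] by (simp add: sums_def b_def)
    then have lim: "(\<lambda>m. ennreal ((norm (U z * (\<Sum>n<m. b n * \<phi> z ^ n)))\<^sup>2)) \<longlonglongrightarrow> ennreal ((norm (U z * g (\<phi> z)))\<^sup>2)"
      by (intro tendsto_ennrealI tendsto_intros)
    have le: "ennreal ((norm (U z * (\<Sum>n<m. b n * \<phi> z ^ n)))\<^sup>2) \<le> h s" for m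
    proof -
      have "ennreal ((norm (U z * (\<Sum>n<m. b n * \<phi> z ^ n)))\<^sup>2)
          \<le> ennreal (\<Sum>n<m. K * (norm (b n))\<^sup>2 * sqrt (real n + 1) * kern n s)"
      proof (intro ennreal_leI order_trans[OF partial] sum_mono)
        fix n
        show "K * (norm (b n))\<^sup>2 * sqrt (real n + 1) * kern n d \<le> K * (norm (b n))\<^sup>2 * sqrt (real n + 1) * kern n s"
          using s K by (intro mult_left_mono kern_antimono) (auto simp: d_def)
      qed
      also have "\<dots> = (\<Sum>n<m. ennreal (K * (norm (b n))\<^sup>2 * sqrt (real n + 1) * kern n s))"
        using K kern_nonneg by (intro sum_ennreal[symmetric]) simp
      also have "\<dots> \<le> h s"
        unfolding h_def by (rule sum_le_suminf) auto
      finally show ?thesis .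
    qed
    have "ennreal ((norm (U z * g (\<phi> z)))\<^sup>2) \<le> h s"
      by (rule LIMSEQ_le_const2[OF lim]) (use le in blast)
    then show ?thesis using z by (simp add: F_def)
  qed
  define B where "B = K * (pi / (\<alpha> * sqrt c)) * (h2_norm g)\<^sup>2"
  have sg: "summable (\<lambda>n. (norm (b n))\<^sup>2)" using g by (simp add: H2_def b_def)
  have int: "(\<integral>\<^sup>+t\<in>{0..1}. h t \<partial>lborel) \<le> ennreal B"
  proof -
    have "(\<integral>\<^sup>+t\<in>{0..1}. h t \<partial>lborel)
        = (\<integral>\<^sup>+t. (\<Sum>n. ennreal (K * (norm (b n))\<^sup>2 * sqrt (real n + 1)) * (ennreal (kern n t) * indicator {0..1} t)) \<partial>lborel)"
      unfolding h_def using K kern_nonneg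
      by (intro nn_integral_cong) (auto simp: ennreal_mult mult.assoc intro!: arg_cong[where f = suminf] split: split_indicator)
    also have "\<dots> = (\<Sum>n. \<integral>\<^sup>+t. ennreal (K * (norm (b n))\<^sup>2 * sqrt (real n + 1)) * (ennreal (kern n t) * indicator {0..1} t) \<partial>lborel)"
      by (rule nn_integral_suminf) measurable
    also have "\<dots> \<le> (\<Sum>n. ennreal (K * (pi / (\<alpha> * sqrt c)) * (norm (b n))\<^sup>2))"
    proof (rule suminf_le)
      fix n
      have "(\<integral>\<^sup>+t. ennreal (K * (norm (b n))\<^sup>2 * sqrt (real n + 1)) * (ennreal (kern n t) * indicator {0..1} t) \<partial>lborel)
          = ennreal (K * (norm (b n))\<^sup>2 * sqrt (real n + 1)) * (\<integral>\<^sup>+t\<in>{0..1}. ennreal (kern n t) \<partial>lborel)"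
        by (rule nn_integral_cmult) measurable
      also have "\<dots> \<le> ennreal (K * (norm (b n))\<^sup>2 * sqrt (real n + 1)) * ennreal (pi / (\<alpha> * sqrt c) / sqrt (real n + 1))"
        by (intro mult_left_mono kern_integral) simp
      also have "\<dots> = ennreal (K * (pi / (\<alpha> * sqrt c)) * (norm (b n))\<^sup>2)"
        using K \<alpha>_pos c_pos by (subst ennreal_mult[symmetric]) (auto simp: field_simps)
      finally show "(\<integral>\<^sup>+t. ennreal (K * (norm (b n))\<^sup>2 * sqrt (real n + 1)) * (ennreal (kern n t) * indicator {0..1} t) \<partial>lborel)
        \<le> ennreal (K * (pi / (\<alpha> * sqrt c)) * (norm (b n))\<^sup>2)" .
    qed auto
    also have "\<dots> = ennreal (\<Sum>n. K * (pi / (\<alpha> * sqrt c)) * (norm (b n))\<^sup>2)"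
      using K \<alpha>_pos c_pos sg by (intro suminf_ennreal2 summable_mult) auto
    also have "(\<Sum>n. K * (pi / (\<alpha> * sqrt c)) * (norm (b n))\<^sup>2) = B"
      using sg unfolding B_def h2_norm_def b_def[symmetric]
      by (subst suminf_mult[OF sg]) (simp add: suminf_nonneg[OF sg])
    finally show ?thesis .
  qed
  have B: "0 \<le> B" using K \<alpha>_pos c_pos by (simp add: B_def)
  have "F \<in> H2 \<and> h2_norm F \<le> sqrt (M * Cw) * h2_norm g"
  proof (rule H2_I[OF hol])
    show "0 \<le> sqrt (M * Cw) * h2_norm g"
      using M Cw_pos h2_norm_nonneg[OF g] by simp
    fix m
    have "(\<Sum>n<m. (norm (h2_coeff F n))\<^sup>2) \<le> 2 * B"
    proof (rule circle_mean_bound[OF hol h_meas _ int B])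
      fix r t :: real assume rt: "0 < r" "r < 1" "0 < t" "t < 1"
      have "ennreal ((norm (F (of_real r * cis (2 * pi * t))))\<^sup>2) \<le> h (min t (1 - t))"
      proof (rule pointwise)
        show "0 < min t (1 - t)" using rt by simp
        then show "min t (1 - t) \<le> norm (1 - of_real r * cis (2 * pi * t))"
          using order_trans[OF _ norm_one_minus_circle_ge[OF rt], of "min t (1 - t)"] by simp
      qed (use rt in \<open>simp add: norm_mult\<close>)
      also have "\<dots> \<le> h t + h (1 - t)" by (simp add: min_def add_increasing add_increasing2)
      finally show "ennreal ((norm (F (of_real r * cis (2 * pi * t))))\<^sup>2) \<le> h t + h (1 - t)" .
    qed
    also have "2 * B = (sqrt (M * Cw) * h2_norm g)\<^sup>2"
    proof -
      have "(sqrt (M * Cw) * h2_norm g)\<^sup>2 = M * Cw * (h2_norm g)\<^sup>2"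
        using M Cw_pos by (simp add: power_mult_distrib)
      then show ?thesis by (simp add: B_def K_def Cw_def)
    qed
    finally show "(\<Sum>n<m. (norm (h2_coeff F n))\<^sup>2) \<le> (sqrt (M * Cw) * h2_norm g)\<^sup>2" .
  qed (simp add: F_def)
  then show ?thesis by (simp add: F_def)
qed

lemma comp_op_bounded:
  assumes "g \<in> H2"
  shows "comp_op \<phi> g \<in> H2" and "h2_norm (comp_op \<phi> g) \<le> sqrt (2 * Cw) * h2_norm g"
proof -
  \<comment> \<open>From |1 - z| <= 2 the weight is at least 2 powr (-1), hence M = 2 for U =
    1.\<close>
  have "(norm (1::complex))\<^sup>2 \<le> 2 * norm (1 - z) powr (\<alpha> - 1)" if "norm z < 1" for z :: complex
  proof -
    have "norm (1 - z) \<le> 2" using norm_triangle_ineq4[of 1 z] that by simp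
    moreover have "0 < norm (1 - z)" using that by auto
    ultimately have "2 powr (\<alpha> - 1) \<le> norm (1 - z) powr (\<alpha> - 1)"
      using \<alpha>_less by (intro powr_mono2') auto
    moreover have "(2::real) powr (- 1) \<le> 2 powr (\<alpha> - 1)" using \<alpha>_pos by (intro powr_mono) auto
    ultimately show ?thesis by (simp add: powr_minus)
  qed
  from weighted_composition[where U = "\<lambda>_. 1" and M = 2, OF _ _ this assms]
  show "comp_op \<phi> g \<in> H2" "h2_norm (comp_op \<phi> g) \<le> sqrt (2 * Cw) * h2_norm g"
    by (simp_all only: comp_op_def mult_1) simp_all
qed

end

section \<open>Division by Blaschke products\<close>

lemma bounded_holomorphic_H2:
  assumes hol: "F holomorphic_on ball 0 1" and out: "\<And>z. z \<notin> ball 0 1 \<Longrightarrow> F z = 0"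
    and M: "\<And>z. norm z < 1 \<Longrightarrow> norm (F z) \<le> M"
  shows "F \<in> H2"
proof -
  have "(\<Sum>n<m. (norm (h2_coeff F n))\<^sup>2) \<le> 2 * M\<^sup>2" for m
  proof (rule circle_mean_bound[OF hol, of "\<lambda>_. ennreal (M\<^sup>2)"])
    fix r t :: real assume "0 < r" "r < 1"
    then have "(norm (F (of_real r * cis (2 * pi * t))))\<^sup>2 \<le> M\<^sup>2"
      by (intro power_mono M) (auto simp: norm_mult)
    then show "ennreal ((norm (F (of_real r * cis (2 * pi * t))))\<^sup>2) \<le> ennreal (M\<^sup>2) + ennreal (M\<^sup>2)"
      by (intro add_increasing2 ennreal_leI) auto
  qed (auto simp: nn_integral_cmult_indicator)
  then have "(\<Sum>n<m. (norm (h2_coeff F n))\<^sup>2) \<le> (sqrt (2 * M\<^sup>2))\<^sup>2" for m by simp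
  then show ?thesis using H2_I[OF hol out, of "sqrt (2 * M\<^sup>2)"] by simp
qed

section \<open>Finite Blaschke products with zeros in [0, 1)\<close>

definition blaschke_factor :: "real \<Rightarrow> complex \<Rightarrow> complex" where
  "blaschke_factor p z = (z - of_real p) / (1 - of_real p * z)"

definition blaschke_prod :: "real list \<Rightarrow> complex \<Rightarrow> complex" where
  "blaschke_prod ps z = (\<Prod>p\<leftarrow>ps. blaschke_factor p z)"

lemma one_minus_mult_nonzero:
  assumes "0 \<le> p" "p < 1" "norm z < 1"
  shows "1 - of_real p * z \<noteq> (0::complex)"
proof
  assume "1 - of_real p * z = 0"
  then have "of_real p * z = 1" by simp
  then have "norm (of_real p * z) = 1" by (simp only: norm_one)
  moreover have "norm (of_real p * z) \<le> 1 * norm z"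
    unfolding norm_mult using assms by (intro mult_right_mono) auto
  ultimately show False using assms by simp
qed

lemma blaschke_factor_le_1:
  assumes p: "0 \<le> p" "p < 1" and z: "norm z < 1"
  shows "norm (blaschke_factor p z) \<le> 1"
proof -
  have id: "(norm (1 - of_real p * z))\<^sup>2 - (norm (z - of_real p))\<^sup>2 = (1 - p\<^sup>2) * (1 - (norm z)\<^sup>2)"
    unfolding cmod_power2 by (simp add: power2_eq_square algebra_simps)
  have "p\<^sup>2 \<le> 1" "(norm z)\<^sup>2 \<le> 1" using p z by (auto simp: power_le_one)
  then have "0 \<le> (1 - p\<^sup>2) * (1 - (norm z)\<^sup>2)" by (intro mult_nonneg_nonneg) simp_all
  then have "(norm (z - of_real p))\<^sup>2 \<le> (norm (1 - of_real p * z))\<^sup>2" using id by linarith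
  then have "norm (z - of_real p) \<le> norm (1 - of_real p * z)"
    by (rule power2_le_imp_le) simp
  moreover have "0 < norm (1 - of_real p * z)"
    using one_minus_mult_nonzero[OF assms] by simp
  ultimately show ?thesis
    unfolding blaschke_factor_def norm_divide by (simp only: divide_le_eq_1_pos)
qed

lemma blaschke_prod_le_1:
  assumes "set ps \<subseteq> {0..<1}" "norm z < 1"
  shows "norm (blaschke_prod ps z) \<le> 1"
  using assms unfolding blaschke_prod_def
  by (induction ps) (auto simp: norm_mult blaschke_factor_le_1 intro!: mult_le_one)

lemma blaschke_factor_holomorphic:
  assumes "0 \<le> p" "p < 1"
  shows "blaschke_factor p holomorphic_on ball 0 1"
  unfolding blaschke_factor_def using one_minus_mult_nonzero[OF assms]
  by (intro holomorphic_intros) auto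

lemma blaschke_prod_holomorphic:
  assumes "set ps \<subseteq> {0..<1}"
  shows "blaschke_prod ps holomorphic_on ball 0 1"
  using assms
proof (induction ps)
  case (Cons p ps)
  then have "(\<lambda>z. blaschke_factor p z * blaschke_prod ps z) holomorphic_on ball 0 1"
    by (intro holomorphic_intros blaschke_factor_holomorphic) auto
  then show ?case by (simp add: blaschke_prod_def[abs_def])
qed (simp add: blaschke_prod_def[abs_def])

text \<open>The value at p of the n-fold backward shift of f; for n = 0 it is f p.\<close>

definition tail_coeff :: "real \<Rightarrow> (complex \<Rightarrow> complex) \<Rightarrow> nat \<Rightarrow> complex" where
  "tail_coeff p f n = (\<Sum>j. h2_coeff f (n + j) * of_real p ^ j)"

text \<open>Taylor coefficients of f minus its projection onto the Szego kernel at p, divided by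
  \<open>blaschke_factor p\<close>. Working with coefficients turns linearity and the norm estimate
  into statements about sequences.\<close>

definition quot_coeff :: "real \<Rightarrow> (complex \<Rightarrow> complex) \<Rightarrow> nat \<Rightarrow> complex" where
  "quot_coeff p f n = tail_coeff p f (Suc n) - of_real p * tail_coeff p f n"

definition blaschke_quot :: "real \<Rightarrow> (complex \<Rightarrow> complex) \<Rightarrow> complex \<Rightarrow> complex" where
  "blaschke_quot p f z = (if z \<in> ball 0 1 then \<Sum>n. quot_coeff p f n * z ^ n else 0)"

section \<open>Division by one factor\<close>

context
  fixes p :: real
  assumes p: "0 \<le> p" "p < 1"
begin

lemma tail_summable:
  assumes "f \<in> H2"
  shows "summable (\<lambda>j. h2_coeff f (n + j) * of_real p ^ j)"
proof (rule summable_comparison_test')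
  show "summable (\<lambda>j. h2_norm f * p ^ j)" using p by (intro summable_mult summable_geometric) auto
  fix j
  have "(norm (h2_coeff f k))\<^sup>2 \<le> (h2_norm f)\<^sup>2" for k
    using H2_partial_sum_le[OF assms, of "Suc k"] sum_nonneg[of "{..<k}" "\<lambda>n. (norm (h2_coeff f n))\<^sup>2"]
    by simp
  then have "norm (h2_coeff f k) \<le> h2_norm f" for k
    using h2_norm_nonneg[OF assms] power2_le_imp_le by blast
  then show "norm (h2_coeff f (n + j) * of_real p ^ j) \<le> h2_norm f * p ^ j"
    using p by (auto simp: norm_mult norm_power intro!: mult_right_mono)
qed

text \<open>Mirror image of \<open>quot_coeff\<close>: f and the quotient are built from the same
  tails with the roles of n and Suc n exchanged.\<close>

lemma tail_coeff_rec:
  assumes "f \<in> H2"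
  shows "h2_coeff f n = tail_coeff p f n - of_real p * tail_coeff p f (Suc n)"
proof -
  have "(\<Sum>j. h2_coeff f (n + Suc j) * of_real p ^ Suc j) = tail_coeff p f n - h2_coeff f n"
    using suminf_split_head[OF tail_summable[OF assms]] by (simp add: tail_coeff_def)
  then have "tail_coeff p f n = h2_coeff f n + (\<Sum>j. of_real p * (h2_coeff f (Suc n + j) * of_real p ^ j))"
    by (simp add: mult_ac)
  also have "(\<Sum>j. of_real p * (h2_coeff f (Suc n + j) * of_real p ^ j)) = of_real p * tail_coeff p f (Suc n)"
    unfolding tail_coeff_def by (rule suminf_mult[OF tail_summable[OF assms]])
  finally show ?thesis by simp
qed

text \<open>Removes the boundary term of the telescoping sum in the norm estimate. The coefficients
  tend to 0, and a tail weighs them by a convergent geometric series.\<close>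

lemma tail_coeff_tendsto_0:
  assumes f: "f \<in> H2"
  shows "tail_coeff p f \<longlonglongrightarrow> 0"
proof (rule LIMSEQ_I)
  fix e :: real assume e: "0 < e"
  have "summable (\<lambda>n. (norm (h2_coeff f n))\<^sup>2)" using f by (simp add: H2_def)
  then have "(\<lambda>n. sqrt ((norm (h2_coeff f n))\<^sup>2)) \<longlonglongrightarrow> sqrt 0"
    by (intro tendsto_real_sqrt summable_LIMSEQ_zero)
  then have "(\<lambda>n. norm (h2_coeff f n)) \<longlonglongrightarrow> 0" by simp
  moreover define d where "d = e / 2 * (1 - p)"
  moreover have "0 < d" using e p by (simp add: d_def)
  ultimately obtain N where N: "\<And>n. n \<ge> N \<Longrightarrow> norm (h2_coeff f n) < d"
    unfolding LIMSEQ_iff by (metis abs_norm_cancel diff_zero real_norm_def)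
  have "norm (tail_coeff p f n) < e" if "n \<ge> N" for n
  proof -
    have geo: "summable (\<lambda>j. d * p ^ j)" using p by (intro summable_mult summable_geometric) auto
    have le: "norm (h2_coeff f (n + j) * of_real p ^ j) \<le> d * p ^ j" for j
      using N[of "n + j"] that p by (auto simp: norm_mult norm_power intro!: mult_right_mono)
    have sn: "summable (\<lambda>j. norm (h2_coeff f (n + j) * of_real p ^ j))"
      by (rule summable_comparison_test'[OF geo]) (use le in auto)
    have "norm (tail_coeff p f n) \<le> (\<Sum>j. norm (h2_coeff f (n + j) * of_real p ^ j))"
      unfolding tail_coeff_def by (rule summable_norm[OF sn])
    also have "\<dots> \<le> (\<Sum>j. d * p ^ j)" by (rule suminf_le[OF le sn geo])
    also have "\<dots> = d * (1 / (1 - p))" using p by (simp add: suminf_mult suminf_geometric)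
    also have "\<dots> = e / 2" using p by (simp add: d_def field_simps)
    also have "\<dots> < e" using e by simp
    finally show ?thesis .
  qed
  then show "\<exists>N. \<forall>n\<ge>N. norm (tail_coeff p f n - 0) < e" by auto
qed

lemma tail_series_summable:
  assumes "f \<in> H2" "norm z < 1"
  shows "summable (\<lambda>n. tail_coeff p f n * z ^ n)"
proof -
  have "Bseq (tail_coeff p f)"
    using convergent_imp_Bseq convergentI tail_coeff_tendsto_0[OF assms(1)] by blast
  then obtain M where "\<And>n. norm (tail_coeff p f n) \<le> M" by (meson BseqD)
  then show ?thesis
    using assms(2)
    by (intro summable_comparison_test'[OF summable_mult[OF summable_geometric, of "norm z" M], of 0])
      (auto simp: norm_mult norm_power intro!: mult_right_mono)
qed

lemma tail_series_summable_Suc: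
  assumes "f \<in> H2" "norm z < 1"
  shows "summable (\<lambda>n. tail_coeff p f (Suc n) * z ^ n)"
proof (cases "z = 0")
  case False
  have "summable (\<lambda>n. tail_coeff p f (Suc n) * z ^ Suc n)"
    using tail_series_summable[OF assms] by (subst summable_Suc_iff)
  from summable_mult[OF this, of "inverse z"] show ?thesis using False by (simp add: mult_ac)
qed (use powser_inside in simp)

lemma quot_sums:
  assumes "f \<in> H2" "norm z < 1"
  shows "(\<lambda>n. quot_coeff p f n * z ^ n) sums blaschke_quot p f z"
proof -
  have "summable (\<lambda>n. tail_coeff p f (Suc n) * z ^ n - of_real p * (tail_coeff p f n * z ^ n))"
    by (intro summable_diff summable_mult tail_series_summable tail_series_summable_Suc assms)
  then have "summable (\<lambda>n. quot_coeff p f n * z ^ n)" by (simp add: quot_coeff_def algebra_simps)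
  then show ?thesis using assms by (simp add: blaschke_quot_def summable_sums)
qed

lemma blaschke_quot_coeff:
  assumes "f \<in> H2"
  shows "blaschke_quot p f holomorphic_on ball 0 1" "h2_coeff (blaschke_quot p f) n = quot_coeff p f n"
  using power_series_h2_coeff[OF quot_sums[OF assms]] by auto

text \<open>\<open>|a_n|\<^sup>2 - |g_n|\<^sup>2\<close> telescopes: it is \<open>(1 - p\<^sup>2) (|e_n|\<^sup>2 - |e_(n+1)|\<^sup>2)\<close> for the tail sums \<open>e_n\<close>.\<close>
lemma blaschke_quot_H2:
  assumes f: "f \<in> H2"
  shows "blaschke_quot p f \<in> H2 \<and> h2_norm (blaschke_quot p f) \<le> h2_norm f"
proof (rule H2_I[OF blaschke_quot_coeff(1)[OF f]])
  fix m
  let ?e = "\<lambda>n. (norm (tail_coeff p f n))\<^sup>2"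
  have id: "(norm (a - of_real p * b))\<^sup>2 - (norm (b - of_real p * a))\<^sup>2 = (1 - p\<^sup>2) * ((norm a)\<^sup>2 - (norm b)\<^sup>2)"
    for a b :: complex
    unfolding cmod_power2 by (simp add: power2_eq_square algebra_simps)
  have "(\<Sum>n<M. (norm (quot_coeff p f n))\<^sup>2) \<le> (h2_norm f)\<^sup>2 + (1 - p\<^sup>2) * ?e M" for M
  proof -
    have "(\<Sum>n<M. (norm (h2_coeff f n))\<^sup>2) - (\<Sum>n<M. (norm (quot_coeff p f n))\<^sup>2)
        = (\<Sum>n<M. (1 - p\<^sup>2) * (?e n - ?e (Suc n)))"
      unfolding sum_subtractf[symmetric] tail_coeff_rec[OF f] quot_coeff_def id ..
    also have "\<dots> = (1 - p\<^sup>2) * (?e 0 - ?e M)"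
      unfolding sum_distrib_left[symmetric] using sum_lessThan_telescope'[of ?e M] by simp
    finally have "(\<Sum>n<M. (norm (quot_coeff p f n))\<^sup>2)
        = (\<Sum>n<M. (norm (h2_coeff f n))\<^sup>2) + (1 - p\<^sup>2) * ?e M - (1 - p\<^sup>2) * ?e 0"
      by (simp add: algebra_simps)
    \<comment> \<open>The dropped term is (1 - p^2) |f p|^2, the squared norm of the projected
      part.\<close>
    moreover have "0 \<le> (1 - p\<^sup>2) * ?e 0" using p by (simp add: power_le_one)
    ultimately show ?thesis using H2_partial_sum_le[OF f, of M] by linarith
  qed
  \<comment> \<open>The bound at index M carries |e_M|^2, so m stays fixed while M tends to
    infinity.\<close>
  moreover have "(\<Sum>n<m. (norm (quot_coeff p f n))\<^sup>2) \<le> (\<Sum>n<M. (norm (quot_coeff p f n))\<^sup>2)" if "m \<le> M" for M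
    using that by (intro sum_mono2) auto
  ultimately have le: "(\<Sum>n<m. (norm (quot_coeff p f n))\<^sup>2) \<le> (h2_norm f)\<^sup>2 + (1 - p\<^sup>2) * ?e M" if "m \<le> M" for M
    using that order_trans by blast
  have "(\<lambda>M. (h2_norm f)\<^sup>2 + (1 - p\<^sup>2) * ?e M) \<longlonglongrightarrow> (h2_norm f)\<^sup>2 + (1 - p\<^sup>2) * (norm (0::complex))\<^sup>2"
    by (intro tendsto_intros tail_coeff_tendsto_0 f)
  then have "(\<Sum>n<m. (norm (quot_coeff p f n))\<^sup>2) \<le> (h2_norm f)\<^sup>2 + (1 - p\<^sup>2) * (norm (0::complex))\<^sup>2"
    by (rule LIMSEQ_le_const) (use le in blast)
  then show "(\<Sum>n<m. (norm (h2_coeff (blaschke_quot p f) n))\<^sup>2) \<le> (h2_norm f)\<^sup>2"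
    by (simp add: blaschke_quot_coeff(2)[OF f])
qed (auto simp: blaschke_quot_def h2_norm_nonneg[OF f])

text \<open>With E and H the generating series of the tails and of the shifted tails, f = E - p H,
  the quotient is H - p E, and E = e + z H; multiplying f by 1 - p z gives the claim.\<close>

lemma blaschke_quot_split:
  assumes f: "f \<in> H2" and z: "norm z < 1"
  shows "f z = tail_coeff p f 0 * (of_real (1 - p\<^sup>2) / (1 - of_real p * z)) + blaschke_factor p z * blaschke_quot p f z"
proof -
  define H where "H = (\<Sum>n. tail_coeff p f (Suc n) * z ^ n)"
  define E where "E = (\<Sum>n. tail_coeff p f n * z ^ n)"
  define e where "e = tail_coeff p f 0"
  have sE: "(\<lambda>n. tail_coeff p f n * z ^ n) sums E" and sH: "(\<lambda>n. tail_coeff p f (Suc n) * z ^ n) sums H"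
    using tail_series_summable[OF assms] tail_series_summable_Suc[OF assms]
    by (auto simp: E_def H_def summable_sums)
  have E: "E = e + z * H"
  proof -
    have "(\<lambda>n. tail_coeff p f (Suc n) * z ^ Suc n) sums (E - e)"
      using sE by (subst sums_Suc_iff) (simp add: e_def)
    moreover have "(\<lambda>n. tail_coeff p f (Suc n) * z ^ Suc n) sums (z * H)"
      using sums_mult[OF sH, of z] by (simp add: mult_ac)
    ultimately have "E - e = z * H" by (rule sums_unique2)
    then show ?thesis by (simp add: algebra_simps)
  qed
  have "(\<lambda>n. tail_coeff p f n * z ^ n - of_real p * (tail_coeff p f (Suc n) * z ^ n)) sums (E - of_real p * H)"
    by (intro sums_diff sums_mult sE sH)
  moreover have "tail_coeff p f n * z ^ n - of_real p * (tail_coeff p f (Suc n) * z ^ n) = h2_coeff f n * z ^ n" for n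
    by (simp add: tail_coeff_rec[OF f] algebra_simps)
  ultimately have F: "f z = E - of_real p * H"
    using sums_unique2[OF h2_coeff_sums[OF H2_holomorphic[OF f] z]] by simp
  have "(\<lambda>n. tail_coeff p f (Suc n) * z ^ n - of_real p * (tail_coeff p f n * z ^ n)) sums (H - of_real p * E)"
    by (intro sums_diff sums_mult sE sH)
  moreover have "tail_coeff p f (Suc n) * z ^ n - of_real p * (tail_coeff p f n * z ^ n) = quot_coeff p f n * z ^ n" for n
    by (simp add: quot_coeff_def algebra_simps)
  ultimately have Q: "blaschke_quot p f z = H - of_real p * E"
    using sums_unique2[OF quot_sums[OF assms]] by simp
  have nz: "1 - of_real p * z \<noteq> 0" by (rule one_minus_mult_nonzero[OF p z])
  have "f z * (1 - of_real p * z) = e * of_real (1 - p\<^sup>2) + (z - of_real p) * (H - of_real p * E)"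
    unfolding F E by (simp add: algebra_simps power2_eq_square)
  then show ?thesis
    using nz by (simp add: Q blaschke_factor_def e_def eq_divide_eq add_divide_distrib[symmetric])
qed

lemma tail_coeff_add:
  assumes "f \<in> H2" "g \<in> H2"
  shows "tail_coeff p (\<lambda>z. f z + g z) n = tail_coeff p f n + tail_coeff p g n"
  unfolding tail_coeff_def
  by (subst suminf_add) (auto simp: tail_summable assms h2_coeff_add H2_holomorphic distrib_right)

lemma tail_coeff_cmult:
  assumes "f \<in> H2"
  shows "tail_coeff p (\<lambda>z. c * f z) n = c * tail_coeff p f n"
  unfolding tail_coeff_def
  by (subst suminf_mult[symmetric]) (auto simp: tail_summable assms h2_coeff_cmult H2_holomorphic mult.assoc)

lemma blaschke_quot_add:
  assumes "f \<in> H2" "g \<in> H2"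
  shows "blaschke_quot p (\<lambda>z. f z + g z) = (\<lambda>z. blaschke_quot p f z + blaschke_quot p g z)"
proof
  fix z
  show "blaschke_quot p (\<lambda>z. f z + g z) z = blaschke_quot p f z + blaschke_quot p g z"
  proof (cases "z \<in> ball 0 1")
    case True
    then have z: "norm z < 1" by simp
    have "(\<lambda>n. quot_coeff p (\<lambda>z. f z + g z) n * z ^ n) sums (blaschke_quot p f z + blaschke_quot p g z)"
      using sums_add[OF quot_sums[OF assms(1) z] quot_sums[OF assms(2) z]]
      by (simp add: quot_coeff_def tail_coeff_add assms algebra_simps)
    then show ?thesis using sums_unique2 quot_sums[OF conjunct1[OF h2_norm_add[OF assms]] z] by blast
  qed (simp add: blaschke_quot_def)
qed

lemma blaschke_quot_cmult:
  assumes "f \<in> H2"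
  shows "blaschke_quot p (\<lambda>z. c * f z) = (\<lambda>z. c * blaschke_quot p f z)"
proof
  fix z
  show "blaschke_quot p (\<lambda>z. c * f z) z = c * blaschke_quot p f z"
  proof (cases "z \<in> ball 0 1")
    case True
    then have z: "norm z < 1" by simp
    have "(\<lambda>n. quot_coeff p (\<lambda>z. c * f z) n * z ^ n) sums (c * blaschke_quot p f z)"
      using sums_mult[OF quot_sums[OF assms(1) z], of c]
      by (simp add: quot_coeff_def tail_coeff_cmult assms algebra_simps)
    then show ?thesis using sums_unique2 quot_sums[OF h2_norm_cmult(1)[OF assms] z] by blast
  qed (simp add: blaschke_quot_def)
qed

end

text \<open>Dividing the quotient by one more factor multiplies the new remainder by the product so
  far, so \<open>es\<close> is an unnormalised Takenaka-Malmquist system. Its members are not cut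
  off outside the disc, hence they appear as bounded holomorphic functions rather than elements of
  \<open>H2\<close>.\<close>

lemma blaschke_division:
  assumes "set ps \<subseteq> {0..<1}"
  shows "\<exists>G cs es. length es = length ps
    \<and> (\<forall>e\<in>set es. e holomorphic_on ball 0 1 \<and> (\<exists>M. \<forall>z. norm z < 1 \<longrightarrow> norm (e z) \<le> M))
    \<and> (\<forall>f\<in>H2. G f \<in> H2 \<and> h2_norm (G f) \<le> h2_norm f)
    \<and> (\<forall>f\<in>H2. \<forall>g\<in>H2. G (\<lambda>z. f z + g z) = (\<lambda>z. G f z + G g z))
    \<and> (\<forall>c. \<forall>f\<in>H2. G (\<lambda>z. c * f z) = (\<lambda>z. c * G f z))
    \<and> (\<forall>f\<in>H2. \<forall>z. norm z < 1 \<longrightarrow>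
          f z = (\<Sum>i<length es. cs f i * (es ! i) z) + blaschke_prod ps z * G f z)"
    (is "\<exists>G cs es. ?P ps G cs es")
  using assms
proof (induction ps rule: rev_induct)
  case Nil
  show ?case
    by (rule exI[of _ "\<lambda>f. f"], rule exI[of _ "\<lambda>_ _. 0"], rule exI[of _ "[]"])
      (simp add: blaschke_prod_def)
next
  case (snoc p ps)
  then have p: "0 \<le> p" "p < 1" and ps: "set ps \<subseteq> {0..<1}" by auto
  obtain G cs es where IH: "?P ps G cs es" using snoc.IH[OF ps] by blast
  define e where "e = (\<lambda>z. blaschke_prod ps z * (of_real (1 - p\<^sup>2) / (1 - of_real p * z)))"
  have e_hol: "e holomorphic_on ball 0 1"
    unfolding e_def using one_minus_mult_nonzero[OF p] blaschke_prod_holomorphic[OF ps]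
    by (intro holomorphic_intros) auto
  have e_bound: "norm (e z) \<le> 1 * (1 / (1 - p))" if z: "norm z < 1" for z
    unfolding e_def norm_mult
  proof (intro mult_mono blaschke_prod_le_1[OF ps z])
    have "p * norm z \<le> p * 1" using p z by (intro mult_left_mono) auto
    then have "1 - p \<le> norm (1 - of_real p * z)"
      using norm_triangle_ineq2[of 1 "of_real p * z"] p by (simp add: norm_mult)
    moreover have "norm (of_real (1 - p\<^sup>2) :: complex) \<le> 1"
      using p by (simp only: norm_of_real) (simp add: power_le_one)
    ultimately show "norm (of_real (1 - p\<^sup>2) / (1 - of_real p * z)) \<le> 1 / (1 - p)"
      unfolding norm_divide using p by (intro frac_le) auto
  qed auto
  let ?cs = "\<lambda>f i. if i < length es then cs f i else tail_coeff p (G f) 0"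
  have split: "f z = (\<Sum>i<length (es @ [e]). ?cs f i * ((es @ [e]) ! i) z)
      + blaschke_prod (ps @ [p]) z * blaschke_quot p (G f) z" if f: "f \<in> H2" and z: "norm z < 1" for f z
  proof -
    have Gf: "G f \<in> H2" using IH f by blast
    have "f z = (\<Sum>i<length es. cs f i * (es ! i) z) + blaschke_prod ps z * G f z"
      using IH f z by blast
    also have "G f z = tail_coeff p (G f) 0 * (of_real (1 - p\<^sup>2) / (1 - of_real p * z))
        + blaschke_factor p z * blaschke_quot p (G f) z"
      by (rule blaschke_quot_split[OF p Gf z])
    also have "(\<Sum>i<length es. cs f i * (es ! i) z) = (\<Sum>i<length es. ?cs f i * ((es @ [e]) ! i) z)"
      by (intro sum.cong) (auto simp: nth_append)
    finally show ?thesis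
      by (simp add: e_def blaschke_prod_def algebra_simps)
  qed
  show ?case
  proof (rule exI[of _ "\<lambda>f. blaschke_quot p (G f)"], rule exI[of _ ?cs], rule exI[of _ "es @ [e]"], intro conjI ballI allI impI)
    show "length (es @ [e]) = length (ps @ [p])" using IH by simp
    fix x assume "x \<in> set (es @ [e])"
    then consider "x \<in> set es" | "x = e" by auto
    then show "x holomorphic_on ball 0 1" "\<exists>M. \<forall>z. norm z < 1 \<longrightarrow> norm (x z) \<le> M"
      using IH e_hol e_bound by (cases; blast)+
  next
    fix f assume f: "f \<in> H2"
    then have Gf: "G f \<in> H2" "h2_norm (G f) \<le> h2_norm f" using IH by auto
    show "blaschke_quot p (G f) \<in> H2" "h2_norm (blaschke_quot p (G f)) \<le> h2_norm f"
      using blaschke_quot_H2[OF p Gf(1)] Gf(2) by auto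
    show "blaschke_quot p (G (\<lambda>z. f z + g z)) = (\<lambda>z. blaschke_quot p (G f) z + blaschke_quot p (G g) z)"
      if g: "g \<in> H2" for g
    proof -
      have "G (\<lambda>z. f z + g z) = (\<lambda>z. G f z + G g z)" "G g \<in> H2" using IH f g by auto
      then show ?thesis using blaschke_quot_add[OF p Gf(1)] by simp
    qed
    show "blaschke_quot p (G (\<lambda>z. c * f z)) = (\<lambda>z. c * blaschke_quot p (G f) z)" for c
    proof -
      have "G (\<lambda>z. c * f z) = (\<lambda>z. c * G f z)" using IH f by auto
      then show ?thesis using blaschke_quot_cmult[OF p Gf(1)] by simp
    qed
    show "f z = (\<Sum>i<length (es @ [e]). ?cs f i * ((es @ [e]) ! i) z)
      + blaschke_prod (ps @ [p]) z * blaschke_quot p (G f) z" if "norm z < 1" for z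
      by (rule split[OF f that])
  qed
qed

section \<open>The Green potential of a tapered row of zeros\<close>

context lens_symbol
begin

text \<open>Green's function of the strip |Im| < pi/2 with pole on the centre line, at height
  \<theta> and horizontal distance t. In half-plane terms it is -ln |(P - v) / (P + v)| for v on the
  edge of the sector.\<close>

definition G :: "real \<Rightarrow> real" where
  "G t = ln ((cosh t + c) / (cosh t - c)) / 2"

text \<open>Primitive of \<open>G\<close> vanishing at 0. Green's function vanishes at height pi/2,
  so \<open>G\<close> is an integral over \<psi>; integrating first in u gives an arctangent, whose
  limit at infinity is explicit.\<close>

definition G_int :: "real \<Rightarrow> real" where
  "G_int u = integral {\<theta>..pi/2} (\<lambda>\<psi>. arctan (sinh u / sin \<psi>))"

lemma cosh_diff_pos: "0 < cosh t - c" for t :: real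
  using cosh_real_ge_1[of t] c_pos c_less by linarith

lemma G_nonneg: "0 \<le> G t"
proof -
  have "1 \<le> (cosh t + c) / (cosh t - c)"
    using cosh_diff_pos[of t] c_pos c_less by (simp add: field_simps)
  then show ?thesis by (simp add: G_def)
qed

lemma G_antimono_abs:
  assumes "\<bar>s\<bar> \<le> \<bar>t\<bar>" shows "G t \<le> G s"
proof -
  have "cosh \<bar>s\<bar> \<le> cosh \<bar>t\<bar>" using assms cosh_real_nonneg_le_iff[of "\<bar>s\<bar>" "\<bar>t\<bar>"] by simp
  then have le: "cosh s \<le> cosh t" by (simp add: abs_if split: if_splits)
  have "(cosh t + c) / (cosh t - c) = 1 + 2 * c / (cosh t - c)" for t
    using cosh_diff_pos[of t] by (simp add: field_simps)
  moreover have "2 * c / (cosh t - c) \<le> 2 * c / (cosh s - c)"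
    using cosh_diff_pos[of s] c_pos c_less le by (intro divide_left_mono mult_pos_pos) auto
  moreover have "0 < (cosh t + c) / (cosh t - c)"
    using cosh_diff_pos[of t] c_pos c_less cosh_real_pos[of t] by (intro divide_pos_pos) auto
  ultimately show ?thesis by (simp add: G_def)
qed

lemma sin_pos_strip: "\<psi> \<in> {\<theta>..pi/2} \<Longrightarrow> 0 < sin \<psi>"
  using \<theta>_bounds by (intro sin_gt_zero) auto

lemma G_int_integrable: "(\<lambda>\<psi>. arctan (sinh u / sin \<psi>)) integrable_on {\<theta>..pi/2}"
  by (intro integrable_continuous_real continuous_intros) (use sin_pos_strip in force)

text \<open>The \<psi>-primitive is minus \<open>G\<close> with \<theta> replaced by \<psi>, and it
  vanishes at \<psi> = pi/2.\<close>

lemma G_eq_integral: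
  "((\<lambda>\<psi>. cosh u / sin \<psi> * inverse (1 + (sinh u / sin \<psi>)\<^sup>2)) has_integral G u) {\<theta>..pi/2}"
proof -
  let ?L = "\<lambda>\<psi>. - (ln (cosh u + cos \<psi>) - ln (cosh u - cos \<psi>)) / 2"
  have "((\<lambda>\<psi>. cosh u / sin \<psi> * inverse (1 + (sinh u / sin \<psi>)\<^sup>2)) has_integral (?L (pi/2) - ?L \<theta>)) {\<theta>..pi/2}"
  proof (rule fundamental_theorem_of_calculus)
    fix x assume x: "x \<in> {\<theta>..pi/2}"
    have s: "0 < sin x" using sin_pos_strip[OF x] .
    have c0: "0 \<le> cos x" using x \<theta>_bounds by (intro cos_ge_zero) auto
    have c1: "cos x < 1" using cos_monotone_0_pi[of 0 x] x \<theta>_bounds by auto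
    have p: "0 < cosh u + cos x" "0 < cosh u - cos x"
      using cosh_real_ge_1[of u] c0 c1 by linarith+
    have "(?L has_real_derivative - (- sin x / (cosh u + cos x) - sin x / (cosh u - cos x)) / 2) (at x within {\<theta>..pi/2})"
      using p by (auto intro!: derivative_eq_intros simp: mult_ac)
    moreover have "- (- sin x / (cosh u + cos x) - sin x / (cosh u - cos x)) / 2
        = cosh u / sin x * inverse (1 + (sinh u / sin x)\<^sup>2)"
    proof -
      have prod: "(cosh u + cos x) * (cosh u - cos x) = (sin x)\<^sup>2 + (sinh u)\<^sup>2"
        by (simp add: algebra_simps power2_eq_square[symmetric] cosh_square_eq sin_squared_eq)
      have "- (- sin x / (cosh u + cos x) - sin x / (cosh u - cos x)) / 2
          = sin x * cosh u / ((cosh u + cos x) * (cosh u - cos x))"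
      proof -
        have "- (- s / a - s / b) / 2 = s * ((a + b) / 2) / (a * b)" if "a \<noteq> 0" "b \<noteq> 0" for s a b :: real
          using that by (simp add: field_simps)
        then have "- (- sin x / (cosh u + cos x) - sin x / (cosh u - cos x)) / 2
            = sin x * ((cosh u + cos x + (cosh u - cos x)) / 2) / ((cosh u + cos x) * (cosh u - cos x))"
          using p by (metis less_irrefl)
        also have "(cosh u + cos x + (cosh u - cos x)) / 2 = cosh u" by simp
        finally show ?thesis .
      qed
      also have "\<dots> = sin x * cosh u / ((sin x)\<^sup>2 + (sinh u)\<^sup>2)" by (simp only: prod)
      also have "\<dots> = cosh u / sin x * inverse (1 + (sinh u / sin x)\<^sup>2)"
      proof -
        have "1 + (sinh u / sin x)\<^sup>2 = ((sin x)\<^sup>2 + (sinh u)\<^sup>2) / (sin x)\<^sup>2"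
          using s by (simp add: power_divide add_divide_distrib)
        then show ?thesis using s by (simp add: power2_eq_square)
      qed
      finally show ?thesis .
    qed
    ultimately show "(?L has_vector_derivative cosh u / sin x * inverse (1 + (sinh u / sin x)\<^sup>2)) (at x within {\<theta>..pi/2})"
      by (simp add: has_real_derivative_iff_has_vector_derivative)
  qed (use \<theta>_bounds in auto)
  moreover have "?L (pi/2) - ?L \<theta> = G u"
    using cosh_diff_pos[of u] c_pos c_less cosh_real_pos[of u] by (simp add: G_def c_def ln_div add_pos_pos field_simps)
  ultimately show ?thesis by simp
qed

lemma G_int_deriv: "(G_int has_real_derivative G u) (at u)"
proof -
  have "((\<lambda>u. integral (cbox \<theta> (pi/2)) (\<lambda>\<psi>. arctan (sinh u / sin \<psi>))) has_field_derivative
      integral (cbox \<theta> (pi/2)) (\<lambda>\<psi>. cosh u / sin \<psi> * inverse (1 + (sinh u / sin \<psi>)\<^sup>2))) (at u within UNIV)"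
  proof (rule leibniz_rule_field_derivative)
    fix x t :: real assume t: "t \<in> cbox \<theta> (pi/2)"
    then have "sin t \<noteq> 0" using sin_pos_strip[of t] by auto
    then show "((\<lambda>x. arctan (sinh x / sin t)) has_real_derivative
        cosh x / sin t * inverse (1 + (sinh x / sin t)\<^sup>2)) (at x within UNIV)"
      by (auto intro!: derivative_eq_intros simp: divide_inverse)
  next
    have nz: "sin (snd p) \<noteq> 0" if "p \<in> UNIV \<times> cbox \<theta> (pi/2)" for p :: "real \<times> real"
      using that sin_pos_strip[of "snd p"] by auto
    have pos: "1 + y\<^sup>2 \<noteq> 0" for y :: real
      by (smt (verit) zero_le_power2)
    show "continuous_on (UNIV \<times> cbox \<theta> (pi/2)) (\<lambda>(x, t). cosh x / sin t * inverse (1 + (sinh x / sin t)\<^sup>2))"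
      unfolding split_beta by (intro continuous_intros ballI nz pos)
  qed (use G_int_integrable in auto)
  then show ?thesis
    using integral_unique[OF G_eq_integral[of u]] by (simp add: G_int_def[abs_def])
qed

lemma G_int_odd: "G_int (- u) = - G_int u"
  by (simp add: G_int_def arctan_minus)

lemma G_int_le: "G_int u \<le> pi / 2 * (pi / 2 - \<theta>)"
proof -
  have "G_int u \<le> integral {\<theta>..pi/2} (\<lambda>\<psi>. pi / 2)"
    unfolding G_int_def by (intro integral_le G_int_integrable less_imp_le[OF arctan_ubound]) auto
  then show ?thesis using \<theta>_bounds by (simp add: mult.commute)
qed

text \<open>The defect from pi/2 is the arctangent of 1 / sinh u, at most 8/3 exp (-u) once exp (-u)
  <= 1/2; before that the left side is negative.\<close>

lemma arctan_sinh_ge: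
  assumes "0 \<le> u" shows "pi / 2 - pi * exp (- u) \<le> arctan (sinh u)"
proof (cases "exp (- u) \<le> 1 / 2")
  case True
  have u: "0 < u" using True assms by (cases "u = 0") auto
  then have s: "0 < sinh u" by simp
  have e2: "exp (- u) * exp (- u) \<le> 1 / 2 * (1 / 2)"
    using True by (intro mult_mono) auto
  have "inverse (sinh u) = 2 * exp (- u) / (1 - exp (- u) * exp (- u))"
    using s by (simp add: sinh_def exp_minus field_simps)
  also have "\<dots> \<le> 2 * exp (- u) / (3 / 4)"
    using e2 by (intro divide_left_mono mult_pos_pos) auto
  also have "\<dots> \<le> pi * exp (- u)" using pi_gt3 by simp
  finally have "inverse (sinh u) \<le> pi * exp (- u)" .
  moreover have "arctan (inverse (sinh u)) \<le> inverse (sinh u)"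
    using s by (intro arctan_le_self) auto
  moreover have "arctan (inverse (sinh u)) = pi / 2 - arctan (sinh u)"
    using arctan_inverse_pos[OF s] by simp
  ultimately show ?thesis by linarith
next
  case False
  then have "pi * (1 / 2) \<le> pi * exp (- u)" by (intro mult_left_mono) auto
  moreover have "0 \<le> arctan (sinh u)" using assms by simp
  ultimately show ?thesis by linarith
qed

text \<open>Since sin \<psi> <= 1, the integrand is smallest at \<psi> = pi/2.\<close>

lemma G_int_ge:
  assumes "0 \<le> u" shows "(pi / 2 - pi * exp (- u)) * (pi / 2 - \<theta>) \<le> G_int u"
proof -
  have "integral {\<theta>..pi/2} (\<lambda>\<psi>. pi / 2 - pi * exp (- u)) \<le> G_int u"
    unfolding G_int_def
  proof (intro integral_le G_int_integrable)
    fix \<psi> assume "\<psi> \<in> {\<theta>..pi/2}"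
    then have "sinh u * 1 \<le> sinh u / sin \<psi>"
      using sin_pos_strip[of \<psi>] assms by (auto simp: field_simps intro!: mult_left_le_one_le)
    then have "arctan (sinh u) \<le> arctan (sinh u / sin \<psi>)" by (simp add: arctan_le_iff)
    then show "pi / 2 - pi * exp (- u) \<le> arctan (sinh u / sin \<psi>)"
      using arctan_sinh_ge[OF assms] by linarith
  qed auto
  then show ?thesis using \<theta>_bounds by (simp add: mult.commute)
qed

text \<open>A second primitive, for integrating \<open>G\<close> by parts against a linear density.
  Averaging with the reflection makes it even, so that J (-x) becomes J x in the estimate.\<close>

lemma G_int_even_primitive:
  assumes "0 < X"
  obtains J where "\<And>u. J (- u) = J u"
    and "\<And>u. u \<in> {-X<..<X} \<Longrightarrow> (J has_real_derivative G_int u) (at u)"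
proof -
  have "continuous_on {-X..X} G_int"
    by (meson G_int_deriv DERIV_atLeastAtMost_imp_continuous_on)
  then obtain g where g: "\<And>u. u \<in> {-X..X} \<Longrightarrow> (g has_vector_derivative G_int u) (at u within {-X..X})"
    using antiderivative_continuous by blast
  have g': "(g has_real_derivative G_int u) (at u)" if "u \<in> {-X<..<X}" for u
    using g[of u] that at_within_interior[of u "{-X..X}"]
    by (simp add: has_real_derivative_iff_has_vector_derivative)
  show ?thesis
  proof
    show "(g (- (- u)) + g (- u)) / 2 = (g (- u) + g u) / 2" for u by (simp add: add.commute)
    fix u assume u: "u \<in> {-X<..<X}"
    have "((\<lambda>u. g (- u)) has_real_derivative G_int (- u) * (- 1)) (at u)"
      by (rule DERIV_chain2[OF g']) (use u in \<open>auto intro!: derivative_eq_intros\<close>)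
    then have "((\<lambda>u. (g (- u) + g u) / 2) has_real_derivative (G_int (- u) * (- 1) + G_int u) / 2) (at u)"
      by (intro DERIV_cdivide DERIV_add g' u)
    then show "((\<lambda>u. (g (- u) + g u) / 2) has_real_derivative G_int u) (at u)"
      by (simp add: G_int_odd)
  qed
qed

text \<open>A cell right of 0 is bounded by the value \<open>G (u (Suc k))\<close> at its left end,
  a cell left of 0 by \<open>G (u k)\<close>, the sample of the preceding index. The shift leaves
  one cell, that around 0, to be paid by \<open>G 0\<close>.\<close>

lemma unimodal_sum_le:
  fixes u e :: "nat \<Rightarrow> real"
  assumes u: "\<And>k. u (Suc k) \<le> u k" and u0: "0 \<le> u 0"
    and e: "\<And>k M. k < N \<Longrightarrow> (\<And>t. u (Suc k) \<le> t \<Longrightarrow> t \<le> u k \<Longrightarrow> G t \<le> M) \<Longrightarrow> e k \<le> M"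
  shows "(\<Sum>k<N. e k) \<le> (\<Sum>k<N. G (u (Suc k))) + G 0"
proof -
  \<comment> \<open>In the negative phase, \<open>G (u m)\<close> on the left is the sample still to
    be spent on the next cell.\<close>
  have "(0 \<le> u m \<longrightarrow> (\<Sum>k<m. e k) \<le> (\<Sum>k<m. G (u (Suc k))))
      \<and> (u m < 0 \<longrightarrow> (\<Sum>k<m. e k) + G (u m) \<le> (\<Sum>k<m. G (u (Suc k))) + G 0)" if "m \<le> N" for m
    using that
  proof (induction m)
    case 0
    then show ?case using u0 by auto
  next
    case (Suc m)
    have em: "e m \<le> M" if "\<And>t. u (Suc m) \<le> t \<Longrightarrow> t \<le> u m \<Longrightarrow> G t \<le> M" for M
      using e[of m M] that Suc.prems by auto
    consider "0 \<le> u (Suc m)" | "u (Suc m) < 0" "0 \<le> u m" | "u m < 0" by linarith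
    then show ?case
    proof cases
      case 1
      have "e m \<le> G (u (Suc m))" by (rule em) (use 1 in \<open>auto intro: G_antimono_abs\<close>)
      then show ?thesis using Suc 1 u[of m] by auto
    next
      case 2
      have "e m \<le> G 0" by (rule em) (auto intro: G_antimono_abs)
      then show ?thesis using Suc 2 by auto
    next
      case 3
      have "e m \<le> G (u m)" by (rule em) (use 3 in \<open>auto intro: G_antimono_abs\<close>)
      then show ?thesis using Suc 3 u[of m] by auto
    qed
  qed
  from this[of N] show ?thesis using G_nonneg[of 0] G_nonneg[of "u N"] by (cases "0 \<le> u N") auto
qed

text \<open>The zeros are the quantiles of the linear density \<open>(A - a) / (\<alpha> \<pi>\<^sup>2)\<close> on \<open>[0, A]\<close>, so the sum is
  compared with the convolution of \<open>G\<close> with this density; by unimodality of \<open>G\<close> the error is at most \<open>G 0\<close>.\<close>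
lemma sum_G_ge:
  fixes N :: nat
  defines "A \<equiv> pi * sqrt (2 * \<alpha> * real N)"
  assumes x: "0 \<le> x" "x \<le> A"
  shows "(1 - \<alpha>) / (2 * \<alpha>) * (A - x) - (1 - \<alpha>) / \<alpha> * A * exp (- x) - G 0
    \<le> (\<Sum>k<N. G (A - x - pi * sqrt (2 * \<alpha> * real (Suc k))))"
proof -
  define D where "D = A - x"
  \<comment> \<open>Quantiles in the shifted variable: the density \<sigma> (D - t) has mass k on
    [u k, D], as \<open>sq\<close> records, so every cell has mass 1.\<close>
  define u where "u k = D - pi * sqrt (2 * \<alpha> * real k)" for k
  define \<sigma> where "\<sigma> = 1 / (\<alpha> * pi\<^sup>2)"
  define \<delta> where "\<delta> = pi / 2 - \<theta>"
  have A: "0 \<le> A" using \<alpha>_pos by (simp add: A_def)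
  have D: "0 \<le> D" "D \<le> A" using x by (auto simp: D_def)
  have \<sigma>: "0 < \<sigma>" using \<alpha>_pos by (simp add: \<sigma>_def)
  have \<delta>: "0 < \<delta>" using \<theta>_bounds by (simp add: \<delta>_def)
  obtain J where Jeven: "\<And>u. J (- u) = J u"
    and J: "\<And>u. u \<in> {-(A+1)<..<A+1} \<Longrightarrow> (J has_real_derivative G_int u) (at u)"
    using G_int_even_primitive[of "A + 1"] A by auto
  define K where "K t = (D - t) * G_int t + J t" for t
  have K: "(K has_real_derivative (D - t) * G t) (at t)" if "t \<in> {-(A+1)<..<A+1}" for t
    unfolding K_def by (rule derivative_eq_intros J G_int_deriv that refl)+ (simp add: algebra_simps)
  have u_mono: "u (Suc k) \<le> u k" for k
    using \<alpha>_pos by (auto simp: u_def intro!: mult_left_mono)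
  have u_range: "- x \<le> u k" "u k \<le> D" if "k \<le> N" for k
  proof -
    have "pi * sqrt (2 * \<alpha> * real k) \<le> A"
      unfolding A_def using that \<alpha>_pos by (intro mult_left_mono real_sqrt_le_mono) auto
    then show "- x \<le> u k" by (simp add: u_def D_def)
    show "u k \<le> D" using \<alpha>_pos by (simp add: u_def)
  qed
  have sq: "(D - u k)\<^sup>2 = 2 * real k / \<sigma>" for k
    using \<alpha>_pos by (simp add: u_def \<sigma>_def power_mult_distrib)
  \<comment> \<open>A cell has mass 1, so the weighted mean of \<open>G\<close> over it is at most
    M; expressed as monotonicity of \<open>?H\<close>, a primitive of (D - t) (M - G t).\<close>
  have cell: "\<sigma> * (K (u k) - K (u (Suc k))) \<le> M"
    if k: "k < N" and M: "\<And>t. u (Suc k) \<le> t \<Longrightarrow> t \<le> u k \<Longrightarrow> G t \<le> M" for k M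
  proof -
    let ?H = "\<lambda>t. - M * (D - t)\<^sup>2 / 2 - K t"
    have "?H (u (Suc k)) \<le> ?H (u k)"
    proof (rule DERIV_nonneg_imp_nondecreasing[OF u_mono])
      fix t assume t: "u (Suc k) \<le> t" "t \<le> u k"
      have "t \<in> {-(A+1)<..<A+1}" "t \<le> D"
        using t u_range[of k] u_range[of "Suc k"] k x D by auto
      then have "(?H has_real_derivative (D - t) * (M - G t)) (at t)"
        by (auto intro!: derivative_eq_intros K simp: field_simps)
      moreover have "0 \<le> (D - t) * (M - G t)" using \<open>t \<le> D\<close> M[OF t] by simp
      ultimately show "\<exists>y. (?H has_real_derivative y) (at t) \<and> 0 \<le> y" by blast
    qed
    moreover have "M * (D - u (Suc k))\<^sup>2 / 2 - M * (D - u k)\<^sup>2 / 2 = M / \<sigma>"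
      unfolding sq using \<sigma> by (simp add: field_simps)
    ultimately have "K (u k) - K (u (Suc k)) \<le> M / \<sigma>" by linarith
    then show ?thesis using \<sigma> by (simp add: field_simps)
  qed
  have "(\<Sum>k<N. \<sigma> * (K (u k) - K (u (Suc k)))) \<le> (\<Sum>k<N. G (u (Suc k))) + G 0"
    by (rule unimodal_sum_le[where u = u, OF u_mono]) (use D cell in \<open>auto simp: u_def\<close>)
  moreover have "(\<Sum>k<N. \<sigma> * (K (u k) - K (u (Suc k)))) = \<sigma> * (K (u 0) - K (u N))"
    using sum_lessThan_telescope'[of "\<lambda>k. K (u k)" N] by (simp only: sum_distrib_left[symmetric])
  moreover have "u 0 = D" "u N = - x" by (simp_all add: u_def D_def A_def)
  ultimately have s1: "\<sigma> * (K D - K (- x)) - G 0 \<le> (\<Sum>k<N. G (u (Suc k)))" by simp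
  have KK: "K D - K (- x) = A * G_int x + (J D - J x)"
    by (simp add: K_def G_int_odd Jeven D_def)
  define E where "E = \<delta> * pi * exp (- x)"
  have E: "0 \<le> E" using \<delta> by (simp add: E_def)
  have Gx: "pi / 2 * \<delta> - E \<le> G_int x"
    using G_int_ge[OF x(1)] by (simp add: E_def \<delta>_def algebra_simps)
  have mvt: "\<exists>z>a. z < b \<and> J b - J a = (b - a) * G_int z" if "a < b" "-A \<le> a" "b \<le> A" for a b
    using that J by (intro MVT2) auto
  \<comment> \<open>D - x may have either sign: \<open>G_int_le\<close> serves D < x and
    \<open>G_int_ge\<close> serves D > x.\<close>
  have JJ: "(D - x) * (pi / 2 * \<delta>) - A * E \<le> J D - J x"
  proof (cases D x rule: linorder_cases)
    case less
    then obtain z where "J x - J D = (x - D) * G_int z" using mvt[of D x] D x by auto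
    also have "\<dots> \<le> (x - D) * (pi / 2 * \<delta>)"
      using less G_int_le[of z] by (intro mult_left_mono) (auto simp: \<delta>_def)
    finally have "J x - J D \<le> (x - D) * (pi / 2 * \<delta>)" .
    moreover have "(x - D) * (pi / 2 * \<delta>) = - ((D - x) * (pi / 2 * \<delta>))"
      by (simp only: minus_mult_left minus_diff_eq)
    ultimately show ?thesis using mult_nonneg_nonneg[OF A E] by linarith
  next
    case equal
    then show ?thesis using mult_nonneg_nonneg[OF A E] by simp
  next
    case greater
    then obtain z where z: "x < z" "J D - J x = (D - x) * G_int z" using mvt[of x D] D x by auto
    have "pi / 2 * \<delta> - \<delta> * pi * exp (- z) \<le> G_int z"
      using G_int_ge[of z] z x by (simp add: \<delta>_def algebra_simps)
    moreover have "\<delta> * pi * exp (- z) \<le> E"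
      unfolding E_def using z \<delta> by (intro mult_left_mono) auto
    ultimately have "(D - x) * (pi / 2 * \<delta> - E) \<le> J D - J x"
      unfolding z(2) using greater by (intro mult_left_mono) auto
    moreover have "(D - x) * E \<le> A * E" using E D x by (intro mult_right_mono) auto
    ultimately show ?thesis by (simp add: algebra_simps)
  qed
  have "A * (pi / 2 * \<delta> - E) \<le> A * G_int x" by (intro mult_left_mono Gx A)
  with JJ have "pi * \<delta> * D - 2 * A * E \<le> K D - K (- x)"
    unfolding KK by (simp add: D_def field_simps)
  then have s2: "\<sigma> * (pi * \<delta> * D - 2 * A * E) \<le> \<sigma> * (K D - K (- x))"
    using \<sigma> by (intro mult_left_mono) auto
  \<comment> \<open>Slope of the density times the total mass pi \<delta> of \<open>G\<close>; this
    is the later \<open>\<beta>\<close>.\<close>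
  have sd: "\<sigma> * pi * \<delta> = (1 - \<alpha>) / (2 * \<alpha>)"
    using \<alpha>_pos by (simp add: \<sigma>_def \<delta>_def \<theta>_def power2_eq_square field_simps)
  have "\<sigma> * (pi * \<delta> * D - 2 * A * E) = (\<sigma> * pi * \<delta>) * D - 2 * (\<sigma> * pi * \<delta>) * A * exp (- x)"
    by (simp add: E_def algebra_simps)
  also have "\<dots> = (1 - \<alpha>) / (2 * \<alpha>) * D - (1 - \<alpha>) / \<alpha> * A * exp (- x)"
    unfolding sd using \<alpha>_pos by (simp add: divide_simps)
  finally have "\<dots> \<le> \<sigma> * (K D - K (- x))" using s2 by simp
  then show ?thesis using s1 unfolding u_def D_def by linarith
qed

end

section \<open>The upper bound\<close>

lemma h2_bounded_linear_zero: "h2_bounded_linear (\<lambda>f z. 0)"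
  by (auto simp: h2_bounded_linear_def zero_H2 h2_norm_zero intro!: exI[of _ 0])

lemma h2_rank_less_zero: "1 \<le> n \<Longrightarrow> h2_rank_less (\<lambda>f z. 0) n"
  by (auto simp: h2_rank_less_def intro!: exI[of _ "[]"])

text \<open>\<open>Sup\<close> of a set of reals is informative only when the set is bounded, which
  the constant C provides.\<close>

lemma h2_op_norm_ge:
  assumes "\<And>f. f \<in> H2 \<Longrightarrow> h2_norm (T f) \<le> C * h2_norm f" and f: "f \<in> H2" "h2_norm f \<le> 1"
  shows "h2_norm (T f) \<le> h2_op_norm T"
proof -
  have "h2_norm (T g) \<le> \<bar>C\<bar>" if "g \<in> H2" "h2_norm g \<le> 1" for g
  proof -
    have "h2_norm (T g) \<le> \<bar>C\<bar> * h2_norm g"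
      using assms(1)[OF that(1)] mult_right_mono[OF abs_ge_self h2_norm_nonneg[OF that(1)], of C] by linarith
    also have "\<dots> \<le> \<bar>C\<bar> * 1" using that by (intro mult_left_mono) auto
    finally show ?thesis by simp
  qed
  then have "bdd_above {h2_norm (T f) |f. f \<in> H2 \<and> h2_norm f \<le> 1}"
    by (intro bdd_aboveI[of _ "\<bar>C\<bar>"]) auto
  then show ?thesis unfolding h2_op_norm_def using f by (intro cSup_upper) auto
qed

lemma h2_op_norm_le:
  assumes "\<And>f. f \<in> H2 \<Longrightarrow> h2_norm f \<le> 1 \<Longrightarrow> h2_norm (T f) \<le> C"
  shows "h2_op_norm T \<le> C"
  unfolding h2_op_norm_def using assms zero_H2 h2_norm_zero by (intro cSup_least) force+

lemma H2_operator_diff_bound: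
  assumes T: "h2_bounded_linear T" and R: "h2_bounded_linear R"
  shows "\<exists>C. \<forall>f\<in>H2. h2_norm (\<lambda>z. T f z - R f z) \<le> C * h2_norm f"
proof -
  obtain C where C: "\<forall>f\<in>H2. h2_norm (T f) \<le> C * h2_norm f"
    using T by (auto simp: h2_bounded_linear_def)
  obtain D where D: "\<forall>f\<in>H2. h2_norm (R f) \<le> D * h2_norm f"
    using R by (auto simp: h2_bounded_linear_def)
  have "h2_norm (\<lambda>z. T f z - R f z) \<le> (C + D) * h2_norm f" if "f \<in> H2" for f
  proof -
    have "T f \<in> H2" "R f \<in> H2" using T R that by (auto simp: h2_bounded_linear_def)
    from h2_norm_diff[OF this] bspec[OF C that] bspec[OF D that] show ?thesis by (simp add: distrib_right)
  qed
  then show ?thesis by blast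
qed

text \<open>Supplies the lower bound that makes the infimum in \<open>approx_number\<close>
  meaningful.\<close>

lemma h2_op_norm_diff_nonneg:
  assumes T: "h2_bounded_linear T" and R: "h2_bounded_linear R"
  shows "0 \<le> h2_op_norm (\<lambda>f z. T f z - R f z)"
proof -
  obtain C where C: "\<And>f. f \<in> H2 \<Longrightarrow> h2_norm (\<lambda>z. T f z - R f z) \<le> C * h2_norm f"
    using H2_operator_diff_bound[OF assms] by blast
  have "(\<lambda>z. T (\<lambda>z. 0) z - R (\<lambda>z. 0) z) \<in> H2"
    using T R zero_H2 by (intro conjunct1[OF h2_norm_diff]) (auto simp: h2_bounded_linear_def)
  then have "0 \<le> h2_norm (\<lambda>z. T (\<lambda>z. 0) z - R (\<lambda>z. 0) z)" by (rule h2_norm_nonneg)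
  also have "\<dots> \<le> h2_op_norm (\<lambda>f z. T f z - R f z)"
    using h2_op_norm_ge[where T = "\<lambda>f z. T f z - R f z", OF C] zero_H2 h2_norm_zero by simp
  finally show ?thesis .
qed

lemma approx_number_le:
  assumes T: "h2_bounded_linear T" and R: "h2_bounded_linear R" "h2_rank_less R n"
    and C: "\<And>f. f \<in> H2 \<Longrightarrow> h2_norm f \<le> 1 \<Longrightarrow> h2_norm (\<lambda>z. T f z - R f z) \<le> C"
  shows "approx_number T n \<le> C"
proof -
  have "bdd_below {h2_op_norm (\<lambda>f z. T f z - R f z) |R. h2_bounded_linear R \<and> h2_rank_less R n}"
    using h2_op_norm_diff_nonneg[OF T] by (intro bdd_belowI[of _ 0]) auto
  then have "approx_number T n \<le> h2_op_norm (\<lambda>f z. T f z - R f z)"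
    unfolding approx_number_def using R by (intro cInf_lower) auto
  also have "\<dots> \<le> C" by (rule h2_op_norm_le[OF C])
  finally show ?thesis .
qed

section \<open>Approximation by dividing out a Blaschke product\<close>

context lens_symbol
begin

lemma comp_op_bounded_linear: "h2_bounded_linear (comp_op \<phi>)"
  unfolding h2_bounded_linear_def
  using comp_op_bounded by (auto simp: comp_op_def)

lemma approx_number_le_blaschke:
  assumes ps: "set ps \<subseteq> {0..<1}" "length ps < n" and M: "0 \<le> M"
    and B: "\<And>z. norm z < 1 \<Longrightarrow> (norm (blaschke_prod ps (\<phi> z)))\<^sup>2 \<le> M * norm (1 - z) powr (\<alpha> - 1)"
  shows "approx_number (comp_op \<phi>) n \<le> sqrt (M * Cw)"
proof -
  obtain G cs es where len: "length es = length ps"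
    and div: "\<forall>e\<in>set es. e holomorphic_on ball 0 1 \<and> (\<exists>M. \<forall>z. norm z < 1 \<longrightarrow> norm (e z) \<le> M)"
      "\<forall>f\<in>H2. G f \<in> H2 \<and> h2_norm (G f) \<le> h2_norm f"
      "\<forall>f\<in>H2. \<forall>g\<in>H2. G (\<lambda>z. f z + g z) = (\<lambda>z. G f z + G g z)"
      "\<forall>c. \<forall>f\<in>H2. G (\<lambda>z. c * f z) = (\<lambda>z. c * G f z)"
      "\<forall>f\<in>H2. \<forall>z. norm z < 1 \<longrightarrow>
          f z = (\<Sum>i<length es. cs f i * (es ! i) z) + blaschke_prod ps z * G f z"
    using blaschke_division[OF ps(1)] by (elim exE conjE) (rule that; assumption)
  have es: "\<And>e. e \<in> set es \<Longrightarrow> e holomorphic_on ball 0 1 \<and> (\<exists>M. \<forall>z. norm z < 1 \<longrightarrow> norm (e z) \<le> M)"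
    and G: "\<And>f. f \<in> H2 \<Longrightarrow> G f \<in> H2 \<and> h2_norm (G f) \<le> h2_norm f"
    and G_add: "\<And>f g. f \<in> H2 \<Longrightarrow> g \<in> H2 \<Longrightarrow> G (\<lambda>z. f z + g z) = (\<lambda>z. G f z + G g z)"
    and G_cmult: "\<And>c f. f \<in> H2 \<Longrightarrow> G (\<lambda>z. c * f z) = (\<lambda>z. c * G f z)"
    and split: "\<And>f z. f \<in> H2 \<Longrightarrow> norm z < 1 \<Longrightarrow>
          f z = (\<Sum>i<length es. cs f i * (es ! i) z) + blaschke_prod ps z * G f z"
    using div by blast+
  define W where "W g = (\<lambda>z. if z \<in> ball 0 1 then blaschke_prod ps (\<phi> z) * g (\<phi> z) else 0)" for g
  \<comment> \<open>Subtracting the error term from the full operator gives linearity and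
    boundedness from \<open>G\<close>; the rank is read off from \<open>split\<close>.\<close>
  define R where "R f = (\<lambda>z. comp_op \<phi> f z - W (G f) z)" for f
  have U: "(\<lambda>z. blaschke_prod ps (\<phi> z)) holomorphic_on ball 0 1"
    using norm_\<phi>_less
    by (intro holomorphic_on_compose_gen[OF \<phi>_holomorphic blaschke_prod_holomorphic[OF ps(1)], unfolded o_def]) auto
  have W: "W g \<in> H2" "h2_norm (W g) \<le> sqrt (M * Cw) * h2_norm g" if "g \<in> H2" for g
    using weighted_composition[OF U M B that] unfolding W_def by auto
  have WG: "W (G f) \<in> H2" "h2_norm (W (G f)) \<le> sqrt (M * Cw) * h2_norm f" if f: "f \<in> H2" for f
  proof -
    show "W (G f) \<in> H2" using W G[OF f] by simp
    have "h2_norm (W (G f)) \<le> sqrt (M * Cw) * h2_norm (G f)" using W G[OF f] by simp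
    also have "\<dots> \<le> sqrt (M * Cw) * h2_norm f"
      using G[OF f] M Cw_pos by (intro mult_left_mono) auto
    finally show "h2_norm (W (G f)) \<le> sqrt (M * Cw) * h2_norm f" .
  qed
  have R_bl: "h2_bounded_linear R"
    unfolding h2_bounded_linear_def
  proof (intro conjI ballI allI)
    fix f assume f: "f \<in> H2"
    show "R f \<in> H2" unfolding R_def using h2_norm_diff comp_op_bounded(1)[OF f] WG(1)[OF f] by blast
    show "R (\<lambda>z. f z + g z) = (\<lambda>z. R f z + R g z)" if "g \<in> H2" for g
      unfolding R_def W_def G_add[OF f that] by (auto simp: comp_op_def algebra_simps)
    show "R (\<lambda>z. c * f z) = (\<lambda>z. c * R f z)" for c
      unfolding R_def W_def G_cmult[OF f] by (auto simp: comp_op_def algebra_simps)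
  next
    have "h2_norm (R f) \<le> (sqrt (2 * Cw) + sqrt (M * Cw)) * h2_norm f" if f: "f \<in> H2" for f
      using h2_norm_diff[OF comp_op_bounded(1)[OF f] WG(1)[OF f]] comp_op_bounded(2)[OF f] WG(2)[OF f]
      by (simp add: R_def distrib_right)
    then show "\<exists>C. \<forall>f\<in>H2. h2_norm (R f) \<le> C * h2_norm f" by blast
  qed
  have R_rank: "h2_rank_less R n"
    unfolding h2_rank_less_def
  proof (intro exI[of _ "map (comp_op \<phi>) es"] conjI ballI)
    show "length (map (comp_op \<phi>) es) < n" using len ps by simp
    show "set (map (comp_op \<phi>) es) \<subseteq> H2"
    proof
      fix g assume "g \<in> set (map (comp_op \<phi>) es)"
      then obtain e where e: "e \<in> set es" "g = comp_op \<phi> e" by auto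
      then obtain K where hol: "e holomorphic_on ball 0 1" and K: "\<And>z. norm z < 1 \<Longrightarrow> norm (e z) \<le> K"
        using es by blast
      have "(\<lambda>z. e (\<phi> z)) holomorphic_on ball 0 1"
        using norm_\<phi>_less by (intro holomorphic_on_compose_gen[OF \<phi>_holomorphic hol, unfolded o_def]) auto
      then have "g holomorphic_on ball 0 1"
        unfolding e(2) by (rule holomorphic_transform) (simp add: comp_op_def)
      then show "g \<in> H2"
        by (rule bounded_holomorphic_H2[of _ K]) (auto simp: e(2) comp_op_def K norm_\<phi>_less)
    qed
    fix f assume f: "f \<in> H2"
    have "R f = (\<lambda>z. \<Sum>i<length es. cs f i * (map (comp_op \<phi>) es ! i) z)"
    proof
      fix z
      show "R f z = (\<Sum>i<length es. cs f i * (map (comp_op \<phi>) es ! i) z)"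
        using split[OF f norm_\<phi>_less, of z]
        by (cases "norm z < 1") (auto simp: R_def W_def comp_op_def)
    qed
    then show "\<exists>c. R f = (\<lambda>z. \<Sum>i<length (map (comp_op \<phi>) es). c i * (map (comp_op \<phi>) es ! i) z)"
      by auto
  qed
  show ?thesis
  proof (rule approx_number_le[OF comp_op_bounded_linear R_bl R_rank])
    fix f assume f: "f \<in> H2" "h2_norm f \<le> 1"
    have "h2_norm (W (G f)) \<le> sqrt (M * Cw) * 1"
      using WG(2)[OF f(1)] mult_left_mono[OF f(2), of "sqrt (M * Cw)"] M Cw_pos by simp
    then show "h2_norm (\<lambda>z. comp_op \<phi> f z - R f z) \<le> sqrt (M * Cw)" by (simp add: R_def)
  qed
qed

text \<open>The half-plane coordinate (1 - \<zeta>) / (1 + \<zeta>) of the image point \<zeta> =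
  \<phi> z.\<close>

definition v where "v z = w z / (2 + w z)"

text \<open>v stays in the sector of w and is comparable to it: the numerator of Re v is 2 Re w +
  |w|^2, which dominates c |w| (2 + |w|).\<close>

lemma v_properties:
  assumes z: "norm z < 1"
  shows "norm (w z) / 4 \<le> norm (v z)" "norm (v z) \<le> norm (w z) / 2" "c * norm (v z) \<le> Re (v z)" "v z \<noteq> 0"
proof -
  have Re_w: "0 \<le> Re (w z)" using Re_w_ge[OF z] c_pos by (smt (verit) mult_nonneg_nonneg norm_ge_zero)
  have lower: "2 \<le> norm (2 + w z)" using complex_Re_le_cmod[of "2 + w z"] Re_w by simp
  have upper: "norm (2 + w z) \<le> 2 + norm (w z)" using norm_triangle_ineq[of 2 "w z"] by simp
  have nz: "2 + w z \<noteq> 0" using lower by auto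
  show "norm (w z) / 4 \<le> norm (v z)"
    unfolding v_def norm_divide using upper lower norm_w_le[OF z] by (intro divide_left_mono) auto
  show "norm (v z) \<le> norm (w z) / 2"
    unfolding v_def norm_divide using lower by (intro divide_left_mono) auto
  show "v z \<noteq> 0" using nz w_nonzero[OF z] by (simp add: v_def)
  have "Re (v z) = (2 * Re (w z) + (norm (w z))\<^sup>2) / (norm (2 + w z))\<^sup>2"
    unfolding v_def Re_divide cmod_power2 by (simp add: power2_eq_square algebra_simps)
  moreover have "c * norm (w z) * norm (2 + w z) \<le> 2 * Re (w z) + (norm (w z))\<^sup>2"
  proof -
    have "c * norm (w z) * norm (2 + w z) \<le> c * norm (w z) * (2 + norm (w z))"
      using c_pos by (intro mult_left_mono upper) auto
    also have "\<dots> = 2 * (c * norm (w z)) + c * (norm (w z))\<^sup>2"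
      by (simp add: power2_eq_square algebra_simps)
    also have "c * (norm (w z))\<^sup>2 \<le> 1 * (norm (w z))\<^sup>2"
      using c_less by (intro mult_right_mono) auto
    finally show ?thesis using Re_w_ge[OF z] by simp
  qed
  ultimately have "c * norm (w z) * norm (2 + w z) / (norm (2 + w z))\<^sup>2 \<le> Re (v z)"
    by (simp add: divide_right_mono)
  moreover have "c * norm (w z) * norm (2 + w z) / (norm (2 + w z))\<^sup>2 = c * norm (v z)"
    using nz by (simp add: v_def norm_divide power2_eq_square)
  ultimately show "c * norm (v z) \<le> Re (v z)" by simp
qed

text \<open>The point of the disc with half-plane coordinate exp (-a); a = 0 is the origin.\<close>

definition zero_at :: "real \<Rightarrow> real" where
  "zero_at a = (1 - exp (- a)) / (1 + exp (- a))"

lemma zero_at_range: "0 \<le> a \<Longrightarrow> zero_at a \<in> {0..<1}"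
  by (simp add: zero_at_def add_pos_pos)

text \<open>In the coordinate \<open>v = (1 - \<zeta>) / (1 + \<zeta>)\<close> on the right half-plane the factor becomes
  \<open>(P - v) / (P + v)\<close> with \<open>P = exp (-a)\<close>.\<close>
lemma blaschke_factor_zero_at_le:
  assumes z: "norm z < 1"
  shows "norm (blaschke_factor (zero_at a) (\<phi> z)) \<le> exp (- G (a + ln (norm (v z))))"
proof -
  define P where "P = exp (- a)"
  define \<rho> where "\<rho> = norm (v z)"
  define y where "y = Re (v z) / \<rho>"
  define C where "C = cosh (a + ln \<rho>)"
  have P: "0 < P" by (simp add: P_def)
  have \<rho>: "0 < \<rho>" using v_properties[OF z] by (simp add: \<rho>_def)
  have y: "c \<le> y" using v_properties(3)[OF z] \<rho> by (simp add: y_def \<rho>_def field_simps)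
  have y1: "y \<le> 1" using complex_Re_le_cmod[of "v z"] \<rho> by (simp add: y_def \<rho>_def)
  have C1: "1 \<le> C" unfolding C_def by (rule cosh_real_ge_1)
  \<comment> \<open>Takes out the common factor 2 P \<rho>; the modulus then depends only on C and
    on the cosine y of the argument of v.\<close>
  have PC: "P\<^sup>2 + \<rho>\<^sup>2 = 2 * P * \<rho> * C"
  proof -
    have "exp (a + ln \<rho>) = \<rho> / P" "exp (- (a + ln \<rho>)) = P / \<rho>"
      using \<rho> by (auto simp: P_def exp_add exp_minus exp_diff field_simps)
    then have "C = (\<rho> / P + P / \<rho>) / 2" unfolding C_def cosh_field_def by simp
    then show ?thesis using P \<rho> by (simp add: power2_eq_square field_simps)
  qed
  have n: "(norm (of_real P - v z))\<^sup>2 = 2 * P * \<rho> * (C - y)" "(norm (of_real P + v z))\<^sup>2 = 2 * P * \<rho> * (C + y)"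
  proof -
    have "(norm (v z))\<^sup>2 = \<rho>\<^sup>2" by (simp add: \<rho>_def)
    then have "(norm (of_real P - v z))\<^sup>2 = P\<^sup>2 + \<rho>\<^sup>2 - 2 * P * Re (v z)"
      "(norm (of_real P + v z))\<^sup>2 = P\<^sup>2 + \<rho>\<^sup>2 + 2 * P * Re (v z)"
      unfolding cmod_power2 by (auto simp: power2_eq_square algebra_simps)
    moreover have "Re (v z) = \<rho> * y" using \<rho> by (simp add: y_def)
    ultimately show "(norm (of_real P - v z))\<^sup>2 = 2 * P * \<rho> * (C - y)" "(norm (of_real P + v z))\<^sup>2 = 2 * P * \<rho> * (C + y)"
      unfolding PC by (auto simp: algebra_simps)
  qed
  have bf: "blaschke_factor (zero_at a) (\<phi> z) = (of_real P - v z) / (of_real P + v z)"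
  proof -
    have nz: "1 + w z \<noteq> 0" "2 + w z \<noteq> 0"
      using norm_one_plus_w_ge[OF z] c_pos w_nonzero[OF z] v_properties(4)[OF z]
      by (auto simp: v_def add_pos_nonneg) (smt (verit) mult_nonneg_nonneg norm_ge_zero)
    have P1: "(1 + of_real P :: complex) \<noteq> 0"
      using P by (metis Re_complex_of_real add_pos_pos less_irrefl of_real_1 of_real_add zero_complex.sel(1) zero_less_one)
    have "0 < Re (v z)" using v_properties[OF z] c_pos \<rho> unfolding \<rho>_def by (smt (verit) mult_pos_pos)
    then have "0 < Re (of_real P + v z)" using P by simp
    then have nzP: "of_real P + v z \<noteq> 0" by (metis less_irrefl zero_complex.sel(1))
    have p: "complex_of_real (zero_at a) = (1 - of_real P) / (1 + of_real P)"
      by (simp add: zero_at_def P_def)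
    have vw: "v z * (2 + w z) = w z" using nz by (simp add: v_def)
    have v2: "(of_real P - v z) * (2 + w z) = of_real P * (2 + w z) - w z"
      "(of_real P + v z) * (2 + w z) = of_real P * (2 + w z) + w z"
      unfolding left_diff_distrib distrib_right vw by simp_all
    have 1: "\<phi> z - of_real (zero_at a) = (of_real P - v z) * (2 + w z) / ((1 + w z) * (1 + of_real P))"
    proof -
      have "1 / X - (2 - Y) / Y = ((Y - 1) * (X + 1) - (X - 1)) / (X * Y)" if "X \<noteq> 0" "Y \<noteq> 0" for X Y :: complex
        using that by (simp add: field_simps)
      from this[OF nz(1) P1] show ?thesis unfolding p \<phi>_def v2 by (simp add: add.commute)
    qed
    have 2: "1 - of_real (zero_at a) * \<phi> z = (of_real P + v z) * (2 + w z) / ((1 + w z) * (1 + of_real P))"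
    proof -
      have "1 - (2 - Y) / Y * (1 / X) = ((Y - 1) * (X + 1) + (X - 1)) / (X * Y)" if "X \<noteq> 0" "Y \<noteq> 0" for X Y :: complex
        using that by (simp add: field_simps)
      from this[OF nz(1) P1] show ?thesis unfolding p \<phi>_def v2 by (simp add: add.commute)
    qed
    show ?thesis unfolding blaschke_factor_def 1 2 using nz P1 nzP by simp
  qed
  have "(norm (blaschke_factor (zero_at a) (\<phi> z)))\<^sup>2 = (C - y) / (C + y)"
    unfolding bf norm_divide power_divide n using P \<rho> by simp
  \<comment> \<open>The quotient decreases in y, so the edge y = c of the sector is the worst
    case.\<close>
  also have "\<dots> \<le> (C - c) / (C + c)"
    using C1 y y1 c_pos c_less by (intro frac_le) auto
  also have "\<dots> = (exp (- G (a + ln \<rho>)))\<^sup>2"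
  proof -
    have "0 < C - c" "0 < C + c" using C1 c_less c_pos by auto
    moreover have "(exp (- G (a + ln \<rho>)))\<^sup>2 = exp (- ln ((C + c) / (C - c)))"
      by (simp add: G_def C_def power2_eq_square exp_add[symmetric])
    ultimately show ?thesis by (simp add: exp_minus)
  qed
  finally show ?thesis unfolding \<rho>_def by (rule power2_le_imp_le) simp
qed

text \<open>Chosen so that |v| powr (-2 \<beta>) is comparable to |1 - z| powr (\<alpha> - 1), the
  weight in \<open>weighted_composition\<close>.\<close>

definition \<beta> where "\<beta> = (1 - \<alpha>) / (2 * \<alpha>)"

lemma \<beta>_pos: "0 < \<beta>" using \<alpha>_pos \<alpha>_less by (simp add: \<beta>_def)

text \<open>The zeros at the origin yield decay in m |v|, the same shape as the end effect A exp
  (-x) in \<open>sum_G_ge\<close>, where exp (-x) = |v|.\<close>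

lemma norm_\<phi>_power_le:
  assumes z: "norm z < 1"
  shows "norm (\<phi> z) ^ m \<le> exp (- real m * (2 * c / 3) * norm (v z))"
proof -
  define y where "y = c * norm (w z)"
  have y: "0 \<le> y" "y \<le> 2"
  proof -
    show "0 \<le> y" using c_pos by (simp add: y_def)
    have "y \<le> 1 * 2" unfolding y_def using c_pos c_less norm_w_le[OF z] by (intro mult_mono) auto
    then show "y \<le> 2" by simp
  qed
  have "norm (\<phi> z) \<le> 1 / (1 + y)" using norm_\<phi>_le[OF z] by (simp add: y_def)
  also have "1 / (1 + y) = 1 + - (y / (1 + y))" using y by (simp add: field_simps)
  also have "\<dots> \<le> exp (- (y / (1 + y)))" by (rule exp_ge_add_one_self)
  also have "\<dots> \<le> exp (- (2 * c / 3 * norm (v z)))"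
  proof -
    have "2 * c / 3 * norm (v z) \<le> 2 * c / 3 * (norm (w z) / 2)"
      using c_pos by (intro mult_left_mono v_properties[OF z]) auto
    also have "\<dots> = y / 3" by (simp add: y_def)
    also have "\<dots> \<le> y / (1 + y)" using y by (intro divide_left_mono) auto
    finally show ?thesis by simp
  qed
  finally have "norm (\<phi> z) ^ m \<le> exp (- (2 * c / 3 * norm (v z))) ^ m"
    by (rule power_mono) simp
  then show ?thesis by (simp add: exp_of_nat_mult[symmetric] mult.assoc)
qed

definition zeros :: "nat \<Rightarrow> nat \<Rightarrow> real list" where
  "zeros m N = replicate m 0 @
     map (\<lambda>k. zero_at (pi * sqrt (2 * \<alpha> * real N) - pi * sqrt (2 * \<alpha> * real (Suc k)))) [0..<N]"

lemma zeros_range: "set (zeros m N) \<subseteq> {0..<1}"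
proof -
  have "zero_at (pi * sqrt (2 * \<alpha> * real N) - pi * sqrt (2 * \<alpha> * real (Suc k))) \<in> {0..<1}" if "k < N" for k
    using that \<alpha>_pos by (intro zero_at_range) (auto intro!: mult_left_mono)
  then show ?thesis by (auto simp: zeros_def)
qed

text \<open>At this threshold for m the decay from \<open>norm_\<phi>_power_le\<close> absorbs the
  end effect; what remains is the discretisation loss \<open>G 0\<close>.\<close>

lemma blaschke_zeros_le:
  assumes z: "norm z < 1" and m: "3 / (2 * c) * ((1 - \<alpha>) / \<alpha>) * (pi * sqrt (2 * \<alpha> * real N)) \<le> real m"
  shows "norm (blaschke_prod (zeros m N) (\<phi> z))
    \<le> exp (G 0 - \<beta> * (pi * sqrt (2 * \<alpha> * real N))) * norm (v z) powr (- \<beta>)"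
proof -
  define A where "A = pi * sqrt (2 * \<alpha> * real N)"
  define x where "x = - ln (norm (v z))"
  have v: "0 < norm (v z)" "norm (v z) \<le> 1" using v_properties[OF z] norm_w_le[OF z] by auto
  have ex: "exp (- x) = norm (v z)" using v by (simp add: x_def)
  have x0: "0 \<le> x" using v by (simp add: x_def)
  have target: "exp (G 0 - \<beta> * A) * norm (v z) powr (- \<beta>) = exp (G 0 - \<beta> * (A - x))"
    using v by (simp add: powr_def x_def exp_add[symmetric] algebra_simps)
  have "norm (blaschke_prod (zeros m N) (\<phi> z)) \<le> exp (G 0 - \<beta> * (A - x))"
  proof (cases "x \<le> A")
    \<comment> \<open>Closer to the vertex than all zeros the claim is weaker than |B| <= 1.\<close>
    case False
    then have "\<beta> * (A - x) \<le> 0" using \<beta>_pos by (simp add: mult_le_0_iff)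
    then have "1 \<le> exp (G 0 - \<beta> * (A - x))" using G_nonneg[of 0] by simp
    then show ?thesis using blaschke_prod_le_1[OF zeros_range norm_\<phi>_less[OF z], of m N] by linarith
  next
    case True
    define a where "a k = A - pi * sqrt (2 * \<alpha> * real (Suc k))" for k
    have "blaschke_prod (zeros m N) (\<phi> z) = \<phi> z ^ m * (\<Prod>k<N. blaschke_factor (zero_at (a k)) (\<phi> z))"
      unfolding blaschke_prod_def zeros_def a_def A_def
      by (simp add: prod_list_replicate blaschke_factor_def o_def interv_sum_list_conv_sum_set_nat atLeast0LessThan
          prod.distinct_set_conv_list[symmetric])
    then have "norm (blaschke_prod (zeros m N) (\<phi> z)) = norm (\<phi> z) ^ m * (\<Prod>k<N. norm (blaschke_factor (zero_at (a k)) (\<phi> z)))"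
      by (simp add: norm_mult norm_power prod_norm)
    also have "\<dots> \<le> exp (- real m * (2 * c / 3) * norm (v z)) * (\<Prod>k<N. exp (- G (a k + ln (norm (v z)))))"
      by (intro mult_mono norm_\<phi>_power_le[OF z] prod_mono conjI blaschke_factor_zero_at_le[OF z] prod_nonneg) auto
    also have "\<dots> = exp (- real m * (2 * c / 3) * exp (- x) - (\<Sum>k<N. G (A - x - pi * sqrt (2 * \<alpha> * real (Suc k)))))"
      using v by (simp add: ex exp_sum[symmetric] exp_add[symmetric] sum_negf a_def x_def algebra_simps)
    also have "\<dots> \<le> exp (G 0 - \<beta> * (A - x))"
    proof -
      have "(1 - \<alpha>) / \<alpha> * A = (3 / (2 * c) * ((1 - \<alpha>) / \<alpha>) * A) * (2 * c / 3)"
        using c_pos \<alpha>_pos by (simp add: divide_simps)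
      also have "\<dots> \<le> real m * (2 * c / 3)"
        using m c_pos unfolding A_def by (intro mult_right_mono) auto
      finally have "(1 - \<alpha>) / \<alpha> * A * exp (- x) \<le> real m * (2 * c / 3) * exp (- x)"
        by (intro mult_right_mono) auto
      then show ?thesis using sum_G_ge[of x N] x0 True unfolding A_def[symmetric] \<beta>_def[symmetric]
        by simp
    qed
    finally show ?thesis .
  qed
  then show ?thesis using target by (simp add: A_def)
qed

lemma v_powr_le:
  assumes z: "norm z < 1"
  shows "(norm (v z) powr (- \<beta>))\<^sup>2 \<le> (4 powr \<beta>)\<^sup>2 * norm (1 - z) powr (\<alpha> - 1)"
proof -
  have d: "0 < norm (1 - z)" using z by auto
  have "norm (v z) powr (- \<beta>) \<le> (norm (w z) / 4) powr (- \<beta>)"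
    using v_properties[OF z] w_nonzero[OF z] \<beta>_pos by (intro powr_mono2') auto
  also have "\<dots> = 4 powr \<beta> * norm (1 - z) powr (- (\<alpha> * \<beta>))"
    using d by (simp add: norm_w powr_divide powr_powr powr_minus field_simps)
  finally have "(norm (v z) powr (- \<beta>))\<^sup>2 \<le> (4 powr \<beta> * norm (1 - z) powr (- (\<alpha> * \<beta>)))\<^sup>2"
    by (rule power_mono) simp
  also have "\<dots> = (4 powr \<beta>)\<^sup>2 * norm (1 - z) powr (\<alpha> - 1)"
  proof -
    have "- (\<alpha> * \<beta>) + - (\<alpha> * \<beta>) = \<alpha> - 1" using \<alpha>_pos by (simp add: \<beta>_def field_simps)
    then have "(norm (1 - z) powr (- (\<alpha> * \<beta>)))\<^sup>2 = norm (1 - z) powr (\<alpha> - 1)"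
      unfolding power2_eq_square powr_add[symmetric] by (rule arg_cong)
    then show ?thesis by (simp only: power_mult_distrib)
  qed
  finally show ?thesis .
qed

lemma approx_number_upper:
  "\<exists>C>0. \<forall>n\<ge>1. approx_number (comp_op \<phi>) n \<le> C * exp (- pi * (1 - \<alpha>) * sqrt (real n / (2 * \<alpha>)))"
proof -
  define \<gamma> where "\<gamma> = \<beta> * (pi * sqrt (2 * \<alpha>))"
  \<comment> \<open>About \<kappa> sqrt n zeros go to the origin. They cost sqrt n - sqrt N <=
    \<kappa> + 2, hence exp (\<gamma> (\<kappa> + 2)) in \<open>C\<close>; the summand sqrt 2 covers
    the n with m >= n.\<close>
  define \<kappa> where "\<kappa> = 3 / (2 * c) * ((1 - \<alpha>) / \<alpha>) * (pi * sqrt (2 * \<alpha>))"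
  define C where "C = (exp (G 0) * 4 powr \<beta> + sqrt 2) * sqrt Cw * exp (\<gamma> * (\<kappa> + 2))"
  have \<gamma>: "0 < \<gamma>" using \<beta>_pos \<alpha>_pos by (simp add: \<gamma>_def)
  have \<kappa>: "0 < \<kappa>" using c_pos \<alpha>_pos \<alpha>_less by (simp add: \<kappa>_def)
  have C: "0 < C" using Cw_pos by (simp add: C_def add_pos_pos)
  have rate: "- pi * (1 - \<alpha>) * sqrt (real n / (2 * \<alpha>)) = - \<gamma> * sqrt (real n)" for n
  proof -
    have "sqrt (2 * \<alpha>) * sqrt (2 * \<alpha>) = 2 * \<alpha>" using \<alpha>_pos by simp
    then have "sqrt (2 * \<alpha>) / (2 * \<alpha>) = 1 / sqrt (2 * \<alpha>)"
      using \<alpha>_pos by (simp add: real_div_sqrt field_simps)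
    moreover have "\<gamma> = pi * (1 - \<alpha>) * (sqrt (2 * \<alpha>) / (2 * \<alpha>))" by (simp add: \<gamma>_def \<beta>_def)
    ultimately show ?thesis by (simp add: real_sqrt_divide)
  qed
  have "approx_number (comp_op \<phi>) n \<le> C * exp (- \<gamma> * sqrt (real n))" if n: "1 \<le> n" for n
  proof -
    define m where "m = nat \<lceil>\<kappa> * sqrt (real n)\<rceil>"
    have m1: "\<kappa> * sqrt (real n) \<le> real m" unfolding m_def by linarith
    have m2: "real m \<le> \<kappa> * sqrt (real n) + 1"
      unfolding m_def using \<kappa> by (smt (verit) mult_nonneg_nonneg of_nat_nat real_sqrt_ge_zero of_nat_0_le_iff zero_le_ceiling ceiling_correct)
    have sn: "1 \<le> sqrt (real n)" using n by simp
    show ?thesis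
    proof (cases "m < n")
      case True
      \<comment> \<open>Rank less than n allows n - 1 zeros, m of them at the origin.\<close>
      define N where "N = n - 1 - m"
      define A where "A = pi * sqrt (2 * \<alpha> * real N)"
      define M where "M = (exp (G 0 - \<beta> * A) * 4 powr \<beta>)\<^sup>2"
      have "N \<le> n" by (simp add: N_def)
      have A: "A = pi * sqrt (2 * \<alpha>) * sqrt (real N)" by (simp add: A_def real_sqrt_mult)
      have mA: "3 / (2 * c) * ((1 - \<alpha>) / \<alpha>) * A \<le> real m"
      proof -
        have "3 / (2 * c) * ((1 - \<alpha>) / \<alpha>) * A = \<kappa> * sqrt (real N)" by (simp add: A \<kappa>_def)
        also have "\<dots> \<le> \<kappa> * sqrt (real n)" using \<kappa> \<open>N \<le> n\<close> by (intro mult_left_mono) auto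
        finally show ?thesis using m1 by linarith
      qed
      have "approx_number (comp_op \<phi>) n \<le> sqrt (M * Cw)"
      proof (rule approx_number_le_blaschke[OF zeros_range])
        show "length (zeros m N) < n" using True by (simp add: zeros_def N_def)
        show "0 \<le> M" by (simp add: M_def)
        fix z :: complex assume z: "norm z < 1"
        have "(norm (blaschke_prod (zeros m N) (\<phi> z)))\<^sup>2 \<le> (exp (G 0 - \<beta> * A) * norm (v z) powr (- \<beta>))\<^sup>2"
          using blaschke_zeros_le[OF z mA[unfolded A_def]] unfolding A_def by (rule power_mono) simp
        also have "\<dots> = (exp (G 0 - \<beta> * A))\<^sup>2 * (norm (v z) powr (- \<beta>))\<^sup>2" by (rule power_mult_distrib)
        also have "\<dots> \<le> (exp (G 0 - \<beta> * A))\<^sup>2 * ((4 powr \<beta>)\<^sup>2 * norm (1 - z) powr (\<alpha> - 1))"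
          by (intro mult_left_mono v_powr_le[OF z]) simp
        finally show "(norm (blaschke_prod (zeros m N) (\<phi> z)))\<^sup>2 \<le> M * norm (1 - z) powr (\<alpha> - 1)"
          by (simp add: M_def power_mult_distrib mult.assoc)
      qed
      also have "sqrt (M * Cw) = exp (G 0) * 4 powr \<beta> * sqrt Cw * exp (- \<beta> * A)"
      proof -
        have "sqrt M = exp (G 0 - \<beta> * A) * 4 powr \<beta>" by (simp add: M_def)
        moreover have "exp (G 0 - \<beta> * A) = exp (G 0) * exp (- \<beta> * A)" by (simp add: exp_add[symmetric])
        ultimately show ?thesis by (simp only: real_sqrt_mult mult_ac)
      qed
      also have "\<dots> \<le> exp (G 0) * 4 powr \<beta> * sqrt Cw * exp (\<gamma> * (\<kappa> + 2) - \<gamma> * sqrt (real n))"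
      proof (intro mult_left_mono)
        have "sqrt (real n) - sqrt (real N) \<le> \<kappa> + 2"
        proof -
          have "(sqrt (real n) - sqrt (real N)) * sqrt (real n) \<le> (sqrt (real n) - sqrt (real N)) * (sqrt (real n) + sqrt (real N))"
            using \<open>N \<le> n\<close> by (intro mult_left_mono) auto
          also have "\<dots> = real n - real N" by (simp add: algebra_simps)
          also have "\<dots> = real m + 1" using True by (simp add: N_def)
          also have "\<dots> \<le> (\<kappa> + 2) * sqrt (real n)" unfolding distrib_right using m2 sn by linarith
          finally show ?thesis using sn by simp
        qed
        then have "\<gamma> * (sqrt (real n) - sqrt (real N)) \<le> \<gamma> * (\<kappa> + 2)" using \<gamma> by (intro mult_left_mono) auto
        moreover have "\<beta> * A = \<gamma> * sqrt (real N)" by (simp add: A \<gamma>_def)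
        ultimately show "exp (- \<beta> * A) \<le> exp (\<gamma> * (\<kappa> + 2) - \<gamma> * sqrt (real n))" by (simp add: algebra_simps)
      qed (use Cw_pos in auto)
      also have "\<dots> \<le> C * exp (- \<gamma> * sqrt (real n))"
        using Cw_pos unfolding C_def by (simp add: exp_diff exp_minus divide_inverse mult.assoc[symmetric])
      finally show ?thesis .
    next
      case False
      \<comment> \<open>Here n <= m forces sqrt n <= \<kappa> + 2, so n is bounded and the zero
        operator is good enough.\<close>
      have "approx_number (comp_op \<phi>) n \<le> sqrt (2 * Cw)"
      proof (rule approx_number_le[OF comp_op_bounded_linear h2_bounded_linear_zero h2_rank_less_zero[OF n]])
        fix f assume f: "f \<in> H2" "h2_norm f \<le> 1"
        have "sqrt (2 * Cw) * h2_norm f \<le> sqrt (2 * Cw) * 1"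
          using f Cw_pos by (intro mult_left_mono) auto
        then show "h2_norm (\<lambda>z. comp_op \<phi> f z - 0) \<le> sqrt (2 * Cw)"
          using comp_op_bounded(2)[OF f(1)] by simp
      qed
      also have "\<dots> \<le> sqrt (2 * Cw) * exp (\<gamma> * (\<kappa> + 2) - \<gamma> * sqrt (real n))"
      proof -
        have "sqrt (real n) * sqrt (real n) \<le> (\<kappa> + 2) * sqrt (real n)"
        proof -
          have "real n \<le> real m" using False by simp
          moreover have "sqrt (real n) * sqrt (real n) = real n" by simp
          ultimately show ?thesis unfolding distrib_right using m2 sn by linarith
        qed
        then have "sqrt (real n) \<le> \<kappa> + 2" by (rule mult_right_le_imp_le) (use sn in linarith)
        then have "\<gamma> * sqrt (real n) \<le> \<gamma> * (\<kappa> + 2)" using \<gamma> by (intro mult_left_mono) auto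
        then have "1 \<le> exp (\<gamma> * (\<kappa> + 2) - \<gamma> * sqrt (real n))" by simp
        then show ?thesis using Cw_pos by (simp add: mult_le_cancel_left1)
      qed
      also have "\<dots> \<le> C * exp (- \<gamma> * sqrt (real n))"
        using Cw_pos unfolding C_def by (simp add: exp_diff exp_minus divide_inverse mult.assoc[symmetric] real_sqrt_mult)
      finally show ?thesis .
    qed
  qed
  then show ?thesis using C unfolding rate by blast
qed

end

section \<open>The lower bound\<close>

text \<open>On the normalised f the difference T - R acts as T; f may depend on the competitor
  R.\<close>

lemma approx_number_ge:
  assumes T: "h2_bounded_linear T" and n: "1 \<le> n"
    and "\<And>R. h2_bounded_linear R \<Longrightarrow> h2_rank_less R n \<Longrightarrow>
      \<exists>f\<in>H2. 0 < h2_norm f \<and> R f = (\<lambda>z. 0) \<and> \<epsilon> * h2_norm f \<le> h2_norm (T f)"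
  shows "\<epsilon> \<le> approx_number T n"
  unfolding approx_number_def
proof (rule cInf_greatest)
  show "{h2_op_norm (\<lambda>f z. T f z - R f z) |R. h2_bounded_linear R \<and> h2_rank_less R n} \<noteq> {}"
    using h2_bounded_linear_zero h2_rank_less_zero[OF n] by blast
  fix x assume "x \<in> {h2_op_norm (\<lambda>f z. T f z - R f z) |R. h2_bounded_linear R \<and> h2_rank_less R n}"
  then obtain R where x: "x = h2_op_norm (\<lambda>f z. T f z - R f z)" and R: "h2_bounded_linear R" "h2_rank_less R n"
    by blast
  obtain f where f: "f \<in> H2" "0 < h2_norm f" "R f = (\<lambda>z. 0)" "\<epsilon> * h2_norm f \<le> h2_norm (T f)"
    using assms(3)[OF R] by blast
  obtain C where C: "\<And>f. f \<in> H2 \<Longrightarrow> h2_norm (\<lambda>z. T f z - R f z) \<le> C * h2_norm f"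
    using H2_operator_diff_bound[OF T R(1)] by blast
  define a :: complex where "a = of_real (1 / h2_norm f)"
  have a: "norm a = 1 / h2_norm f" using f by (simp add: a_def norm_divide)
  let ?g = "\<lambda>z. a * f z"
  have g: "?g \<in> H2" "h2_norm ?g = 1" using h2_norm_cmult[OF f(1), of a] f(2) a by auto
  have Tf: "T f \<in> H2" using T f(1) by (auto simp: h2_bounded_linear_def)
  have "T ?g = (\<lambda>z. a * T f z)" "R ?g = (\<lambda>z. a * R f z)"
    using T R(1) f(1) by (auto simp: h2_bounded_linear_def)
  then have "(\<lambda>z. T ?g z - R ?g z) = (\<lambda>z. a * T f z)" using f(3) by simp
  then have "h2_norm (\<lambda>z. T ?g z - R ?g z) = h2_norm (T f) / h2_norm f"
    using h2_norm_cmult(2)[OF Tf, of a] a by simp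
  moreover have "\<epsilon> \<le> h2_norm (T f) / h2_norm f" using f by (simp add: field_simps)
  moreover have "h2_norm (\<lambda>z. T ?g z - R ?g z) \<le> x"
    unfolding x using h2_op_norm_ge[where T = "\<lambda>f z. T f z - R f z", OF C g(1)] g(2) by simp
  ultimately show "\<epsilon> \<le> x" by linarith
qed

text \<open>Gaussian elimination: an index with nonzero entry in the last equation is the pivot, and
  the other unknowns solve the reduced system.\<close>

lemma homogeneous_system_nontrivial:
  fixes d :: "'i \<Rightarrow> nat \<Rightarrow> 'a::field"
  assumes "finite I" "r < card I"
  shows "\<exists>c. (\<exists>i\<in>I. c i \<noteq> 0) \<and> (\<forall>j<r. (\<Sum>i\<in>I. c i * d i j) = 0)"
  using assms
proof (induction r arbitrary: I d)
  case 0
  then have "I \<noteq> {}" by auto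
  then show ?case by (intro exI[of _ "\<lambda>_. 1"]) auto
next
  case (Suc r)
  show ?case
  proof (cases "\<forall>i\<in>I. d i r = 0")
    case True
    obtain c where "\<exists>i\<in>I. c i \<noteq> 0" "\<forall>j<r. (\<Sum>i\<in>I. c i * d i j) = 0"
      using Suc.IH[OF Suc.prems(1)] Suc.prems(2) by (meson Suc_lessD)
    then show ?thesis using True by (intro exI[of _ c]) (auto simp: less_Suc_eq)
  next
    case False
    then obtain p where p: "p \<in> I" "d p r \<noteq> 0" by blast
    define J where "J = I - {p}"
    have J: "finite J" "p \<notin> J" "I = insert p J" using Suc.prems p by (auto simp: J_def)
    have "r < card J" using Suc.prems p by (simp add: J_def)
    then obtain c where c: "\<exists>i\<in>J. c i \<noteq> 0"
      "\<forall>j<r. (\<Sum>i\<in>J. c i * (d i j - d i r / d p r * d p j)) = 0"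
      using Suc.IH[OF J(1), of "\<lambda>i j. d i j - d i r / d p r * d p j"] by blast
    define b where "b = c(p := - (\<Sum>i\<in>J. c i * d i r) / d p r)"
    have sum_b: "(\<Sum>i\<in>I. b i * d i j) = (\<Sum>i\<in>J. c i * (d i j - d i r / d p r * d p j))" for j
    proof -
      have "(\<Sum>i\<in>J. b i * d i j) = (\<Sum>i\<in>J. c i * d i j)"
        using J(2) by (intro sum.cong) (auto simp: b_def)
      then show ?thesis
        using J by (simp add: b_def right_diff_distrib sum_subtractf sum_distrib_right sum_divide_distrib mult.assoc sum_negf)
    qed
    have "(\<Sum>i\<in>I. b i * d i r) = 0" unfolding sum_b using p by simp
    moreover have "\<exists>i\<in>I. b i \<noteq> 0" using c(1) J by (auto simp: b_def)
    ultimately show ?thesis using c(2) sum_b by (intro exI[of _ b]) (auto simp: less_Suc_eq)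
  qed
qed

text \<open>Coordinates of R (f i) along \<open>gs\<close> form a homogeneous system with fewer than
  n equations in M >= n unknowns.\<close>

lemma finite_rank_kernel:
  fixes f :: "nat \<Rightarrow> complex \<Rightarrow> complex"
  assumes R: "h2_bounded_linear R" "h2_rank_less R n" and M: "n \<le> M" and f: "\<And>i. f i \<in> H2"
  shows "\<exists>c. (\<exists>i<M. c i \<noteq> 0) \<and> R (\<lambda>z. \<Sum>i<M. c i * f i z) = (\<lambda>z. 0)"
proof -
  obtain gs where gs: "length gs < n" "\<And>f. f \<in> H2 \<Longrightarrow> \<exists>c::nat \<Rightarrow> complex. R f = (\<lambda>z. \<Sum>i<length gs. c i * (gs ! i) z)"
    using R(2) unfolding h2_rank_less_def by blast
  have "\<forall>i. \<exists>c::nat \<Rightarrow> complex. R (f i) = (\<lambda>z. \<Sum>j<length gs. c j * (gs ! j) z)" using gs(2) f by blast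
  then obtain d :: "nat \<Rightarrow> nat \<Rightarrow> complex" where d: "\<And>i. R (f i) = (\<lambda>z. \<Sum>j<length gs. d i j * (gs ! j) z)"
    by metis
  obtain c where c: "\<exists>i\<in>{..<M}. c i \<noteq> 0" "\<forall>j<length gs. (\<Sum>i<M. c i * d i j) = 0"
    using homogeneous_system_nontrivial[of "{..<M}" "length gs" d] gs(1) M by auto
  have lin: "R (\<lambda>z. \<Sum>i<m. c i * f i z) = (\<lambda>z. \<Sum>i<m. c i * R (f i) z)" for m
  proof (induction m)
    case 0
    have "\<forall>c. \<forall>f\<in>H2. R (\<lambda>z. c * f z) = (\<lambda>z. c * R f z)"
      using R(1) by (simp add: h2_bounded_linear_def)
    from bspec[OF spec[OF this, of 0] zero_H2] show ?case by simp
  next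
    case (Suc m)
    have H2: "(\<lambda>z. \<Sum>i<m. c i * f i z) \<in> H2" "(\<lambda>z. c m * f m z) \<in> H2"
      using H2_sum[of "{..<m}" f c] f h2_norm_cmult(1)[OF f] by auto
    have add: "\<forall>f\<in>H2. \<forall>g\<in>H2. R (\<lambda>z. f z + g z) = (\<lambda>z. R f z + R g z)"
      and cmult: "\<forall>c. \<forall>f\<in>H2. R (\<lambda>z. c * f z) = (\<lambda>z. c * R f z)"
      using R(1) by (simp_all add: h2_bounded_linear_def)
    note bspec[OF bspec[OF add H2(1)] H2(2)] bspec[OF spec[OF cmult, of "c m"] f[of m]]
    then have "R (\<lambda>z. (\<Sum>i<m. c i * f i z) + c m * f m z) = (\<lambda>z. (\<Sum>i<m. c i * R (f i) z) + c m * R (f m) z)"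
      by (simp only: Suc.IH)
    then show ?case by simp
  qed
  have "(\<Sum>i<M. c i * R (f i) z) = 0" for z
  proof -
    have "(\<Sum>i<M. c i * R (f i) z) = (\<Sum>j<length gs. (\<Sum>i<M. c i * d i j) * (gs ! j) z)"
      unfolding d sum_distrib_left sum_distrib_right by (subst sum.swap) (simp add: mult.assoc)
    then show ?thesis using c(2) by simp
  qed
  then show ?thesis using c(1) lin[of M] by (intro exI[of _ c]) auto
qed

text \<open>Each coefficient is the mean over m of the transform times a unimodular factor. The
  shift k, used to centre the frequencies, only alters phases.\<close>

lemma dft_coeff_bound:
  fixes b :: "nat \<Rightarrow> complex"
  assumes "\<And>m. m < M \<Longrightarrow> norm (\<Sum>i<M. b i * cis (- (2 * pi * ((real i - k) * real m / real M)))) \<le> X"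
    and i: "i < M"
  shows "norm (b i) \<le> X"
proof -
  define Q where "Q m = (\<Sum>j<M. b j * cis (- (2 * pi * ((real j - k) * real m / real M))))" for m
  have M: "0 < real M" using i by simp
  have ortho: "(\<Sum>m<M. cis (2 * pi * ((real i - real j) * real m / real M))) = (if j = i then of_nat M else 0)"
    if j: "j < M" for j
  proof (cases "j = i")
    case False
    define x where "x = 2 * pi * ((real i - real j) / real M)"
    have pow: "cis (2 * pi * ((real i - real j) * real m / real M)) = cis x ^ m" for m
    proof -
      have "2 * pi * ((real i - real j) * real m / real M) = real m * x" by (simp add: x_def)
      then show ?thesis by (simp only: Complex.DeMoivre)
    qed
    have "cis x ^ M = cis (2 * pi * (real i - real j))"
      using M by (simp add: x_def Complex.DeMoivre)
    also have "\<dots> = 1" by (rule cis_multiple_2pi) auto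
    finally have one: "cis x ^ M = 1" .
    \<comment> \<open>0 < |i - j| < M excludes that M divides i - j.\<close>
    have "cis x \<noteq> 1"
    proof
      assume "cis x = 1"
      then obtain l :: int where "x = of_int (2 * l) * pi"
        unfolding cis_conv_exp exp_eq_1 by auto
      then have "2 * pi * ((real i - real j) / real M) = 2 * pi * of_int l" by (simp add: x_def)
      then have "(real i - real j) / real M = of_int l"
        by (rule mult_left_cancel[THEN iffD1, rotated]) simp
      then have l: "real i - real j = of_int l * real M" using M by (simp add: field_simps)
      then have "real_of_int (int i - int j) = real_of_int (l * int M)" by simp
      then have "int i - int j = l * int M" by (simp only: of_int_eq_iff)
      moreover have "\<bar>int i - int j\<bar> < int M" using i j by auto
      ultimately have "\<bar>l\<bar> * int M < 1 * int M" by (simp add: abs_mult)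
      then have "l = 0" using M by (simp add: mult_less_cancel_right)
      then show False using l False by simp
    qed
    moreover have "(1 - cis x) * (\<Sum>m<M. cis x ^ m) = 1 - cis x ^ M"
      by (rule one_diff_power_eq[symmetric])
    ultimately show ?thesis unfolding pow using one False by simp
  qed simp
  have "(\<Sum>m<M. Q m * cis (2 * pi * ((real i - k) * real m / real M)))
      = (\<Sum>m<M. \<Sum>j<M. b j * cis (2 * pi * ((real i - real j) * real m / real M)))"
    unfolding Q_def sum_distrib_right mult.assoc cis_mult
    by (intro sum.cong refl arg_cong2[where f = "(*)"] arg_cong[where f = cis]) (use M in \<open>simp add: field_simps\<close>)
  also have "\<dots> = (\<Sum>j<M. b j * (\<Sum>m<M. cis (2 * pi * ((real i - real j) * real m / real M))))"
    by (subst sum.swap) (simp add: sum_distrib_left)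
  also have "\<dots> = (\<Sum>j<M. if j = i then b j * of_nat M else 0)"
    using ortho by (intro sum.cong) auto
  also have "\<dots> = b i * of_nat M" using i by simp
  finally have "real M * norm (b i) = norm (\<Sum>m<M. Q m * cis (2 * pi * ((real i - k) * real m / real M)))"
    by (simp add: norm_mult mult.commute)
  also have "\<dots> \<le> (\<Sum>m<M. norm (Q m))"
    by (rule order_trans[OF norm_sum]) (simp add: norm_mult)
  also have "\<dots> \<le> (\<Sum>m<M. X)" using assms(1) by (intro sum_mono) (auto simp: Q_def)
  finally show ?thesis using M by simp
qed

section \<open>Test functions with a power singularity at 1\<close>

definition test_fun :: "complex \<Rightarrow> complex \<Rightarrow> complex" where
  "test_fun s z = (if z \<in> ball 0 1 then (1 - z) powr s else 0)"

text \<open>|(1 - z) powr s| is |1 - z| powr Re s times exp (-Im s arg (1 - z)), with argument at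
  most pi/2 in modulus. The exponent 2 \<eta> - 1 > -1 is integrable with integral 1 / (2
  \<eta>).\<close>

lemma test_fun_H2:
  assumes \<eta>: "0 < \<eta>" "\<eta> \<le> 1 / 2" and s: "Re s = \<eta> - 1 / 2"
  shows "test_fun s \<in> H2 \<and> h2_norm (test_fun s) \<le> sqrt (1 / \<eta>) * exp (pi / 2 * \<bar>Im s\<bar>)"
proof (rule H2_I)
  have re: "0 < Re (1 - z)" if "norm z < 1" for z
    using complex_Re_le_cmod[of z] that by simp
  have "1 - z \<notin> \<real>\<^sub>\<le>\<^sub>0" if "z \<in> ball 0 1" for z :: complex
    using re[of z] that complex_nonpos_Reals_iff by auto
  then have "(\<lambda>z. (1 - z) powr s) holomorphic_on ball 0 1" by (intro holomorphic_intros) auto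
  then show hol: "test_fun s holomorphic_on ball 0 1"
    by (rule holomorphic_transform) (simp add: test_fun_def)
  define E where "E = exp (pi * \<bar>Im s\<bar>)"
  define h where "h t = ennreal (E * t powr (2 * \<eta> - 1))" for t
  have h_meas: "h \<in> borel_measurable borel" unfolding h_def by measurable
  have bound: "(norm (test_fun s z))\<^sup>2 \<le> E * t powr (2 * \<eta> - 1)"
    if z: "norm z < 1" and t: "0 < t" "t \<le> norm (1 - z)" for z t
  proof -
    have nz: "1 - z \<noteq> 0" using re[OF z] by auto
    have arg: "\<bar>Im (Ln (1 - z))\<bar> \<le> pi / 2" using Re_Ln_pos_lt[OF nz] re[OF z] by simp
    have "norm (test_fun s z) = exp (Re s * ln (norm (1 - z)) - Im s * Im (Ln (1 - z)))"
      using z nz by (simp add: test_fun_def powr_def norm_exp_eq_Re)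
    also have "\<dots> \<le> exp (Re s * ln (norm (1 - z)) + pi / 2 * \<bar>Im s\<bar>)"
    proof -
      have "- (Im s * Im (Ln (1 - z))) \<le> \<bar>Im s\<bar> * \<bar>Im (Ln (1 - z))\<bar>"
        by (metis abs_ge_minus_self abs_mult)
      also have "\<dots> \<le> \<bar>Im s\<bar> * (pi / 2)" by (intro mult_left_mono arg) auto
      finally show ?thesis by (simp add: mult.commute)
    qed
    also have "\<dots> = norm (1 - z) powr Re s * exp (pi / 2 * \<bar>Im s\<bar>)"
      using nz by (simp add: powr_def exp_add)
    finally have "(norm (test_fun s z))\<^sup>2 \<le> (norm (1 - z) powr Re s * exp (pi / 2 * \<bar>Im s\<bar>))\<^sup>2"
      by (rule power_mono) simp
    also have "\<dots> = E * norm (1 - z) powr (2 * \<eta> - 1)"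
      using s by (simp add: power2_eq_square E_def powr_add[symmetric] exp_add[symmetric] mult_ac)
    also have "\<dots> \<le> E * t powr (2 * \<eta> - 1)"
      using t \<eta> by (intro mult_left_mono powr_mono2') (auto simp: E_def)
    finally show ?thesis .
  qed
  have int: "(\<integral>\<^sup>+t\<in>{0..1}. h t \<partial>lborel) \<le> ennreal (E / (2 * \<eta>))"
  proof -
    have "((\<lambda>t. E * t powr (2 * \<eta> - 1)) has_integral E * (1 powr (2 * \<eta> - 1 + 1) / (2 * \<eta> - 1 + 1))) {0..1}"
      by (intro has_integral_mult_right has_integral_powr_from_0) (use \<eta> in auto)
    then have I: "((\<lambda>t. E * t powr (2 * \<eta> - 1)) has_integral E / (2 * \<eta>)) {0..1}" by simp
    have "(\<integral>\<^sup>+t\<in>{0..1}. h t \<partial>lborel) = (\<integral>\<^sup>+t. ennreal (indicator {0..1} t * (E * t powr (2 * \<eta> - 1))) \<partial>lborel)"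
      unfolding h_def by (intro nn_integral_cong) (auto simp: indicator_def)
    also have "\<dots> = ennreal (E / (2 * \<eta>))"
      by (rule nn_integral_has_integral_lebesgue[OF _ I]) (simp add: E_def)
    finally show ?thesis by simp
  qed
  show "0 \<le> sqrt (1 / \<eta>) * exp (pi / 2 * \<bar>Im s\<bar>)" using \<eta> by simp
  fix m
  have "(\<Sum>n<m. (norm (h2_coeff (test_fun s) n))\<^sup>2) \<le> 2 * (E / (2 * \<eta>))"
  proof (rule circle_mean_bound[OF hol h_meas _ int])
    fix r t :: real assume rt: "0 < r" "r < 1" "0 < t" "t < 1"
    have "ennreal ((norm (test_fun s (of_real r * cis (2 * pi * t))))\<^sup>2) \<le> h (min t (1 - t))"
      unfolding h_def
    proof (intro ennreal_leI bound)
      show "0 < min t (1 - t)" using rt by simp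
      then show "min t (1 - t) \<le> norm (1 - of_real r * cis (2 * pi * t))"
        using order_trans[OF _ norm_one_minus_circle_ge[OF rt], of "min t (1 - t)"] by simp
    qed (use rt in \<open>simp add: norm_mult\<close>)
    also have "\<dots> \<le> h t + h (1 - t)" by (simp add: min_def add_increasing add_increasing2)
    finally show "ennreal ((norm (test_fun s (of_real r * cis (2 * pi * t))))\<^sup>2) \<le> h t + h (1 - t)" .
  qed (use \<eta> in \<open>simp add: E_def\<close>)
  also have "2 * (E / (2 * \<eta>)) = (sqrt (1 / \<eta>) * exp (pi / 2 * \<bar>Im s\<bar>))\<^sup>2"
  proof -
    have "(exp (pi / 2 * \<bar>Im s\<bar>))\<^sup>2 = E" by (simp add: E_def power2_eq_square exp_add[symmetric])
    moreover have "(sqrt (1 / \<eta>))\<^sup>2 = 1 / \<eta>" using \<eta> by simp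
    ultimately show ?thesis by (simp add: power_mult_distrib)
  qed
  finally show "(\<Sum>n<m. (norm (h2_coeff (test_fun s) n))\<^sup>2) \<le> (sqrt (1 / \<eta>) * exp (pi / 2 * \<bar>Im s\<bar>))\<^sup>2" .
qed (simp add: test_fun_def)

section \<open>Sampling on two rays\<close>

context lens_symbol
begin

text \<open>The rays \<open>arg (1 - \<zeta>) = \<plusminus>\<alpha>\<^sup>2 \<pi> / 2\<close> lie, near the vertex, inside the image of a Stolz angle:
  any opening smaller than \<open>\<alpha> \<pi>\<close> would do here, and \<open>\<alpha>\<^sup>2 \<pi>\<close> is close enough to \<open>\<alpha> \<pi>\<close> for the estimate of
  the exponent.\<close>
lemma preimage_of_ray:
  "\<exists>u0 K. 0 \<le> u0 \<and> 0 < K \<and> (\<forall>u\<ge>u0. \<forall>\<sigma>. \<bar>\<sigma>\<bar> = 1 \<longrightarrow>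
     (\<exists>z. norm z < 1 \<and> 1 - \<phi> z = exp (Complex (- u) (\<sigma> * (\<alpha>\<^sup>2 * pi / 2)))
        \<and> K * exp (- u / \<alpha>) \<le> 1 - (norm z)\<^sup>2))"
proof -
  \<comment> \<open>b is the mean of \<alpha> pi/2 and pi/2, and \<epsilon> is half of \<alpha> b -
    \<tau>, which leaves room for the argument of 1 - x. The three terms of \<open>u0\<close> ensure
    |x| <= \<epsilon>, |x| <= 1/4 and |y| <= cos b.\<close>
  define \<epsilon> where "\<epsilon> = \<alpha> * pi * (1 - \<alpha>) / 8"
  define b where "b = pi * (1 + \<alpha>) / 4"
  define \<tau> where "\<tau> = \<alpha>\<^sup>2 * pi / 2"
  define u0 where "u0 = max (max (- ln \<epsilon>) (ln 4)) (ln 2 - \<alpha> * ln (cos b))"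
  define K where "K = cos b * exp (- ln 2 / \<alpha>)"
  have \<epsilon>: "0 < \<epsilon>" using \<alpha>_pos \<alpha>_less by (simp add: \<epsilon>_def)
  have b: "0 < b" "b < pi / 2" using \<alpha>_pos \<alpha>_less by (auto simp: b_def)
  have cb: "0 < cos b" using b by (intro cos_gt_zero) auto
  have K: "0 < K" using cb by (simp add: K_def)
  have \<tau>: "0 < \<tau>" "\<tau> < pi"
  proof -
    show "0 < \<tau>" using \<alpha>_pos by (simp add: \<tau>_def)
    have "\<alpha>\<^sup>2 < 1" using \<alpha>_pos \<alpha>_less by (simp add: power_less_one_iff)
    then have "\<alpha>\<^sup>2 * pi < 1 * pi" by (intro mult_strict_right_mono) auto
    then show "\<tau> < pi" using pi_gt_zero by (simp add: \<tau>_def)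
  qed
  have "0 \<le> ln (4::real)" by simp
  then have u0: "0 \<le> u0" by (simp add: u0_def le_max_iff_disj)
  have main: "\<exists>z. norm z < 1 \<and> 1 - \<phi> z = exp (Complex (- u) (\<sigma> * \<tau>)) \<and> K * exp (- u / \<alpha>) \<le> 1 - (norm z)\<^sup>2"
    if u: "u0 \<le> u" and \<sigma>: "\<bar>\<sigma>\<bar> = 1" for u \<sigma>
  proof -
    define l where "l = Complex (- u) (\<sigma> * \<tau>)"
    define x where "x = exp l"
    have nx: "norm x = exp (- u)" by (simp add: x_def l_def norm_exp_eq_Re)
    have nx_\<epsilon>: "norm x \<le> \<epsilon>" "norm x \<le> 1 / 4"
    proof -
      have "exp (- u) \<le> exp (ln \<epsilon>)" "exp (- u) \<le> exp (- ln 4)" using u by (auto simp: u0_def)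
      then show "norm x \<le> \<epsilon>" "norm x \<le> 1 / 4" using \<epsilon> by (auto simp: nx exp_minus)
    qed
    have n1x: "1 / 2 \<le> norm (1 - x)" "norm (1 - x) \<le> 2"
      using norm_triangle_ineq2[of 1 x] norm_triangle_ineq4[of 1 x] nx_\<epsilon> by auto
    have nz1x: "1 - x \<noteq> 0" using n1x by auto
    define L where "L = Ln (1 - x)"
    have ReL: "Re L = ln (norm (1 - x))" using nz1x by (simp add: L_def)
    have ReL_b: "- ln 2 \<le> Re L" "Re L \<le> ln 2"
    proof -
      have "ln (1 / 2) \<le> ln (norm (1 - x))" "ln (norm (1 - x)) \<le> ln 2"
        using n1x nz1x by (auto intro: ln_mono)
      then show "- ln 2 \<le> Re L" "Re L \<le> ln 2" by (auto simp: ReL ln_div)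
    qed
    have "norm L \<le> 2 * norm (- x)"
      unfolding L_def using norm_Ln_le[of "- x"] nx_\<epsilon> by simp
    then have ImL: "\<bar>Im L\<bar> \<le> 2 * \<epsilon>" using abs_Im_le_cmod[of L] nx_\<epsilon> by simp
    \<comment> \<open>y = 1 - z is found by inverting the symbol: w z = x / (1 - x) for x = 1 -
      \<phi> z. Going through logarithms keeps the power on its principal branch.\<close>
    define q where "q = (l - L) / of_real \<alpha>"
    define y where "y = exp q"
    have Imq: "\<bar>Im q\<bar> \<le> b"
    proof -
      have "\<bar>Im (l - L)\<bar> \<le> \<bar>\<sigma> * \<tau>\<bar> + \<bar>Im L\<bar>"
        using abs_triangle_ineq4[of "\<sigma> * \<tau>" "Im L"] by (simp add: l_def)
      also have "\<dots> \<le> \<tau> + 2 * \<epsilon>" using ImL \<sigma> \<tau> by (simp add: abs_mult)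
      also have "\<dots> = b * \<alpha>" by (simp add: \<tau>_def \<epsilon>_def b_def power2_eq_square field_simps)
      finally show ?thesis using \<alpha>_pos by (simp add: q_def Im_divide_of_real abs_divide field_simps)
    qed
    have Req: "Re q = (- u - Re L) / \<alpha>" by (simp add: q_def l_def Re_divide_of_real)
    have ny: "norm y = exp ((- u - Re L) / \<alpha>)" by (simp add: y_def norm_exp_eq_Re Req)
    have ny_le: "norm y \<le> cos b"
    proof -
      have "- u - Re L \<le> \<alpha> * ln (cos b)" using u ReL_b by (simp add: u0_def)
      then have "(- u - Re L) / \<alpha> \<le> ln (cos b)" using \<alpha>_pos by (simp add: field_simps)
      then show ?thesis unfolding ny using cb by (metis exp_le_cancel_iff exp_ln)
    qed
    have ny_ge: "exp (- ln 2 / \<alpha>) * exp (- u / \<alpha>) \<le> norm y"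
    proof -
      have "(- ln 2 + - u) / \<alpha> \<le> (- u - Re L) / \<alpha>"
        using ReL_b \<alpha>_pos by (intro divide_right_mono) auto
      then show ?thesis unfolding ny exp_add[symmetric] exp_le_cancel_iff add_divide_distrib[symmetric] .
    qed
    have Rey: "norm y * cos b \<le> Re y"
    proof -
      have "cos b \<le> cos \<bar>Im q\<bar>" using Imq b by (intro cos_monotone_0_pi_le) auto
      then have "cos b \<le> cos (Im q)" by (simp add: abs_if split: if_splits)
      then show ?thesis unfolding y_def by (simp add: Re_exp norm_exp_eq_Re)
    qed
    have mod: "1 - (norm (1 - y))\<^sup>2 = 2 * Re y - (norm y)\<^sup>2"
      unfolding cmod_power2 by (simp add: power2_eq_square algebra_simps)
    have ypos: "0 < norm y" by (simp add: y_def)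
    have "(norm y)\<^sup>2 \<le> norm y * cos b"
      unfolding power2_eq_square by (intro mult_left_mono ny_le) auto
    then have mod_ge: "norm y * cos b \<le> 1 - (norm (1 - y))\<^sup>2" using mod Rey by linarith
    have "K * exp (- u / \<alpha>) = (exp (- ln 2 / \<alpha>) * exp (- u / \<alpha>)) * cos b" by (simp add: K_def)
    also have "\<dots> \<le> norm y * cos b" using ny_ge cb by (intro mult_right_mono) auto
    finally have "K * exp (- u / \<alpha>) \<le> 1 - (norm (1 - y))\<^sup>2" using mod_ge by linarith
    moreover have "norm (1 - y) < 1"
    proof -
      have "0 < norm y * cos b" using ypos cb by simp
      then have "(norm (1 - y))\<^sup>2 < 1\<^sup>2" using mod_ge by simp
      then show ?thesis by (rule power_less_imp_less_base) simp
    qed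
    moreover have "1 - \<phi> (1 - y) = x"
    proof -
      have "Ln y = q" unfolding y_def using Imq b pi_gt_zero by (intro Ln_exp) auto
      then have "w (1 - y) = exp (l - L)"
        using \<alpha>_pos by (simp add: w_def powr_def y_def q_def)
      also have "\<dots> = x / (1 - x)" using nz1x by (simp add: exp_diff x_def L_def)
      finally have "1 + w (1 - y) = 1 / (1 - x)" using nz1x by (simp add: field_simps)
      then show ?thesis by (simp add: \<phi>_def)
    qed
    ultimately show ?thesis by (intro exI[of _ "1 - y"]) (simp add: x_def l_def)
  qed
  show ?thesis using main u0 K unfolding \<tau>_def by (intro exI[of _ u0] exI[of _ K]) blast
qed

lemma test_fun_at_ray:
  assumes z: "norm z < 1" and ray: "1 - \<phi> z = exp (Complex (- u) y)" and y: "\<bar>y\<bar> < pi"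
  shows "comp_op \<phi> (test_fun s) z = exp (s * Complex (- u) y)"
proof -
  have "Ln (exp (Complex (- u) y)) = Complex (- u) y" using y by (intro Ln_exp) auto
  then show ?thesis
    using z norm_\<phi>_less[OF z] by (simp add: comp_op_def test_fun_def powr_def ray)
qed

text \<open>Frequencies spaced by 2 pi / L are separated by M equidistant samples in a window of
  length L. The cost exp (\<beta> L) is that of point evaluation at the far end, reduced by the
  growth of the test functions, since 1/(2 \<alpha>) - 1/2 = \<beta>. The second exponent is
  \<kappa> K (pi/2 - \<tau>): growth of the test function norms minus growth along the rays.\<close>

lemma approx_number_lower_parametric:
  "\<exists>C>0. \<forall>n K L. 1 \<le> n \<longrightarrow> n \<le> 2 * K + 1 \<longrightarrow> 0 < L \<longrightarrow>
     1 / (C * real (2 * K + 1) * sqrt (L + 2) * exp (\<beta> * L + pi\<^sup>2 * real K * (1 - \<alpha>\<^sup>2) / L))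
      \<le> approx_number (comp_op \<phi>) n"
proof -
  obtain u0 k where u0: "0 \<le> u0" and k: "0 < k"
    and ray: "\<And>u \<sigma>. u0 \<le> u \<Longrightarrow> \<bar>\<sigma>\<bar> = 1 \<Longrightarrow>
     \<exists>z. norm z < 1 \<and> 1 - \<phi> z = exp (Complex (- u) (\<sigma> * (\<alpha>\<^sup>2 * pi / 2))) \<and> k * exp (- u / \<alpha>) \<le> 1 - (norm z)\<^sup>2"
    using preimage_of_ray by blast
  define C where "C = exp ((\<beta> + 1) * u0 + 1) / sqrt k"
  have C: "0 < C" using k by (simp add: C_def)
  define \<tau> where "\<tau> = \<alpha>\<^sup>2 * pi / 2"
  have a2: "0 < \<alpha>\<^sup>2" "\<alpha>\<^sup>2 < 1" using \<alpha>_pos \<alpha>_less by (auto simp: power_less_one_iff)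
  have \<tau>: "0 < \<tau>" "\<tau> < pi"
    using a2 mult_strict_right_mono[OF a2(2) pi_gt_zero] pi_gt_zero by (auto simp: \<tau>_def)
  have "1 / (C * real (2 * K + 1) * sqrt (L + 2) * exp (\<beta> * L + pi\<^sup>2 * real K * (1 - \<alpha>\<^sup>2) / L)) \<le> approx_number (comp_op \<phi>) n"
    if n: "1 \<le> n" "n \<le> 2 * K + 1" and L: "0 < L" for n K L
  proof (rule approx_number_ge[OF comp_op_bounded_linear n(1)])
    fix R assume R: "h2_bounded_linear R" "h2_rank_less R n"
    define M where "M = 2 * K + 1"
    \<comment> \<open>\<eta> L <= 1 keeps the loss exp (\<eta> u) bounded on the window, while 1 /
      \<eta> is polynomial in L; the 2 gives \<eta> <= 1/2.\<close>
    define \<eta> where "\<eta> = 1 / (L + 2)"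
    define \<kappa> where "\<kappa> = 2 * pi / L"
    define s where "s i = Complex (\<eta> - 1 / 2) (\<kappa> * (real i - real K))" for i :: nat
    have \<eta>: "0 < \<eta>" "\<eta> \<le> 1 / 2" using L by (auto simp: \<eta>_def field_simps)
    have \<kappa>: "0 < \<kappa>" using L by (simp add: \<kappa>_def)
    have M: "0 < M" by (simp add: M_def)
    have test: "test_fun (s i) \<in> H2" "h2_norm (test_fun (s i)) \<le> sqrt (1 / \<eta>) * exp (pi / 2 * (\<kappa> * \<bar>real i - real K\<bar>))" for i
      using test_fun_H2[OF \<eta>, of "s i"] \<kappa> by (auto simp: s_def abs_mult)
    obtain a where a: "\<exists>i<M. a i \<noteq> 0" "R (\<lambda>z. \<Sum>i<M. a i * test_fun (s i) z) = (\<lambda>z. 0)"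
      using finite_rank_kernel[OF R, of M "\<lambda>i. test_fun (s i)"] n test by (auto simp: M_def)
    define f where "f = (\<lambda>z. \<Sum>i<M. a i * test_fun (s i) z)"
    define X where "X = h2_norm (comp_op \<phi> f) * (C * exp (\<beta> * L))"
    have f: "f \<in> H2" "h2_norm f \<le> (\<Sum>i<M. norm (a i) * h2_norm (test_fun (s i)))"
      using H2_sum[of "{..<M}" "\<lambda>i. test_fun (s i)" a] test by (auto simp: f_def)
    have Cf: "comp_op \<phi> f \<in> H2" using comp_op_bounded f by blast
    have coeff: "norm (a i) * exp (\<kappa> * \<bar>real i - real K\<bar> * \<tau>) \<le> X" if i: "i < M" for i
    proof -
      \<comment> \<open>The ray follows the sign of the frequency, so that the i-th exponential is
        amplified there by exp (\<kappa> |i - K| \<tau>).\<close>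
      define \<sigma> :: real where "\<sigma> = (if real K \<le> real i then - 1 else 1)"
      have \<sigma>: "\<bar>\<sigma>\<bar> = 1" "\<sigma> * (real i - real K) = - \<bar>real i - real K\<bar>" by (auto simp: \<sigma>_def)
      \<comment> \<open>Collects what does not depend on the sample: the amplitude on the ray and
        the phase at u0.\<close>
      define b where "b j = a j * exp (of_real (- (\<kappa> * (real j - real K) * (\<sigma> * \<tau>)))) * cis (- (\<kappa> * (real j - real K) * u0))" for j :: nat
      have "norm (\<Sum>j<M. b j * cis (- (2 * pi * ((real j - real K) * real m / real M)))) \<le> X" if m: "m < M" for m
      proof -
        define u where "u = u0 + real m * L / real M"
        have u: "u0 \<le> u" "u \<le> u0 + L"
        proof -
          show "u0 \<le> u" using L by (simp add: u_def)
          have "real m * L \<le> real M * L" using m L by (intro mult_right_mono) auto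
          then show "u \<le> u0 + L" using M by (simp add: u_def field_simps)
        qed
        obtain z where z: "norm z < 1" and zr: "1 - \<phi> z = exp (Complex (- u) (\<sigma> * \<tau>))"
          and zk: "k * exp (- u / \<alpha>) \<le> 1 - (norm z)\<^sup>2"
          using ray[OF u(1) \<sigma>(1)] unfolding \<tau>_def by blast
        have \<sigma>\<tau>: "\<bar>\<sigma> * \<tau>\<bar> < pi" using \<sigma> \<tau> by (simp add: abs_mult)
        define e where "e = exp (of_real (\<eta> - 1 / 2) * Complex (- u) (\<sigma> * \<tau>))"
        have e: "norm e = exp ((1 / 2 - \<eta>) * u)" by (simp add: e_def norm_exp_eq_Re algebra_simps)
        have entry: "a j * exp (s j * Complex (- u) (\<sigma> * \<tau>)) = e * (b j * cis (- (2 * pi * ((real j - real K) * real m / real M))))" for j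
        proof -
          have \<kappa>u: "\<kappa> * (real j - real K) * u = \<kappa> * (real j - real K) * u0 + 2 * pi * ((real j - real K) * real m / real M)"
            using L M by (simp add: \<kappa>_def u_def field_simps)
          have "s j * Complex (- u) (\<sigma> * \<tau>) = of_real (\<eta> - 1 / 2) * Complex (- u) (\<sigma> * \<tau>)
              + of_real (- (\<kappa> * (real j - real K) * (\<sigma> * \<tau>))) + \<i> * of_real (- (\<kappa> * (real j - real K) * u))"
            by (simp add: s_def complex_eq_iff algebra_simps)
          then have "exp (s j * Complex (- u) (\<sigma> * \<tau>)) = e * exp (of_real (- (\<kappa> * (real j - real K) * (\<sigma> * \<tau>))))
              * cis (- (\<kappa> * (real j - real K) * u))"
            by (simp only: exp_add e_def cis_conv_exp)
          also have "cis (- (\<kappa> * (real j - real K) * u)) = cis (- (\<kappa> * (real j - real K) * u0))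
              * cis (- (2 * pi * ((real j - real K) * real m / real M)))"
            unfolding cis_mult \<kappa>u by simp
          finally show ?thesis by (simp add: b_def mult_ac)
        qed
        have "comp_op \<phi> f z = (\<Sum>j<M. a j * comp_op \<phi> (test_fun (s j)) z)"
          by (simp add: comp_op_def f_def)
        also have "\<dots> = e * (\<Sum>j<M. b j * cis (- (2 * pi * ((real j - real K) * real m / real M))))"
          unfolding test_fun_at_ray[OF z zr \<sigma>\<tau>] entry sum_distrib_left ..
        finally have val: "norm (comp_op \<phi> f z) = exp ((1 / 2 - \<eta>) * u) * norm (\<Sum>j<M. b j * cis (- (2 * pi * ((real j - real K) * real m / real M))))"
          by (simp add: norm_mult e)
        have "(norm (comp_op \<phi> f z))\<^sup>2 * (k * exp (- u / \<alpha>)) \<le> (norm (comp_op \<phi> f z))\<^sup>2 * (1 - (norm z)\<^sup>2)"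
          by (intro mult_left_mono zk) simp
        also have "\<dots> \<le> (h2_norm (comp_op \<phi> f))\<^sup>2" by (rule H2_point_evaluation[OF Cf z])
        finally have pe2: "(norm (comp_op \<phi> f z))\<^sup>2 * (k * exp (- u / \<alpha>)) \<le> (h2_norm (comp_op \<phi> f))\<^sup>2" .
        have "(norm (comp_op \<phi> f z) * (sqrt k * exp (- u / (2 * \<alpha>))))\<^sup>2 \<le> (h2_norm (comp_op \<phi> f))\<^sup>2"
        proof -
          have "(exp (- u / (2 * \<alpha>)))\<^sup>2 = exp (- u / \<alpha>)" by (simp add: power2_eq_square exp_add[symmetric])
          moreover have "(sqrt k)\<^sup>2 = k" using k by simp
          ultimately show ?thesis using pe2 by (simp only: power_mult_distrib)
        qed
        then have "norm (comp_op \<phi> f z) * (sqrt k * exp (- u / (2 * \<alpha>))) \<le> h2_norm (comp_op \<phi> f)"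
          using h2_norm_nonneg[OF Cf] by (rule power2_le_imp_le)
        then have pe: "norm (comp_op \<phi> f z) \<le> h2_norm (comp_op \<phi> f) * (exp (u / (2 * \<alpha>)) / sqrt k)"
          using k by (simp add: exp_minus field_simps)
        have "norm (\<Sum>j<M. b j * cis (- (2 * pi * ((real j - real K) * real m / real M)))) = norm (comp_op \<phi> f z) * exp (- ((1 / 2 - \<eta>) * u))"
          unfolding val by (simp add: exp_minus)
        also have "\<dots> \<le> h2_norm (comp_op \<phi> f) * (exp (u / (2 * \<alpha>)) / sqrt k) * exp (- ((1 / 2 - \<eta>) * u))"
          by (intro mult_right_mono pe) simp
        also have "\<dots> = h2_norm (comp_op \<phi> f) * (exp ((\<beta> + \<eta>) * u) / sqrt k)"
        proof -
          have "u / (2 * \<alpha>) + - ((1 / 2 - \<eta>) * u) = (\<beta> + \<eta>) * u"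
            using \<alpha>_pos by (simp add: \<beta>_def field_simps)
          then have "exp ((\<beta> + \<eta>) * u) = exp (u / (2 * \<alpha>)) * exp (- ((1 / 2 - \<eta>) * u))"
            by (simp only: exp_add[symmetric])
          then show ?thesis by simp
        qed
        also have "\<dots> \<le> h2_norm (comp_op \<phi> f) * (exp ((\<beta> + 1) * u0 + 1 + \<beta> * L) / sqrt k)"
        proof -
          have "(\<beta> + \<eta>) * u \<le> (\<beta> + \<eta>) * (u0 + L)"
            using u \<beta>_pos \<eta> by (intro mult_left_mono) auto
          also have "\<dots> = \<beta> * u0 + \<eta> * u0 + \<beta> * L + \<eta> * L" by (simp add: algebra_simps)
          also have "\<eta> * u0 \<le> 1 * u0" using \<eta> u0 by (intro mult_right_mono) auto
          also have "\<eta> * L \<le> 1" using L by (simp add: \<eta>_def)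
          finally have "(\<beta> + \<eta>) * u \<le> (\<beta> + 1) * u0 + 1 + \<beta> * L" by (simp add: algebra_simps)
          then show ?thesis using k h2_norm_nonneg[OF Cf] by (intro mult_left_mono divide_right_mono) auto
        qed
        also have "\<dots> = X" by (simp add: X_def C_def exp_add)
        finally show ?thesis .
      qed
      from dft_coeff_bound[OF this i] have "norm (b i) \<le> X" .
      moreover have "norm (b i) = norm (a i) * exp (\<kappa> * \<bar>real i - real K\<bar> * \<tau>)"
      proof -
        have "- (\<kappa> * (real i - real K) * (\<sigma> * \<tau>)) = - (\<kappa> * (\<sigma> * (real i - real K)) * \<tau>)" by (simp add: mult_ac)
        also have "\<dots> = \<kappa> * \<bar>real i - real K\<bar> * \<tau>" unfolding \<sigma>(2) by simp
        finally show ?thesis by (simp only: b_def norm_mult norm_cis norm_exp_eq_Re Re_complex_of_real mult_1_right)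
      qed
      ultimately show ?thesis by simp
    qed
    have \<tau>2: "\<tau> \<le> pi / 2" using a2 by (simp add: \<tau>_def)
    define Y where "Y = exp (\<kappa> * real K * (pi / 2 - \<tau>))"
    have "h2_norm f \<le> (\<Sum>i<M. X * (sqrt (1 / \<eta>) * Y))"
    proof (intro order_trans[OF f(2)] sum_mono)
      fix i assume i: "i \<in> {..<M}"
      then have iK: "\<bar>real i - real K\<bar> \<le> real K" by (auto simp: M_def)
      have "norm (a i) * h2_norm (test_fun (s i)) \<le> norm (a i) * (sqrt (1 / \<eta>) * exp (pi / 2 * (\<kappa> * \<bar>real i - real K\<bar>)))"
        by (intro mult_left_mono test) simp
      also have "\<dots> = norm (a i) * exp (\<kappa> * \<bar>real i - real K\<bar> * \<tau>) * (sqrt (1 / \<eta>) * exp (\<kappa> * \<bar>real i - real K\<bar> * (pi / 2 - \<tau>)))"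
      proof -
        have "pi / 2 * (\<kappa> * \<bar>real i - real K\<bar>) = \<kappa> * \<bar>real i - real K\<bar> * \<tau> + \<kappa> * \<bar>real i - real K\<bar> * (pi / 2 - \<tau>)"
          by (simp add: algebra_simps)
        then show ?thesis by (simp only: exp_add mult_ac)
      qed
      also have "\<dots> \<le> X * (sqrt (1 / \<eta>) * Y)"
      proof (intro mult_mono coeff)
        show "0 \<le> X" using coeff[of i] i by (smt (verit) exp_gt_zero lessThan_iff mult_nonneg_nonneg norm_ge_zero)
        show "exp (\<kappa> * \<bar>real i - real K\<bar> * (pi / 2 - \<tau>)) \<le> Y"
          unfolding Y_def using \<kappa> \<tau>2 iK by (auto intro!: mult_right_mono mult_left_mono)
      qed (use i \<eta> in auto)
      finally show "norm (a i) * h2_norm (test_fun (s i)) \<le> X * (sqrt (1 / \<eta>) * Y)" .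
    qed
    also have "\<dots> = h2_norm (comp_op \<phi> f) * (C * real M * sqrt (L + 2) * exp (\<beta> * L + pi\<^sup>2 * real K * (1 - \<alpha>\<^sup>2) / L))"
    proof -
      have "\<kappa> * real K * (pi / 2 - \<tau>) = pi\<^sup>2 * real K * (1 - \<alpha>\<^sup>2) / L"
        using L by (simp add: \<kappa>_def \<tau>_def power2_eq_square field_simps)
      then show ?thesis by (simp add: X_def Y_def \<eta>_def exp_add mult_ac)
    qed
    finally have upper: "h2_norm f \<le> \<dots>" .
    obtain i where i: "i < M" "a i \<noteq> 0" using a by blast
    \<comment> \<open>A nonzero coefficient makes X positive, hence \<open>comp_op \<phi> f\<close>
      and f are nonzero.\<close>
    have "0 < norm (a i) * exp (\<kappa> * \<bar>real i - real K\<bar> * \<tau>)" using i by simp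
    then have "0 < X" using coeff[OF i(1)] by linarith
    then have "0 < h2_norm (comp_op \<phi> f)"
      unfolding X_def by (rule zero_less_mult_pos2) (simp add: C)
    moreover have "h2_norm (comp_op \<phi> f) \<le> sqrt (2 * Cw) * h2_norm f" by (rule comp_op_bounded[OF f(1)])
    ultimately have "0 < sqrt (2 * Cw) * h2_norm f" by linarith
    then have "0 < h2_norm f" by (rule zero_less_mult_pos) (use Cw_pos in simp)
    moreover have "0 < C * real (2 * K + 1) * sqrt (L + 2) * exp (\<beta> * L + pi\<^sup>2 * real K * (1 - \<alpha>\<^sup>2) / L)"
      using C L by simp
    ultimately show "\<exists>f\<in>H2. 0 < h2_norm f \<and> R f = (\<lambda>z. 0) \<and>
       1 / (C * real (2 * K + 1) * sqrt (L + 2) * exp (\<beta> * L + pi\<^sup>2 * real K * (1 - \<alpha>\<^sup>2) / L)) * h2_norm f \<le> h2_norm (comp_op \<phi> f)"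
      using f(1) a(2) upper unfolding M_def[symmetric]
      by (intro bexI[of _ f]) (auto simp: f_def divide_le_eq)
  qed
  then show ?thesis using C by blast
qed

lemma approx_number_lower:
  "\<exists>c>0. \<forall>n\<ge>1. c * exp (- pi * (1 - \<alpha>) * sqrt (2 * real n / \<alpha>)) \<le> approx_number (comp_op \<phi>) n"
proof -
  obtain C where C: "0 < C" and lower: "\<And>n K L. 1 \<le> n \<Longrightarrow> n \<le> 2 * K + 1 \<Longrightarrow> 0 < L \<Longrightarrow>
     1 / (C * real (2 * K + 1) * sqrt (L + 2) * exp (\<beta> * L + pi\<^sup>2 * real K * (1 - \<alpha>\<^sup>2) / L))
      \<le> approx_number (comp_op \<phi>) n"
    using approx_number_lower_parametric by blast
  define a where "a = sqrt (2 * \<alpha>)"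
  have a: "0 < a" "a * a = 2 * \<alpha>" using \<alpha>_pos by (auto simp: a_def)
  define \<gamma> where "\<gamma> = \<beta> * (pi * a)"
  \<comment> \<open>Slack between the target exponent 2 \<gamma> sqrt n and what the parameters
    give; it pays for a factor cubic in sqrt n.\<close>
  define \<delta> where "\<delta> = \<gamma> * (1 - \<alpha>) / 2"
  define D where "D = C * (2 * (pi * a + 2)) * (3 / \<delta>) ^ 3"
  have \<gamma>: "0 < \<gamma>" using \<beta>_pos a by (simp add: \<gamma>_def)
  have \<delta>: "0 < \<delta>" using \<gamma> \<alpha>_less by (simp add: \<delta>_def)
  have D: "0 < D" using C \<delta> a by (simp add: D_def add_pos_pos)
  have \<gamma>a: "\<gamma> * a = pi * (1 - \<alpha>)"
  proof -
    have "\<gamma> * a = \<beta> * pi * (a * a)" by (simp add: \<gamma>_def)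
    also have "\<dots> = pi * (1 - \<alpha>)" unfolding a(2) using \<alpha>_pos by (simp add: \<beta>_def)
    finally show ?thesis .
  qed
  have rate: "- pi * (1 - \<alpha>) * sqrt (2 * real n / \<alpha>) = - (2 * \<gamma> * sqrt (real n))" for n
  proof -
    have "2 * real n / \<alpha> = 4 * real n / (2 * \<alpha>)" by simp
    then have "sqrt (2 * real n / \<alpha>) = sqrt (4 * real n) / a" unfolding a_def by (simp only: real_sqrt_divide)
    also have "sqrt (4 * real n) = 2 * sqrt (real n)" by (simp add: real_sqrt_mult)
    finally have "pi * (1 - \<alpha>) * sqrt (2 * real n / \<alpha>) = \<gamma> * a * (2 * sqrt (real n) / a)"
      unfolding \<gamma>a by simp
    also have "\<dots> = 2 * \<gamma> * sqrt (real n)" using a by simp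
    finally show ?thesis by simp
  qed
  have "1 / D * exp (- pi * (1 - \<alpha>) * sqrt (2 * real n / \<alpha>)) \<le> approx_number (comp_op \<phi>) n" if n: "1 \<le> n" for n
  proof -
    define t where "t = sqrt (real n)"
    have t: "1 \<le> t" "t * t = real n" using n by (auto simp: t_def)
    \<comment> \<open>The least K with n <= 2 K + 1. With L as below the first exponent is half of
      the target 2 \<gamma> t, and the second is at most \<gamma> (1 + \<alpha>) / 2 * t.\<close>
    define K where "K = n div 2"
    define L where "L = pi * a * t"
    have L: "0 < L" using a t by (simp add: L_def)
    have K: "n \<le> 2 * K + 1" "real K \<le> real n / 2" "real (2 * K + 1) \<le> 2 * real n"
      using n by (auto simp: K_def)
    have expo: "\<beta> * L + pi\<^sup>2 * real K * (1 - \<alpha>\<^sup>2) / L \<le> 2 * \<gamma> * t - \<delta> * t"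
    proof -
      have "pi\<^sup>2 * real K * (1 - \<alpha>\<^sup>2) / L \<le> pi\<^sup>2 * (real n / 2) * (1 - \<alpha>\<^sup>2) / L"
        using K L \<alpha>_pos \<alpha>_less by (intro divide_right_mono mult_right_mono mult_left_mono) (auto simp: power_le_one)
      also have "\<dots> = pi * (1 - \<alpha>) * (1 + \<alpha>) / 2 * t / a"
        using a t(1) unfolding t(2)[symmetric] L_def by (simp add: power2_eq_square field_simps)
      also have "\<dots> = \<gamma> * (1 + \<alpha>) / 2 * t" unfolding \<gamma>a[symmetric] using a by simp
      finally have "pi\<^sup>2 * real K * (1 - \<alpha>\<^sup>2) / L \<le> \<gamma> * (1 + \<alpha>) / 2 * t" .
      moreover have "\<beta> * L = \<gamma> * t" by (simp add: L_def \<gamma>_def)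
      moreover have "\<gamma> * t + \<gamma> * (1 + \<alpha>) / 2 * t = 2 * \<gamma> * t - \<delta> * t" by (simp add: \<delta>_def field_simps)
      ultimately show ?thesis by linarith
    qed
    have poly: "real (2 * K + 1) * sqrt (L + 2) \<le> 2 * (pi * a + 2) * ((3 / \<delta>) ^ 3 * exp (\<delta> * t))"
    proof -
      have "sqrt (L + 2) \<le> L + 2"
        using L by (intro real_le_lsqrt) (auto simp: power2_eq_square algebra_simps)
      also have "\<dots> \<le> (pi * a + 2) * t" using t by (simp add: L_def algebra_simps)
      finally have "real (2 * K + 1) * sqrt (L + 2) \<le> (2 * real n) * ((pi * a + 2) * t)"
        using K(3) L by (intro mult_mono) auto
      also have "\<dots> = 2 * (pi * a + 2) * t ^ 3" unfolding t(2)[symmetric] by (simp add: power3_eq_cube)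
      also have "t ^ 3 = (3 / \<delta>) ^ 3 * (\<delta> * t / 3) ^ 3" using \<delta> by (simp add: power_mult_distrib[symmetric])
      also have "(\<delta> * t / 3) ^ 3 \<le> exp (\<delta> * t / 3) ^ 3"
      proof (rule power_mono)
        show "\<delta> * t / 3 \<le> exp (\<delta> * t / 3)" using exp_ge_add_one_self[of "\<delta> * t / 3"] by linarith
      qed (use \<delta> t in simp)
      also have "exp (\<delta> * t / 3) ^ 3 = exp (\<delta> * t)" by (simp add: exp_of_nat_mult[symmetric])
      finally show ?thesis using a \<delta> by (simp add: mult_left_mono)
    qed
    have pos: "0 < C * real (2 * K + 1) * sqrt (L + 2) * exp (\<beta> * L + pi\<^sup>2 * real K * (1 - \<alpha>\<^sup>2) / L)"
      using C L by simp
    have "C * (real (2 * K + 1) * sqrt (L + 2)) * exp (\<beta> * L + pi\<^sup>2 * real K * (1 - \<alpha>\<^sup>2) / L)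
        \<le> C * (2 * (pi * a + 2) * ((3 / \<delta>) ^ 3 * exp (\<delta> * t))) * exp (2 * \<gamma> * t - \<delta> * t)"
      by (rule mult_mono[OF mult_left_mono[OF poly]]) (use C expo a \<delta> in auto)
    also have "\<dots> = D * exp (2 * \<gamma> * t)" by (simp add: D_def exp_diff)
    finally have "1 / (D * exp (2 * \<gamma> * t)) \<le> 1 / (C * real (2 * K + 1) * sqrt (L + 2) * exp (\<beta> * L + pi\<^sup>2 * real K * (1 - \<alpha>\<^sup>2) / L))"
      using pos unfolding mult.assoc[of C] by (intro divide_left_mono) (auto intro: less_le_trans mult_pos_pos)
    also have "\<dots> \<le> approx_number (comp_op \<phi>) n" by (rule lower[OF n K(1) L])
    finally show ?thesis unfolding rate by (simp add: t_def exp_minus field_simps)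
  qed
  then show ?thesis using D by (intro exI[of _ "1 / D"]) auto
qed

end

theorem theorem1p3:
  fixes \<alpha> :: real and \<phi> :: "complex \<Rightarrow> complex"
  assumes "0 < \<alpha>" and "\<alpha> < 1"
    and "\<phi> = (\<lambda>z. 1 / (1 + (1 - z) powr (complex_of_real \<alpha>)))"
  shows "\<exists>c>0. \<exists>C>0. \<forall>n::nat\<ge>1.
           c * exp (- pi * (1 - \<alpha>) * sqrt (2 * real n / \<alpha>)) \<le> approx_number (comp_op \<phi>) n
         \<and> approx_number (comp_op \<phi>) n \<le> C * exp (- pi * (1 - \<alpha>) * sqrt (real n / (2 * \<alpha>)))"
proof -
  interpret lens_symbol \<alpha> using assms by unfold_locales
  have "\<phi> = lens_symbol.\<phi> \<alpha>"
    unfolding assms(3) by (rule ext) (simp add: \<phi>_def w_def)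
  then show ?thesis using approx_number_lower approx_number_upper by metis
qed

end
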